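(* Let $V=\bigoplus_{d=0}^\infty V_d$ be a $C_2$-cofinite simple vertex operator algebra of CFT type. Then the $2$-cyclic permutation orbifold model $T^2(V)^{S_2}=(V\otimes V)^{S_2}$ is also $C_2$-cofinite.
   Context: All vertex operator algebras (VOAs) are over $\mathbb{C}$, $a_{(n)}b$ ($n\in\mathbb{Z}$) denotes the $n$-th product, $\mathbf{1}$ the vacuum vector, $\omega$ the Virasoro vector, and $V_d$ is the eigenspace of $L_0=\omega_{(1)}$ with eigenvalue $d$. A VOA $V=\bigoplus_d V_d$ is of CFT type if $V_d=0$ for $d<0$ and $V_0=\mathbb{C}\mathbf{1}$. Let $C_2(V)$ be the linear span of all $a_{(-2)}b$ with $a,b\in V$; $V$ is $C_2$-cofinite if $V/C_2(V)$ is finite dimensional. $T^2(V)=V\otimes V$ carries the tensor product VOA structure, the symmetric group $S_2$ acts on it by permuting the two tensor factors, and $T^2(V)^{S_2}$ is the vertex operator subalgebra of $S_2$-fixed vectors (with vacuum $\mathbf{1}\otimes\mathbf{1}$ and Virasoro vector $\omega\otimes\mathbf{1}+\mathbf{1}\otimes\omega$). *)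

theory Defs
  imports Complex_Main "HOL-Library.Poly_Mapping"
begin

section \<open>Complex vector spaces\<close>

class complex_vector = ab_group_add +
  fixes scaleC :: "complex \<Rightarrow> 'a \<Rightarrow> 'a"  (infixr \<open>*\<^sub>C\<close> 75)
  assumes scaleC_add_right: "c *\<^sub>C (x + y) = c *\<^sub>C x + c *\<^sub>C y"
    and scaleC_add_left: "(c + d) *\<^sub>C x = c *\<^sub>C x + d *\<^sub>C x"
    and scaleC_scaleC: "c *\<^sub>C d *\<^sub>C x = (c * d) *\<^sub>C x"
    and scaleC_one: "1 *\<^sub>C x = x"

global_interpretation complex_vector: vector_space "scaleC :: complex \<Rightarrow> 'a \<Rightarrow> 'a::complex_vector"
  by unfold_locales (simp_all add: scaleC_add_right scaleC_add_left scaleC_scaleC scaleC_one)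

abbreviation clinear :: "('a::complex_vector \<Rightarrow> 'b::complex_vector) \<Rightarrow> bool"
  where "clinear \<equiv> Vector_Spaces.linear scaleC scaleC"

definition cbilinear :: "('a::complex_vector \<Rightarrow> 'b::complex_vector \<Rightarrow> 'c::complex_vector) \<Rightarrow> bool"
  where "cbilinear B \<longleftrightarrow> (\<forall>a. clinear (B a)) \<and> (\<forall>b. clinear (\<lambda>a. B a b))"

lemma clinearI:
  assumes "\<And>x y. f (x + y) = f x + f y" and "\<And>c x. f (c *\<^sub>C x) = c *\<^sub>C f x"
  shows "clinear f"
  by unfold_locales (use assms in auto)

lemma clinear_add: "clinear f \<Longrightarrow> f (x + y) = f x + f y"
  and clinear_scaleC: "clinear f \<Longrightarrow> f (c *\<^sub>C x) = c *\<^sub>C f x"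
  by (simp_all add: Vector_Spaces.linear_iff)

lemma clinear_zero: "clinear f \<Longrightarrow> f 0 = 0"
  using clinear_scaleC[of f 0 0] by simp

lemma clinear_diff: "clinear f \<Longrightarrow> f (x - y) = f x - f y"
  using clinear_add[of f "x - y" y] by simp

lemma clinear_neg: "clinear f \<Longrightarrow> f (- x) = - f x"
  using clinear_diff[of f 0 x] clinear_zero[of f] by simp

lemma cbilinearI:
  assumes "\<And>a. clinear (B a)" and "\<And>b. clinear (\<lambda>a. B a b)"
  shows "cbilinear B"
  using assms by (simp add: cbilinear_def)

instantiation complex :: complex_vector
begin
definition scaleC_complex :: "complex \<Rightarrow> complex \<Rightarrow> complex"
  where "scaleC_complex = (*)"
instance
  by standard (simp_all add: scaleC_complex_def algebra_simps)
end

instantiation poly_mapping :: (type, complex_vector) complex_vector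
begin
lift_definition scaleC_poly_mapping :: "complex \<Rightarrow> ('a \<Rightarrow>\<^sub>0 'b) \<Rightarrow> 'a \<Rightarrow>\<^sub>0 'b"
  is "\<lambda>c f k. c *\<^sub>C f k"
  by (rule rev_finite_subset) auto
instance
  by standard (transfer, simp add: fun_eq_iff scaleC_add_right scaleC_add_left scaleC_scaleC scaleC_one)+
end


section \<open>Tensor products of complex vector spaces\<close>

text \<open>The tensor product of two complex vector spaces is the free complex vector space on the pairs
  \<open>(a, b)\<close>, that is \<open>('a \<times> 'b) \<Rightarrow>\<^sub>0 complex\<close>, modulo the bilinearity relations.\<close>

definition tensor_relations :: "('a::complex_vector \<times> 'b::complex_vector \<Rightarrow>\<^sub>0 complex) set"
  where "tensor_relations = complex_vector.span
    ({Poly_Mapping.single (a + a', b) 1 - Poly_Mapping.single (a, b) 1 - Poly_Mapping.single (a', b) 1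
        | a a' b. True} \<union>
     {Poly_Mapping.single (a, b + b') 1 - Poly_Mapping.single (a, b) 1 - Poly_Mapping.single (a, b') 1
        | a b b'. True} \<union>
     {Poly_Mapping.single (c *\<^sub>C a, b) 1 - c *\<^sub>C Poly_Mapping.single (a, b) 1 | c a b. True} \<union>
     {Poly_Mapping.single (a, c *\<^sub>C b) 1 - c *\<^sub>C Poly_Mapping.single (a, b) 1 | c a b. True})"

lemma tensor_relations_zero: "0 \<in> tensor_relations"
  and tensor_relations_add: "x \<in> tensor_relations \<Longrightarrow> y \<in> tensor_relations \<Longrightarrow> x + y \<in> tensor_relations"
  and tensor_relations_diff: "x \<in> tensor_relations \<Longrightarrow> y \<in> tensor_relations \<Longrightarrow> x - y \<in> tensor_relations"
  and tensor_relations_neg: "x \<in> tensor_relations \<Longrightarrow> - x \<in> tensor_relations"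
  and tensor_relations_scale: "x \<in> tensor_relations \<Longrightarrow> c *\<^sub>C x \<in> tensor_relations"
  unfolding tensor_relations_def
  by (simp_all add: complex_vector.span_zero complex_vector.span_add complex_vector.span_diff
      complex_vector.span_neg complex_vector.span_scale)

quotient_type (overloaded) ('a, 'b) tensor =
  "('a::complex_vector \<times> 'b::complex_vector) \<Rightarrow>\<^sub>0 complex" / "\<lambda>p q. p - q \<in> tensor_relations"
proof (rule equivpI)
  show "reflp (\<lambda>p q. p - q \<in> (tensor_relations :: (('a \<times> 'b) \<Rightarrow>\<^sub>0 complex) set))"
    by (simp add: reflp_def tensor_relations_zero)
  show "symp (\<lambda>p q. p - q \<in> (tensor_relations :: (('a \<times> 'b) \<Rightarrow>\<^sub>0 complex) set))"
    using tensor_relations_neg by (fastforce simp: symp_def)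
  show "transp (\<lambda>p q. p - q \<in> (tensor_relations :: (('a \<times> 'b) \<Rightarrow>\<^sub>0 complex) set))"
    using tensor_relations_add by (fastforce simp: transp_def)
qed

instantiation tensor :: (complex_vector, complex_vector) complex_vector
begin

lift_definition zero_tensor :: "('a, 'b) tensor" is 0 .

lift_definition plus_tensor :: "('a, 'b) tensor \<Rightarrow> ('a, 'b) tensor \<Rightarrow> ('a, 'b) tensor" is "(+)"
  by (drule (1) tensor_relations_add) (simp add: algebra_simps)

lift_definition minus_tensor :: "('a, 'b) tensor \<Rightarrow> ('a, 'b) tensor \<Rightarrow> ('a, 'b) tensor" is "(-)"
  by (drule (1) tensor_relations_diff) (simp add: algebra_simps)

lift_definition uminus_tensor :: "('a, 'b) tensor \<Rightarrow> ('a, 'b) tensor" is uminus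
  using tensor_relations_neg by fastforce

lift_definition scaleC_tensor :: "complex \<Rightarrow> ('a, 'b) tensor \<Rightarrow> ('a, 'b) tensor" is scaleC
  by (simp add: complex_vector.scale_right_diff_distrib[symmetric] tensor_relations_scale)

instance
  by standard
    (transfer, simp add: tensor_relations_zero algebra_simps
      scaleC_add_right scaleC_add_left scaleC_scaleC scaleC_one)+

end

lift_definition tensor :: "'a::complex_vector \<Rightarrow> 'b::complex_vector \<Rightarrow> ('a, 'b) tensor"  (infixr \<open>\<otimes>\<close> 70)
  is "\<lambda>a b. Poly_Mapping.single (a, b) 1" .

lemma cbilinear_tensor: "cbilinear (\<otimes>)"
proof (intro cbilinearI clinearI)
  fix a a' :: 'a and b b' :: 'b and c :: complex
  show "a \<otimes> (b + b') = a \<otimes> b + a \<otimes> b'"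
    by transfer (unfold tensor_relations_def, rule complex_vector.span_base, unfold diff_diff_eq[symmetric], blast)
  show "(a + a') \<otimes> b = a \<otimes> b + a' \<otimes> b"
    by transfer (unfold tensor_relations_def, rule complex_vector.span_base, unfold diff_diff_eq[symmetric], blast)
  show "a \<otimes> (c *\<^sub>C b) = c *\<^sub>C (a \<otimes> b)"
    by transfer (unfold tensor_relations_def, rule complex_vector.span_base, blast)
  show "(c *\<^sub>C a) \<otimes> b = c *\<^sub>C (a \<otimes> b)"
    by transfer (unfold tensor_relations_def, rule complex_vector.span_base, blast)
qed

text \<open>The linear map induced by a bilinear map \<open>B\<close>, computed on an arbitrary representative.\<close>

definition free_lift ::
    "('a \<Rightarrow> 'b \<Rightarrow> 'c::complex_vector) \<Rightarrow> ('a \<times> 'b \<Rightarrow>\<^sub>0 complex) \<Rightarrow> 'c"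
  where "free_lift B p = (\<Sum>(a, b)\<in>Poly_Mapping.keys p. Poly_Mapping.lookup p (a, b) *\<^sub>C B a b)"

definition tensor_lift ::
    "('a::complex_vector \<Rightarrow> 'b::complex_vector \<Rightarrow> 'c::complex_vector) \<Rightarrow> ('a, 'b) tensor \<Rightarrow> 'c"
  where "tensor_lift B x = free_lift B (rep_tensor x)"

lemma free_lift_superset:
  assumes "finite S" "Poly_Mapping.keys p \<subseteq> S"
  shows "free_lift B p = (\<Sum>(a, b)\<in>S. Poly_Mapping.lookup p (a, b) *\<^sub>C B a b)"
  unfolding free_lift_def
  by (rule sum.mono_neutral_left) (use assms in \<open>auto simp: in_keys_iff\<close>)

lemma clinear_free_lift: "clinear (free_lift B)"
proof (rule clinearI)
  fix p q :: "'a \<times> 'b \<Rightarrow>\<^sub>0 complex" and c :: complex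
  let ?S = "Poly_Mapping.keys p \<union> Poly_Mapping.keys q"
  have *: "finite ?S" "Poly_Mapping.keys p \<subseteq> ?S" "Poly_Mapping.keys q \<subseteq> ?S"
      "Poly_Mapping.keys (p + q) \<subseteq> ?S"
    using Poly_Mapping.keys_add[of p q] by auto
  show "free_lift B (p + q) = free_lift B p + free_lift B q"
    unfolding free_lift_superset[OF *(1,2)] free_lift_superset[OF *(1,3)]
      free_lift_superset[OF *(1,4)] sum.distrib[symmetric]
    by (rule sum.cong) (auto simp: lookup_add scaleC_add_left)
  have "Poly_Mapping.keys (c *\<^sub>C p) \<subseteq> Poly_Mapping.keys p"
    by (auto simp: in_keys_iff scaleC_poly_mapping.rep_eq scaleC_complex_def)
  from free_lift_superset[OF finite_keys this]
  show "free_lift B (c *\<^sub>C p) = c *\<^sub>C free_lift B p"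
    by (simp add: free_lift_def complex_vector.scale_sum_right scaleC_poly_mapping.rep_eq
        scaleC_complex_def scaleC_scaleC case_prod_beta)
qed

lemma free_lift_single: "free_lift B (Poly_Mapping.single (a, b) 1) = B a b"
  by (simp add: free_lift_def scaleC_one)

lemma free_lift_relations:
  assumes "cbilinear B" "p \<in> tensor_relations"
  shows "free_lift B p = 0"
proof -
  have lin: "clinear (B a)" "clinear (\<lambda>a. B a b)" for a b
    using assms(1) by (auto simp: cbilinear_def)
  have "complex_vector.subspace {p. free_lift B p = 0}"
    by (auto simp: complex_vector.subspace_def clinear_free_lift clinear_zero clinear_add clinear_scaleC)
  then have "tensor_relations \<subseteq> {p. free_lift B p = 0}"
    unfolding tensor_relations_def
    by (rule complex_vector.span_minimal[rotated])
      (auto simp: clinear_diff[OF clinear_free_lift] clinear_scaleC[OF clinear_free_lift] free_lift_single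
        clinear_add[OF lin(1)] clinear_add[OF lin(2)] clinear_scaleC[OF lin(1)] clinear_scaleC[OF lin(2)])
  with assms(2) show ?thesis by blast
qed

lemma tensor_lift_abs:
  assumes "cbilinear B"
  shows "tensor_lift B (abs_tensor p) = free_lift B p"
proof -
  have "rep_tensor (abs_tensor p) - p \<in> tensor_relations"
    using Quotient3_rep_abs[OF Quotient3_tensor, of p] by (simp add: tensor_relations_zero)
  from free_lift_relations[OF assms this] show ?thesis
    by (simp add: tensor_lift_def clinear_diff[OF clinear_free_lift])
qed

lemma tensor_lift_tensor:
  assumes "cbilinear B"
  shows "tensor_lift B (a \<otimes> b) = B a b"
  by (simp add: tensor.abs_eq tensor_lift_abs[OF assms] free_lift_single)

lemma clinear_tensor_lift:
  assumes "cbilinear B"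
  shows "clinear (tensor_lift B)"
proof (rule clinearI)
  fix x y :: "('a, 'b) tensor" and c :: complex
  show "tensor_lift B (x + y) = tensor_lift B x + tensor_lift B y"
    by (induction x rule: tensor.abs_induct, induction y rule: tensor.abs_induct)
      (simp add: plus_tensor.abs_eq tensor_lift_abs[OF assms] clinear_add[OF clinear_free_lift])
  show "tensor_lift B (c *\<^sub>C x) = c *\<^sub>C tensor_lift B x"
    by (induction x rule: tensor.abs_induct)
      (simp add: scaleC_tensor.abs_eq tensor_lift_abs[OF assms] clinear_scaleC[OF clinear_free_lift])
qed

lemma clinear_sum: "clinear f \<Longrightarrow> f (sum g S) = (\<Sum>i\<in>S. f (g i))"
  by (induction S rule: infinite_finite_induct) (auto simp: clinear_zero clinear_add)

lemma abs_tensor_eq: "abs_tensor p = free_lift (\<otimes>) p"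
proof -
  have "p = free_lift (\<lambda>a b. Poly_Mapping.single (a, b) 1) p"
  proof (rule poly_mapping_eqI)
    fix k
    have "Poly_Mapping.lookup (free_lift (\<lambda>a b. Poly_Mapping.single (a, b) 1) p) k =
        (\<Sum>l\<in>Poly_Mapping.keys p. if l = k then Poly_Mapping.lookup p k else 0)"
      unfolding free_lift_def lookup_sum
      by (rule sum.cong) (auto simp: scaleC_poly_mapping.rep_eq scaleC_complex_def lookup_single when_def)
    then show "Poly_Mapping.lookup p k =
        Poly_Mapping.lookup (free_lift (\<lambda>a b. Poly_Mapping.single (a, b) 1) p) k"
      by (simp add: sum.delta in_keys_iff)
  qed
  moreover have lin: "clinear (abs_tensor :: _ \<Rightarrow> ('a, 'b) tensor)"
    by (rule clinearI) (simp_all add: plus_tensor.abs_eq scaleC_tensor.abs_eq)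
  ultimately have "abs_tensor p = abs_tensor (free_lift (\<lambda>a b. Poly_Mapping.single (a, b) 1) p)"
    by simp
  also have "\<dots> = free_lift (\<otimes>) p"
    unfolding free_lift_def clinear_sum[OF lin]
    by (rule sum.cong) (auto simp: clinear_scaleC[OF lin] tensor.abs_eq)
  finally show ?thesis .
qed

lemma clinear_tensor_eqI:
  assumes "clinear f" "clinear g" and "\<And>a b. f (a \<otimes> b) = g (a \<otimes> b)"
  shows "f x = g x"
proof (induction x rule: tensor.abs_induct)
  case (1 p)
  show ?case
    unfolding abs_tensor_eq free_lift_def clinear_sum[OF assms(1)] clinear_sum[OF assms(2)]
    by (rule sum.cong) (auto simp: clinear_scaleC[OF assms(1)] clinear_scaleC[OF assms(2)] assms(3))
qed

definition tensor_swap :: "('a::complex_vector, 'a) tensor \<Rightarrow> ('a, 'a) tensor"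
  where "tensor_swap = tensor_lift (\<lambda>a b. b \<otimes> a)"

lemma cbilinear_flip: "cbilinear B \<Longrightarrow> cbilinear (\<lambda>a b. B b a)"
  by (simp add: cbilinear_def)

lemma tensor_swap_tensor: "tensor_swap (a \<otimes> b) = b \<otimes> a"
  by (simp add: tensor_swap_def tensor_lift_tensor[OF cbilinear_flip[OF cbilinear_tensor]])

lemma clinear_tensor_swap: "clinear tensor_swap"
  unfolding tensor_swap_def by (rule clinear_tensor_lift[OF cbilinear_flip[OF cbilinear_tensor]])

text \<open>The space of tensors fixed by \<open>S\<^sub>2\<close>; it is enough to require invariance under the
  transposition, which generates the group.\<close>

typedef (overloaded) 'a sym_tensor = "{x :: ('a::complex_vector, 'a) tensor. tensor_swap x = x}"
  by (rule exI[of _ 0]) (simp add: clinear_zero[OF clinear_tensor_swap])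

setup_lifting type_definition_sym_tensor

instantiation sym_tensor :: (complex_vector) complex_vector
begin

lift_definition zero_sym_tensor :: "'a sym_tensor" is 0
  by (simp add: clinear_zero[OF clinear_tensor_swap])

lift_definition plus_sym_tensor :: "'a sym_tensor \<Rightarrow> 'a sym_tensor \<Rightarrow> 'a sym_tensor" is "(+)"
  by (simp add: clinear_add[OF clinear_tensor_swap])

lift_definition minus_sym_tensor :: "'a sym_tensor \<Rightarrow> 'a sym_tensor \<Rightarrow> 'a sym_tensor" is "(-)"
  by (simp add: clinear_diff[OF clinear_tensor_swap])

lift_definition uminus_sym_tensor :: "'a sym_tensor \<Rightarrow> 'a sym_tensor" is uminus
  by (simp add: clinear_neg[OF clinear_tensor_swap])

lift_definition scaleC_sym_tensor :: "complex \<Rightarrow> 'a sym_tensor \<Rightarrow> 'a sym_tensor" is scaleC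
  by (simp add: clinear_scaleC[OF clinear_tensor_swap])

instance
  by standard
    (transfer, simp add: algebra_simps scaleC_add_right scaleC_add_left scaleC_scaleC scaleC_one)+

end


section \<open>Vertex operator algebras\<close>

text \<open>The field \<open>nprod V n a b\<close> is the \<open>n\<close>-th product \<open>a\<^bsub>(n)\<^esub>b\<close>.\<close>

record 'a voa =
  nprod :: "int \<Rightarrow> 'a \<Rightarrow> 'a \<Rightarrow> 'a"
  vacuum :: 'a
  conformal :: 'a

definition virasoro_mode :: "'a voa \<Rightarrow> int \<Rightarrow> 'a \<Rightarrow> 'a"
  where "virasoro_mode V m = nprod V (m + 1) (conformal V)"

definition weight_space :: "'a::complex_vector voa \<Rightarrow> int \<Rightarrow> 'a set"
  where "weight_space V d = {v. virasoro_mode V 0 v = of_int d *\<^sub>C v}"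

text \<open>The assumption \<open>borcherds\<close> is the Jacobi identity written in components. All its sums are
  finite because of \<open>truncation\<close>. In \<open>grading\<close>, directness of the sum need not be required
  since eigenspaces for distinct eigenvalues are independent.\<close>

locale vertex_operator_algebra =
  fixes V :: "'a::complex_vector voa"
  assumes bilinear_nprod: "cbilinear (nprod V n)"
    and truncation: "\<exists>N. \<forall>n\<ge>N. nprod V n a b = 0"
    and vacuum_left: "nprod V n (vacuum V) a = (if n = -1 then a else 0)"
    and vacuum_right: "nprod V (-1) a (vacuum V) = a"
    and vacuum_right_nonneg: "n \<ge> 0 \<Longrightarrow> nprod V n a (vacuum V) = 0"
    and borcherds:
      "Sum_any (\<lambda>i::nat. (of_int p gchoose i) *\<^sub>C
         nprod V (p + q - int i) (nprod V (r + int i) a b) c) =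
       Sum_any (\<lambda>i::nat. ((-1) ^ i * (of_int r gchoose i)) *\<^sub>C
         (nprod V (p + r - int i) a (nprod V (q + int i) b c) -
          ((-1) powi r) *\<^sub>C nprod V (q + r - int i) b (nprod V (p + int i) a c)))"
    and virasoro:
      "\<exists>z::complex. \<forall>m n v.
         virasoro_mode V m (virasoro_mode V n v) - virasoro_mode V n (virasoro_mode V m v) =
         of_int (m - n) *\<^sub>C virasoro_mode V (m + n) v +
         (if m + n = 0 then (of_int (m ^ 3 - m) / 12 * z) *\<^sub>C v else 0)"
    and translation: "nprod V n (virasoro_mode V (-1) a) b = - of_int n *\<^sub>C nprod V (n - 1) a b"
    and grading: "complex_vector.span (\<Union>d. weight_space V d) = UNIV"
    and finite_dim_weight_space: "\<exists>B. finite B \<and> weight_space V d = complex_vector.span B"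
    and bounded_below: "\<exists>N. \<forall>d<N. weight_space V d = {0}"

definition voa_ideal :: "'a::complex_vector voa \<Rightarrow> 'a set \<Rightarrow> bool"
  where "voa_ideal V I \<longleftrightarrow>
    complex_vector.subspace I \<and> (\<forall>n a. \<forall>v\<in>I. nprod V n a v \<in> I)"

definition simple_voa :: "'a::complex_vector voa \<Rightarrow> bool"
  where "simple_voa V \<longleftrightarrow>
    (UNIV :: 'a set) \<noteq> {0} \<and> (\<forall>I. voa_ideal V I \<longrightarrow> I = {0} \<or> I = UNIV)"

definition CFT_type :: "'a::complex_vector voa \<Rightarrow> bool"
  where "CFT_type V \<longleftrightarrow>
    (\<forall>d<0. weight_space V d = {0}) \<and> weight_space V 0 = complex_vector.span {vacuum V}"

definition C2_space :: "'a::complex_vector voa \<Rightarrow> 'a set"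
  where "C2_space V = complex_vector.span {nprod V (-2) a b | a b. True}"

text \<open>The quotient by a subspace \<open>W\<close> is finite dimensional if finitely many classes \<open>b + W\<close> span it;
  \<open>v - u \<in> W\<close> says that \<open>v\<close> and \<open>u\<close> have the same class.\<close>

definition finite_dim_quotient :: "'a::complex_vector set \<Rightarrow> bool"
  where "finite_dim_quotient W \<longleftrightarrow>
    (\<exists>B. finite B \<and> (\<forall>v. \<exists>u\<in>complex_vector.span B. v - u \<in> W))"

definition C2_cofinite :: "'a::complex_vector voa \<Rightarrow> bool"
  where "C2_cofinite V \<longleftrightarrow> finite_dim_quotient (C2_space V)"


section \<open>Tensor products and the 2-cyclic permutation orbifold\<close>

text \<open>From \<open>Y(a \<otimes> b, z) = Y(a, z) \<otimes> Y(b, z)\<close>, comparing coefficients of \<open>z\<^bsup>-n-1\<^esup>\<close>.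
  The sum over all integers \<open>i\<close> has finitely many nonzero terms.\<close>

definition tensor_nprod ::
    "'a::complex_vector voa \<Rightarrow> 'b::complex_vector voa \<Rightarrow> int \<Rightarrow> 'a \<Rightarrow> 'b \<Rightarrow> 'a \<Rightarrow> 'b \<Rightarrow> ('a, 'b) tensor"
  where "tensor_nprod V W n a b c d =
    Sum_any (\<lambda>i. nprod V i a c \<otimes> nprod W (n - 1 - i) b d)"

definition tensor_voa ::
    "'a::complex_vector voa \<Rightarrow> 'b::complex_vector voa \<Rightarrow> ('a, 'b) tensor voa"
  where "tensor_voa V W =
    \<lparr>nprod = (\<lambda>n x y. tensor_lift (\<lambda>a b. tensor_lift (\<lambda>c d. tensor_nprod V W n a b c d) y) x),
     vacuum = vacuum V \<otimes> vacuum W,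
     conformal = conformal V \<otimes> vacuum W + vacuum V \<otimes> conformal W\<rparr>"

definition T2 :: "'a::complex_vector voa \<Rightarrow> ('a, 'a) tensor voa"
  where "T2 V = tensor_voa V V"

definition T2_S2 :: "'a::complex_vector voa \<Rightarrow> 'a sym_tensor voa"
  where "T2_S2 V =
    \<lparr>nprod = (\<lambda>n x y. Abs_sym_tensor (nprod (T2 V) n (Rep_sym_tensor x) (Rep_sym_tensor y))),
     vacuum = Abs_sym_tensor (vacuum (T2 V)),
     conformal = Abs_sym_tensor (conformal (T2 V))\<rparr>"

text \<open>The formulas above define what they should: the products of \<open>tensor_voa\<close> are bilinear and
  have the expected values on pure tensors, and those of \<open>T2_S2\<close> are the restrictions of those
  of \<open>T2\<close>.\<close>

lemma clinear_zero_fun: "clinear (\<lambda>x. 0)"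
  by (rule clinearI) simp_all

lemma clinear_comp: "clinear f \<Longrightarrow> clinear g \<Longrightarrow> clinear (\<lambda>x. f (g x))"
  by (rule clinearI) (simp_all add: clinear_add clinear_scaleC)

lemma clinear_Sum_any:
  assumes lin: "\<And>i. clinear (f i)" and fin: "\<And>x. finite {i. f i x \<noteq> 0}"
  shows "clinear (\<lambda>x. Sum_any (\<lambda>i. f i x))"
proof (rule clinearI)
  fix x y c
  show "Sum_any (\<lambda>i. f i (x + y)) = Sum_any (\<lambda>i. f i x) + Sum_any (\<lambda>i. f i y)"
    by (simp add: clinear_add[OF lin] Sum_any.distrib[OF fin fin])
  have "Sum_any (\<lambda>i. f i (c *\<^sub>C x)) = (\<Sum>i | f i x \<noteq> 0. f i (c *\<^sub>C x))"
    by (rule Sum_any.expand_superset[OF fin]) (auto simp: clinear_scaleC[OF lin])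
  then show "Sum_any (\<lambda>i. f i (c *\<^sub>C x)) = c *\<^sub>C Sum_any (\<lambda>i. f i x)"
    by (simp add: clinear_scaleC[OF lin] Sum_any.expand_set complex_vector.scale_sum_right)
qed

context
  fixes V :: "'a::complex_vector voa" and W :: "'b::complex_vector voa"
  assumes V: "vertex_operator_algebra V" and W: "vertex_operator_algebra W"
begin

lemma clinear_nprods:
  "clinear (nprod V n a)" "clinear (\<lambda>a. nprod V n a b)"
  "clinear (nprod W n c)" "clinear (\<lambda>c. nprod W n c d)"
  using vertex_operator_algebra.bilinear_nprod[OF V] vertex_operator_algebra.bilinear_nprod[OF W]
  by (auto simp: cbilinear_def)

lemma clinear_tensors: "clinear ((\<otimes>) a)" "clinear (\<lambda>a. a \<otimes> b)"
  using cbilinear_tensor by (auto simp: cbilinear_def)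

lemma finite_tensor_nprod: "finite {i. nprod V i a c \<otimes> nprod W (n - 1 - i) b d \<noteq> 0}"
proof -
  obtain M N where M: "\<forall>i\<ge>M. nprod V i a c = 0" and N: "\<forall>i\<ge>N. nprod W i b d = 0"
    using vertex_operator_algebra.truncation[OF V] vertex_operator_algebra.truncation[OF W] by metis
  have "{i. nprod V i a c \<otimes> nprod W (n - 1 - i) b d \<noteq> 0} \<subseteq> {n - 1 - N..M}"
  proof (intro subsetI)
    fix i assume i: "i \<in> {i. nprod V i a c \<otimes> nprod W (n - 1 - i) b d \<noteq> 0}"
    have "\<not> i \<ge> M" "\<not> n - 1 - i \<ge> N"
      using i M N by (auto simp: clinear_zero[OF clinear_tensors(1)] clinear_zero[OF clinear_tensors(2)])
    then show "i \<in> {n - 1 - N..M}" by auto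
  qed
  then show ?thesis by (rule finite_subset) simp
qed

lemma clinear_tensor_nprod:
  "clinear (\<lambda>a. tensor_nprod V W n a b c d)" "clinear (\<lambda>b. tensor_nprod V W n a b c d)"
  "clinear (\<lambda>c. tensor_nprod V W n a b c d)" "clinear (\<lambda>d. tensor_nprod V W n a b c d)"
  unfolding tensor_nprod_def
  by (rule clinear_Sum_any[OF _ finite_tensor_nprod],
      rule clinear_comp[OF clinear_tensors(1)] clinear_comp[OF clinear_tensors(2)],
      rule clinear_nprods)+

lemma cbilinear_tensor_nprod: "cbilinear (tensor_nprod V W n a b)"
  by (intro cbilinearI clinear_tensor_nprod)

lemma cbilinear_tensor_nprod': "cbilinear (\<lambda>a b. tensor_lift (tensor_nprod V W n a b) y)"
proof (intro cbilinearI clinearI)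
  fix a a' :: 'a and b b' :: 'b and k :: complex
  let ?L = "\<lambda>a b. tensor_lift (tensor_nprod V W n a b)"
  note lin = clinear_tensor_lift[OF cbilinear_tensor_nprod]
  have plus: "clinear f \<Longrightarrow> clinear g \<Longrightarrow> clinear (\<lambda>x. f x + g x)"
    for f g :: "('a, 'b) tensor \<Rightarrow> ('a, 'b) tensor"
    by (rule clinearI) (simp_all add: clinear_add clinear_scaleC scaleC_add_right)
  have scale: "clinear f \<Longrightarrow> clinear (\<lambda>x. k *\<^sub>C f x)"
    for f :: "('a, 'b) tensor \<Rightarrow> ('a, 'b) tensor"
    by (rule clinearI) (simp_all add: clinear_add clinear_scaleC scaleC_add_right scaleC_scaleC mult.commute)
  note val = tensor_lift_tensor[OF cbilinear_tensor_nprod]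
  show "?L (a + a') b y = ?L a b y + ?L a' b y"
    by (rule clinear_tensor_eqI[where f = "?L (a + a') b", OF lin plus[OF lin lin]])
      (simp add: val clinear_add[OF clinear_tensor_nprod(1)])
  show "?L a (b + b') y = ?L a b y + ?L a b' y"
    by (rule clinear_tensor_eqI[where f = "?L a (b + b')", OF lin plus[OF lin lin]])
      (simp add: val clinear_add[OF clinear_tensor_nprod(2)])
  show "?L (k *\<^sub>C a) b y = k *\<^sub>C ?L a b y"
    by (rule clinear_tensor_eqI[where f = "?L (k *\<^sub>C a) b", OF lin scale[OF lin]])
      (simp add: val clinear_scaleC[OF clinear_tensor_nprod(1)])
  show "?L a (k *\<^sub>C b) y = k *\<^sub>C ?L a b y"
    by (rule clinear_tensor_eqI[where f = "?L a (k *\<^sub>C b)", OF lin scale[OF lin]])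
      (simp add: val clinear_scaleC[OF clinear_tensor_nprod(2)])
qed

lemma tensor_voa_nprod:
  "nprod (tensor_voa V W) n (a \<otimes> b) (c \<otimes> d) =
    Sum_any (\<lambda>i. nprod V i a c \<otimes> nprod W (n - 1 - i) b d)"
  unfolding tensor_nprod_def[symmetric]
  by (simp add: tensor_voa_def tensor_lift_tensor[OF cbilinear_tensor_nprod']
      tensor_lift_tensor[OF cbilinear_tensor_nprod])

lemma cbilinear_tensor_voa_nprod: "cbilinear (nprod (tensor_voa V W) n)"
proof (rule cbilinearI)
  fix x y
  show "clinear (\<lambda>x. nprod (tensor_voa V W) n x y)"
    by (simp add: tensor_voa_def clinear_tensor_lift[OF cbilinear_tensor_nprod'])
  have lift: "nprod (tensor_voa V W) n x y =
      free_lift (\<lambda>a b. tensor_lift (tensor_nprod V W n a b) y) (rep_tensor x)" for y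
    by (simp add: tensor_voa_def tensor_lift_def)
  show "clinear (nprod (tensor_voa V W) n x)"
    by (rule clinearI; unfold lift free_lift_def)
      (simp_all add: clinear_add[OF clinear_tensor_lift[OF cbilinear_tensor_nprod]]
        clinear_scaleC[OF clinear_tensor_lift[OF cbilinear_tensor_nprod]] case_prod_beta
        scaleC_add_right sum.distrib complex_vector.scale_sum_right scaleC_scaleC mult.commute)
qed

end

lemma bij_diff_int: "bij (\<lambda>i::int. n - i)"
  by (rule o_bij[where g = "\<lambda>i. n - i"]) (simp_all add: fun_eq_iff)

lemma tensor_swap_T2:
  assumes V: "vertex_operator_algebra V"
  shows "tensor_swap (nprod (T2 V) n x y) = nprod (T2 V) n (tensor_swap x) (tensor_swap y)"
proof -
  note bil = cbilinear_tensor_voa_nprod[OF V V]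
  have lin: "clinear (nprod (T2 V) n x)" "clinear (\<lambda>x. nprod (T2 V) n x y)" for n x y
    using bil by (auto simp: cbilinear_def T2_def)
  have pure: "tensor_swap (nprod (T2 V) n (a \<otimes> b) (c \<otimes> d)) = nprod (T2 V) n (b \<otimes> a) (d \<otimes> c)"
    for a b c d
  proof -
    let ?f = "\<lambda>i. nprod V i a c \<otimes> nprod V (n - 1 - i) b d"
    let ?g = "\<lambda>i. nprod V (n - 1 - i) b d \<otimes> nprod V i a c"
    let ?S = "{i. ?f i \<noteq> 0}"
    have fin: "finite ?S" by (rule finite_tensor_nprod[OF V V])
    have swap: "tensor_swap (?f i) = ?g i" for i by (rule tensor_swap_tensor)
    have sub: "{i. ?g i \<noteq> 0} \<subseteq> ?S"
    proof (intro subsetI CollectI notI)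
      fix i assume "i \<in> {i. ?g i \<noteq> 0}" "?f i = 0"
      then show False using swap[of i] by (simp add: clinear_zero[OF clinear_tensor_swap])
    qed
    have "tensor_swap (nprod (T2 V) n (a \<otimes> b) (c \<otimes> d)) = tensor_swap (sum ?f ?S)"
      by (simp only: T2_def tensor_voa_nprod[OF V V] Sum_any.expand_superset[OF fin order_refl])
    also have "\<dots> = sum ?g ?S"
      by (simp only: clinear_sum[OF clinear_tensor_swap] swap)
    also have "\<dots> = Sum_any ?g"
      by (rule Sum_any.expand_superset[OF fin sub, symmetric])
    also have "\<dots> = Sum_any (\<lambda>i. nprod V i b d \<otimes> nprod V (n - 1 - i) a c)"
      by (rule Sum_any.reindex_cong[where l = "\<lambda>i. n - 1 - i"])
        (simp_all add: bij_diff_int comp_def)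
    finally show ?thesis by (simp add: T2_def tensor_voa_nprod[OF V V])
  qed
  have "tensor_swap (nprod (T2 V) n (a \<otimes> b) y) = nprod (T2 V) n (b \<otimes> a) (tensor_swap y)" for a b
    by (rule clinear_tensor_eqI[OF clinear_comp[OF clinear_tensor_swap lin(1)]
          clinear_comp[OF lin(1) clinear_tensor_swap]])
      (simp add: pure tensor_swap_tensor)
  then show ?thesis
    by (intro clinear_tensor_eqI[where x = x, OF clinear_comp[OF clinear_tensor_swap lin(2)]
          clinear_comp[OF lin(2) clinear_tensor_swap]])
      (simp add: tensor_swap_tensor)
qed

lemma Rep_T2_S2_nprod:
  assumes "vertex_operator_algebra V"
  shows "Rep_sym_tensor (nprod (T2_S2 V) n x y) =
    nprod (T2 V) n (Rep_sym_tensor x) (Rep_sym_tensor y)"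
  using Rep_sym_tensor[of x] Rep_sym_tensor[of y] tensor_swap_T2[OF assms, of n "Rep_sym_tensor x" "Rep_sym_tensor y"]
  by (simp add: T2_S2_def Abs_sym_tensor_inverse)

lemma Rep_T2_S2_vacuum: "Rep_sym_tensor (vacuum (T2_S2 V)) = vacuum V \<otimes> vacuum V"
  by (simp add: T2_S2_def T2_def tensor_voa_def Abs_sym_tensor_inverse tensor_swap_tensor)

lemma Rep_T2_S2_conformal:
  "Rep_sym_tensor (conformal (T2_S2 V)) = conformal V \<otimes> vacuum V + vacuum V \<otimes> conformal V"
  by (simp add: T2_S2_def T2_def tensor_voa_def Abs_sym_tensor_inverse tensor_swap_tensor
      clinear_add[OF clinear_tensor_swap] add.commute)

end

theory Submission
  imports Defs "HOL-Computational_Algebra.Polynomial"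
begin

text \<open>Write \<open>(a|b) = a \<otimes> b + b \<otimes> a\<close>, \<open>R\<close> for the quotient of the orbifold by its \<open>C\<^sub>2\<close>-space, and
  \<open>x\<^sup>-\<close> for \<open>x \<otimes> \<one> - \<one> \<otimes> x\<close>. Three odd fields \<open>x\<^sup>-(z\<^sub>1) y\<^sup>-(z\<^sub>2) z\<^sup>-(z\<^sub>3)\<close> on an antisymmetric vector, taken modulo
  the \<open>C\<^sub>2\<close>-space and multiplied by a fixed power of all \<open>z\<^sub>i\<close> and \<open>z\<^sub>i - z\<^sub>j\<close>, form a polynomial in each
  degree. Expanding two of the fields around each other gives even fields, which have no
  modes below \<open>-1\<close> in \<open>R\<close>; hence this polynomial has bounded degree along each of the three
  directions \<open>e\<^sub>i + e\<^sub>j\<close>. These directions are independent, so it vanishes in high degree. Taking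
  \<open>\<omega>\<close> for two of the fields and commuting them produces \<open>L\<^sub>0\<close>, and it follows that for fixed \<open>x, a, b\<close> the class of
  \<open>(x\<^bsub>(n)\<^esub>a|b)\<close> is zero for all sufficiently negative \<open>n\<close>.

  On the other hand \<open>V\<close> is filtered by total weight of modes, and in the associated graded object all modes commute.
  The relations of \<open>R\<close> then reduce every \<open>(v|b)\<close> to elements \<open>(a|b)\<close> and \<open>(c\<^bsub>(n)\<^esub>a|b)\<close> with
  \<open>a, b, c\<close> homogeneous, and \<open>C\<^sub>2\<close>-cofiniteness of \<open>V\<close> bounds the weights of \<open>a, b, c\<close> that are needed.\<close>


section \<open>Polynomials in three variables with vanishing moments\<close>

text \<open>Read \<open>h a b\<close> as the coefficient of \<open>x^a y^b\<close>. Since weights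
  polynomial in \<open>a\<close> come from powers of the Euler operator \<open>x d/dx\<close>
  evaluated at x = y = 1, the condition says that for g \<ge> K the part of degree g is divisible by
  \<open>(x - y)^(g - K + 1)\<close>. Equivalently, it has degree below K along the direction (1,
  1).\<close>

definition moments_vanish :: "nat \<Rightarrow> (nat \<Rightarrow> nat \<Rightarrow> complex) \<Rightarrow> bool"
  where "moments_vanish K h \<longleftrightarrow>
    (\<forall>g q. degree q + K \<le> g \<longrightarrow> (\<Sum>a\<le>g. poly q (of_nat a) * h a (g - a)) = 0)"

lemma moments_vanishD:
  "moments_vanish K h \<Longrightarrow> degree q + K \<le> g \<Longrightarrow> (\<Sum>a\<le>g. poly q (of_nat a) * h a (g - a)) = 0"
  by (simp add: moments_vanish_def)

lemma moments_vanish_add: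
  "moments_vanish K h \<Longrightarrow> moments_vanish K h' \<Longrightarrow> moments_vanish K (\<lambda>a b. h a b + h' a b)"
  by (simp add: moments_vanish_def distrib_left sum.distrib)

lemma moments_vanish_scale: "moments_vanish K h \<Longrightarrow> moments_vanish K (\<lambda>a b. c * h a b)"
  by (simp add: moments_vanish_def mult.left_commute[of _ c] sum_distrib_left[symmetric])

text \<open>For order 0 all weights of degree up to g are admissible, so Lagrange interpolation at
  0, ..., g isolates a single coefficient.\<close>

lemma moments_vanish_0:
  assumes "moments_vanish 0 h"
  shows "h a b = 0"
proof -
  let ?g = "a + b"
  define q :: "complex poly" where "q = (\<Prod>j\<in>{..?g} - {a}. [:- of_nat j, 1:])"
  have deg: "degree q \<le> ?g"
  proof -
    have "degree q \<le> (\<Sum>j\<in>{..?g} - {a}. degree [:- of_nat j :: complex, 1:])"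
      unfolding q_def by (rule order.trans[OF degree_prod_sum_le]) (simp_all add: comp_def)
    also have "\<dots> = ?g" by simp
    finally show ?thesis .
  qed
  have q: "poly q (of_nat i) = 0 \<longleftrightarrow> i \<noteq> a" if "i \<le> ?g" for i
    using that unfolding q_def poly_prod by (auto simp: prod_zero_iff)
  have "0 = (\<Sum>i\<le>?g. poly q (of_nat i) * h i (?g - i))"
    using moments_vanishD[OF assms, of q ?g] deg by simp
  also have "\<dots> = (\<Sum>i\<le>?g. if i = a then poly q (of_nat a) * h a b else 0)"
    by (intro sum.cong refl) (auto simp: q)
  also have "\<dots> = poly q (of_nat a) * h a b" by simp
  finally show ?thesis using q[of a] by simp
qed

section \<open>Constant-coefficient derivations and the moment conditions\<close>

lemma moments_vanish_deriv1:
  assumes "moments_vanish K h"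
  shows "moments_vanish K (\<lambda>a b. of_nat (Suc a) * h (Suc a) b)"
  unfolding moments_vanish_def
proof (intro allI impI)
  fix g and q :: "complex poly" assume g: "degree q + K \<le> g"
  \<comment> \<open>The derivation, transposed onto the weight, is q(X) -> X q(X - 1). Its degree
    grows by one, and so does the total degree, from g to g + 1.\<close>
  define Q where "Q = [:0, 1:] * pcompose q [:-1, 1:]"
  have "degree Q \<le> 1 + degree q"
    unfolding Q_def by (rule order.trans[OF degree_mult_le]) (simp add: degree_pcompose)
  then have "0 = (\<Sum>a\<le>Suc g. poly Q (of_nat a) * h a (Suc g - a))"
    using moments_vanishD[OF assms, of Q "Suc g"] g by simp
  also have "\<dots> = (\<Sum>a\<le>g. poly Q (of_nat (Suc a)) * h (Suc a) (g - a))"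
    by (subst sum.atMost_Suc_shift) (simp add: Q_def)
  also have "\<dots> = (\<Sum>a\<le>g. poly q (of_nat a) * (of_nat (Suc a) * h (Suc a) (g - a)))"
    by (intro sum.cong refl) (simp add: Q_def poly_pcompose)
  finally show "(\<Sum>a\<le>g. poly q (of_nat a) * (of_nat (Suc a) * h (Suc a) (g - a))) = 0" by simp
qed

lemma moments_vanish_deriv2:
  assumes "moments_vanish K h"
  shows "moments_vanish K (\<lambda>a b. of_nat (Suc b) * h a (Suc b))"
  unfolding moments_vanish_def
proof (intro allI impI)
  fix g and q :: "complex poly" assume g: "degree q + K \<le> g"
  define Q where "Q = [:of_nat (Suc g), -1:] * q"
  have "degree Q \<le> 1 + degree q"
    unfolding Q_def by (rule order.trans[OF degree_mult_le]) (simp add: degree_pcompose)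
  then have "0 = (\<Sum>a\<le>Suc g. poly Q (of_nat a) * h a (Suc g - a))"
    using moments_vanishD[OF assms, of Q "Suc g"] g by simp
  also have "\<dots> = (\<Sum>a\<le>g. poly Q (of_nat a) * h a (Suc g - a))"
    by (simp add: Q_def)
  also have "\<dots> = (\<Sum>a\<le>g. poly q (of_nat a) * (of_nat (Suc (g - a)) * h a (Suc (g - a))))"
    by (intro sum.cong refl) (auto simp: Q_def Suc_diff_le of_nat_diff algebra_simps)
  finally show "(\<Sum>a\<le>g. poly q (of_nat a) * (of_nat (Suc (g - a)) * h a (Suc (g - a)))) = 0" by simp
qed

text \<open>The derivation along (1, 1) kills x - y, so it lowers the total degree but not the order
  of vanishing on the diagonal. Dually the weight becomes X q(X - 1) + (g + 1 - X) q(X), where the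
  terms of degree \<open>degree q + 1\<close> cancel.\<close>

lemma moments_vanish_deriv12:
  assumes "moments_vanish (Suc K) h"
  shows "moments_vanish K (\<lambda>a b. of_nat (Suc a) * h (Suc a) b + of_nat (Suc b) * h a (Suc b))"
  unfolding moments_vanish_def
proof (intro allI impI)
  fix g and q :: "complex poly" assume g: "degree q + K \<le> g"
  define r where "r = pcompose q [:-1, 1:] - q"
  define Q where "Q = [:0, 1:] * r + smult (of_nat (Suc g)) q"
  have r: "coeff r k = 0" if "k \<ge> degree q" for k
  proof (cases "k = degree q")
    case True
    then show ?thesis
      using lead_coeff_comp[of "[:-1, 1::complex:]" q] by (simp add: r_def degree_pcompose)
  next
    case False
    with that show ?thesis by (simp add: r_def coeff_eq_0 degree_pcompose)
  qed
  have "degree Q \<le> degree q"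
    by (rule degree_le) (auto simp: Q_def coeff_eq_0 r coeff_pCons split: nat.splits)
  then have "0 = (\<Sum>a\<le>Suc g. poly Q (of_nat a) * h a (Suc g - a))"
    using moments_vanishD[OF assms, of Q "Suc g"] g by simp
  also have "\<dots> = (\<Sum>a\<le>Suc g. of_nat a * poly q (of_nat a - 1) * h a (Suc g - a)) +
      (\<Sum>a\<le>Suc g. (of_nat (Suc g) - of_nat a) * poly q (of_nat a) * h a (Suc g - a))"
    unfolding sum.distrib[symmetric]
    by (intro sum.cong refl) (simp add: Q_def r_def poly_pcompose algebra_simps)
  also have "(\<Sum>a\<le>Suc g. of_nat a * poly q (of_nat a - 1) * h a (Suc g - a)) =
      (\<Sum>a\<le>g. poly q (of_nat a) * (of_nat (Suc a) * h (Suc a) (g - a)))"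
    by (subst sum.atMost_Suc_shift) (simp add: mult_ac)
  also have "(\<Sum>a\<le>Suc g. (of_nat (Suc g) - of_nat a) * poly q (of_nat a) * h a (Suc g - a)) =
      (\<Sum>a\<le>g. poly q (of_nat a) * (of_nat (Suc (g - a)) * h a (Suc (g - a))))"
  proof -
    have "(of_nat (Suc g) - of_nat a) * poly q (of_nat a) * h a (Suc g - a) =
        poly q (of_nat a) * (of_nat (Suc (g - a)) * h a (Suc (g - a)))" if "a \<le> g" for a
      using that by (simp add: Suc_diff_le of_nat_diff algebra_simps)
    then show ?thesis by (subst sum.atMost_Suc) (auto intro!: sum.cong simp del: of_nat_Suc)
  qed
  finally show "(\<Sum>a\<le>g. poly q (of_nat a) *
      (of_nat (Suc a) * h (Suc a) (g - a) + of_nat (Suc (g - a)) * h a (Suc (g - a)))) = 0"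
    by (simp add: distrib_left sum.distrib)
qed

text \<open>The three derivations \<open>\<partial>\<^sub>1 + \<partial>\<^sub>2\<close>, \<open>\<partial>\<^sub>1 + \<partial>\<^sub>3\<close>, \<open>\<partial>\<^sub>2 + \<partial>\<^sub>3\<close> lower one of the three orders each, and
  they span all derivations with constant coefficients.\<close>

lemma three_moments_vanish:
  assumes "\<And>c. moments_vanish K1 (\<lambda>a b. h a b c)"
    and "\<And>b. moments_vanish K2 (\<lambda>a c. h a b c)"
    and "\<And>a. moments_vanish K3 (\<lambda>b c. h a b c)"
    and "a + b + c > K1 + K2 + K3"
  shows "h a b c = 0"
  using assms
proof (induction "K1 + K2 + K3" arbitrary: K1 K2 K3 h a b c rule: less_induct)
  case less
  note h = less.prems(1-3)
  consider "K1 = 0" | "K2 = 0" | "K3 = 0" | k1 k2 k3 where "K1 = Suc k1" "K2 = Suc k2" "K3 = Suc k3"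
    by (metis not0_implies_Suc)
  then show ?case
  proof cases
    case 1 then show ?thesis using moments_vanish_0[of "\<lambda>a b. h a b c"] h(1) by simp
  next
    case 2 then show ?thesis using moments_vanish_0[of "\<lambda>a c. h a b c"] h(2) by simp
  next
    case 3 then show ?thesis using moments_vanish_0[of "\<lambda>b c. h a b c"] h(3) by simp
  next
    case 4
    \<comment> \<open>This derivative lowers K1 and the total degree by one and keeps K2 and K3.
      Hence \<ge> here yields the strict inequality of the induction hypothesis.\<close>
    have 12: "of_nat (Suc a) * h (Suc a) b c + of_nat (Suc b) * h a (Suc b) c = 0"
      if "a + b + c \<ge> K1 + K2 + K3" for a b c
      by (rule less.hyps[where ?K1.0 = k1 and ?K2.0 = K2 and ?K3.0 = K3 and
            h = "\<lambda>a b c. of_nat (Suc a) * h (Suc a) b c + of_nat (Suc b) * h a (Suc b) c"])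
        (use 4 h that in \<open>auto intro!: moments_vanish_add moments_vanish_scale moments_vanish_deriv12
           moments_vanish_deriv1 moments_vanish_deriv2 simp del: of_nat_Suc\<close>)
    have 13: "of_nat (Suc a) * h (Suc a) b c + of_nat (Suc c) * h a b (Suc c) = 0"
      if "a + b + c \<ge> K1 + K2 + K3" for a b c
      by (rule less.hyps[where ?K1.0 = K1 and ?K2.0 = k2 and ?K3.0 = K3 and
            h = "\<lambda>a b c. of_nat (Suc a) * h (Suc a) b c + of_nat (Suc c) * h a b (Suc c)"])
        (use 4 h that in \<open>auto intro!: moments_vanish_add moments_vanish_scale moments_vanish_deriv12
           moments_vanish_deriv1 moments_vanish_deriv2 simp del: of_nat_Suc\<close>)
    have 23: "of_nat (Suc b) * h a (Suc b) c + of_nat (Suc c) * h a b (Suc c) = 0"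
      if "a + b + c \<ge> K1 + K2 + K3" for a b c
      by (rule less.hyps[where ?K1.0 = K1 and ?K2.0 = K2 and ?K3.0 = k3 and
            h = "\<lambda>a b c. of_nat (Suc b) * h a (Suc b) c + of_nat (Suc c) * h a b (Suc c)"])
        (use 4 h that in \<open>auto intro!: moments_vanish_add moments_vanish_scale moments_vanish_deriv12
           moments_vanish_deriv1 moments_vanish_deriv2 simp del: of_nat_Suc\<close>)
    have solve: "x = 0 \<and> y = 0 \<and> z = 0" if "x + y = 0" "x + z = 0" "y + z = 0" for x y z :: complex
    proof -
      have "x = - y" "z = y" using that by (simp_all add: add_eq_0_iff)
      with that(3) show ?thesis by simp
    qed
    have *: "h (Suc a) b c = 0 \<and> h a (Suc b) c = 0 \<and> h a b (Suc c) = 0"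
      if "a + b + c \<ge> K1 + K2 + K3" for a b c
      using solve[OF 12 13 23, OF that that that] by (simp del: of_nat_Suc)
    \<comment> \<open>All first partial derivatives vanish in this range; since the total degree is
      positive, the coefficient itself occurs in one of them.\<close>
    consider a' where "a = Suc a'" | b' where "b = Suc b'" | c' where "c = Suc c'"
      using less.prems(4) by (metis not0_implies_Suc add_0 not_less0)
    then show ?thesis
      by cases (use * less.prems(4) in auto)
  qed
qed


section \<open>Clearing the poles of a three-point function\<close>

text \<open>The coefficient of \<open>z^(N - c) w^c\<close> in \<open>(z - w)^N\<close>.\<close>

definition signed_binomial :: "nat \<Rightarrow> nat \<Rightarrow> complex"
  where "signed_binomial N c = (-1) ^ c * of_nat (N choose c)"

lemma signed_binomial_reflect:
  assumes "s \<le> N"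
  shows "signed_binomial N (N - s) = (-1) ^ N * signed_binomial N s"
  using assms binomial_symmetric[OF assms]
  by (auto simp: signed_binomial_def minus_one_power_iff)

text \<open>A family \<open>f i j k\<close> lists the coefficients of \<open>z\<^sub>1\<^bsup>-i-1\<^esup> z\<^sub>2\<^bsup>-j-1\<^esup> z\<^sub>3\<^bsup>-k-1\<^esup>\<close> of a formal series;
  the operators multiply it by \<open>(z\<^sub>1 - z\<^sub>2)\<^bsup>N\<^esup>\<close>, \<open>(z\<^sub>1 - z\<^sub>3)\<^bsup>N\<^esup>\<close> and \<open>(z\<^sub>2 - z\<^sub>3)\<^bsup>N\<^esup>\<close>.\<close>

definition mult12 :: "nat \<Rightarrow> (int \<Rightarrow> int \<Rightarrow> int \<Rightarrow> complex) \<Rightarrow> int \<Rightarrow> int \<Rightarrow> int \<Rightarrow> complex"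
  where "mult12 N f i j k = (\<Sum>a\<le>N. signed_binomial N a * f (i + int (N - a)) (j + int a) k)"

definition mult13 :: "nat \<Rightarrow> (int \<Rightarrow> int \<Rightarrow> int \<Rightarrow> complex) \<Rightarrow> int \<Rightarrow> int \<Rightarrow> int \<Rightarrow> complex"
  where "mult13 N f i j k = (\<Sum>b\<le>N. signed_binomial N b * f (i + int (N - b)) j (k + int b))"

definition mult23 :: "nat \<Rightarrow> (int \<Rightarrow> int \<Rightarrow> int \<Rightarrow> complex) \<Rightarrow> int \<Rightarrow> int \<Rightarrow> int \<Rightarrow> complex"
  where "mult23 N f i j k = (\<Sum>c\<le>N. signed_binomial N c * f i (j + int (N - c)) (k + int c))"

text \<open>Multiplication by all three powers of differences and by \<open>(z1 z2 z3)^M\<close>.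
  For the series treated below only nonnegative powers of the variables survive, which leaves a
  polynomial in each total degree.\<close>

definition clear_poles :: "nat \<Rightarrow> nat \<Rightarrow> (int \<Rightarrow> int \<Rightarrow> int \<Rightarrow> complex) \<Rightarrow> int \<Rightarrow> int \<Rightarrow> int \<Rightarrow> complex"
  where "clear_poles N M f i j k =
    mult13 N (mult12 N (mult23 N f)) (i + int M) (j + int M) (k + int M)"

lemma mult12_mult23: "mult12 N (mult23 N f) = mult23 N (mult12 N f)"
proof (intro ext)
  fix i j k
  show "mult12 N (mult23 N f) i j k = mult23 N (mult12 N f) i j k"
    unfolding mult12_def mult23_def sum_distrib_left
    by (subst sum.swap) (simp add: algebra_simps)
qed

text \<open>Exchanging the last two variables interchanges the factors of \<open>mult12\<close> and
  \<open>mult13\<close>. Both have z1 in front, so no sign arises; the sign \<open>(-1)^N\<close> of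
  the remaining factor sits in the hypothesis, which is applied with even N.\<close>

lemma clear_poles_swap23:
  assumes "\<And>i j k. mult23 N f i j k = mult23 N f' i k j"
  shows "clear_poles N M f i j k = clear_poles N M f' i k j"
  unfolding clear_poles_def mult13_def mult12_def sum_distrib_left
  by (subst sum.swap) (simp add: assms algebra_simps)

lemma clear_poles_swap12:
  assumes "\<And>i j k. mult12 N f i j k = mult12 N f' j i k"
  shows "clear_poles N M f i j k = clear_poles N M f' j i k"
  unfolding clear_poles_def mult12_mult23
  unfolding mult13_def mult23_def sum_distrib_left
  by (subst sum.swap) (simp add: assms algebra_simps)

lemma clear_poles_eq_0:
  assumes "\<And>i j k. k \<ge> int M \<Longrightarrow> f i j k = 0" and "k \<ge> 0"
  shows "clear_poles N M f i j k = 0"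
  unfolding clear_poles_def mult12_def mult13_def mult23_def
  using assms(2) by (intro sum.neutral ballI) (auto intro!: sum.neutral assms(1))

section \<open>Moment conditions for families indexed by modes\<close>

text \<open>\<open>Sum_any\<close> is 0 by default on infinite supports, so finiteness is part of
  the condition.\<close>

definition null_sum :: "(int \<Rightarrow> complex) \<Rightarrow> bool"
  where "null_sum g \<longleftrightarrow> finite {i. g i \<noteq> 0} \<and> Sum_any g = 0"

lemma null_sum_scale: "null_sum g \<Longrightarrow> null_sum (\<lambda>i. c * g i)"
  unfolding null_sum_def
  by (auto intro: rev_finite_subset simp: Sum_any_right_distrib[symmetric])

lemma null_sum_sum:
  assumes "finite S" "\<And>c. c \<in> S \<Longrightarrow> null_sum (g c)"
  shows "null_sum (\<lambda>i. \<Sum>c\<in>S. g c i)"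
  using assms
proof (induction S)
  case empty
  show ?case by (simp add: null_sum_def)
next
  case (insert c S)
  then have *: "null_sum (g c)" "null_sum (\<lambda>i. \<Sum>c\<in>S. g c i)" by auto
  have "finite {i. g c i + (\<Sum>c\<in>S. g c i) \<noteq> 0}"
    by (rule finite_subset[of _ "{i. g c i \<noteq> 0} \<union> {i. (\<Sum>c\<in>S. g c i) \<noteq> 0}"])
      (use * in \<open>auto simp: null_sum_def\<close>)
  with * insert.hyps show ?case
    by (simp add: null_sum_def Sum_any.distrib)
qed

lemma null_sum_shift:
  assumes "null_sum g"
  shows "null_sum (\<lambda>i. g (i + A))"
proof -
  have bij: "bij (\<lambda>i::int. i + A)"
    by (rule o_bij[where g = "\<lambda>i. i - A"]) (simp_all add: fun_eq_iff)
  have "{i. g (i + A) \<noteq> 0} = (\<lambda>i. i - A) ` {i. g i \<noteq> 0}"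
    by (force simp: image_iff)
  moreover have "Sum_any (\<lambda>i. g (i + A)) = Sum_any g"
    by (rule Sum_any.reindex_cong[OF bij, symmetric]) (simp add: comp_def)
  ultimately show ?thesis using assms by (simp add: null_sum_def)
qed

text \<open>Each monomial of the clearing factor shifts i + j by at most 3 N + 2 M: at most N for
  each power of a difference, and M for each of z1 and z2. The admissible degree of the weights
  shrinks by this amount.\<close>

lemma null_sum_clear_poles:
  assumes mom: "\<And>t k q. t \<le> -3 \<Longrightarrow> int (degree q) \<le> -3 - t \<Longrightarrow> null_sum (\<lambda>i. poly q (of_int i) * f i (t - i) k)"
    and q: "int (degree q) \<le> -3 - t - int (3 * N + 2 * M)"
  shows "null_sum (\<lambda>i. poly q (of_int i) * clear_poles N M f i (t - i) k)"
proof -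
  have shifted: "null_sum (\<lambda>i. poly q (of_int i) * f (i + A) (t - i + B) k)"
    if "A + B \<le> int (3 * N + 2 * M)" for A B k
  proof -
    define Q where "Q = pcompose q [:- of_int A, 1:]"
    have "null_sum (\<lambda>i. poly Q (of_int i) * f i (t + A + B - i) k)"
      by (rule mom) (use q that in \<open>auto simp: Q_def degree_pcompose\<close>)
    from null_sum_shift[OF this, of A] show ?thesis
      by (simp add: Q_def poly_pcompose algebra_simps)
  qed
  have "null_sum (\<lambda>i. \<Sum>b\<le>N. \<Sum>a\<le>N. \<Sum>c\<le>N.
      (signed_binomial N b * (signed_binomial N a * signed_binomial N c)) *
      (poly q (of_int i) * f (i + (int M + (int (N - b) + int (N - a))))
        (t - i + (int M + (int a + int (N - c)))) (k + (int M + (int b + int c)))))"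
    by (intro null_sum_sum null_sum_scale shifted) auto
  then show ?thesis
    by (simp add: clear_poles_def mult12_def mult13_def mult23_def sum_distrib_left mult_ac add.assoc)
qed

lemma moments_vanish_clear_poles:
  assumes mom: "\<And>t k q. t \<le> -3 \<Longrightarrow> int (degree q) \<le> -3 - t \<Longrightarrow> null_sum (\<lambda>i. poly q (of_int i) * f i (t - i) k)"
    and supp: "\<And>i j. i \<ge> 0 \<or> j \<ge> 0 \<Longrightarrow> clear_poles N M f i j k = 0"
  shows "moments_vanish (3 * N + 2 * M + 1) (\<lambda>a b. clear_poles N M f (-1 - int a) (-1 - int b) k)"
  unfolding moments_vanish_def
proof (intro allI impI)
  fix g and q :: "complex poly"
  assume g: "degree q + (3 * N + 2 * M + 1) \<le> g"
  \<comment> \<open>The substitution i = -1 - a turns mode numbers into exponents. Degree g is total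
    mode t = -2 - g, so -3 - t is g - 1, which accounts for the extra 1 in the order.\<close>
  define Q where "Q = pcompose q [:-1, -1:]"
  let ?F = "\<lambda>i. poly Q (of_int i) * clear_poles N M f i (- 2 - int g - i) k"
  have null: "null_sum ?F"
    by (rule null_sum_clear_poles[where f = f, OF mom]) (use g in \<open>auto simp: Q_def degree_pcompose\<close>)
  have sub: "{i. ?F i \<noteq> 0} \<subseteq> (\<lambda>a. -1 - int a) ` {..g}"
  proof
    fix i assume "i \<in> {i. ?F i \<noteq> 0}"
    with supp[of i "- 2 - int g - i"] have "i < 0" "- 2 - int g - i < 0" by force+
    then have "i = -1 - int (nat (-1 - i))" "nat (-1 - i) \<le> g" by auto
    then show "i \<in> (\<lambda>a. -1 - int a) ` {..g}" by blast
  qed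
  have "0 = Sum_any ?F" using null by (simp add: null_sum_def)
  also have "\<dots> = sum ?F ((\<lambda>a. -1 - int a) ` {..g})"
    by (rule Sum_any.expand_superset[OF _ sub]) simp
  also have "\<dots> = (\<Sum>a\<le>g. ?F (-1 - int a))"
    by (subst sum.reindex) (auto simp: inj_on_def)
  also have "\<dots> = (\<Sum>a\<le>g. poly q (of_nat a) * clear_poles N M f (-1 - int a) (-1 - int (g - a)) k)"
    by (intro sum.cong refl) (auto simp: Q_def poly_pcompose of_nat_diff algebra_simps)
  finally show "(\<Sum>a\<le>g. poly q (of_nat a) * clear_poles N M f (-1 - int a) (-1 - int (g - a)) k) = 0"
    by simp
qed

section \<open>Cancelling powers of differences\<close>

text \<open>On series truncated in the second variable, multiplication by \<open>(z1 - z2)^N\<close>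
  is injective in each total degree: the term a = 0 expresses \<open>g i j\<close> through entries
  with larger second index, and these vanish from J on.\<close>

lemma mult_power_diff_inject:
  fixes g :: "int \<Rightarrow> int \<Rightarrow> complex"
  assumes trunc: "\<And>i j. j \<ge> J \<Longrightarrow> g i j = 0"
    and zero: "\<And>i j. i + j \<le> T \<Longrightarrow> (\<Sum>a\<le>N. signed_binomial N a * g (i + int (N - a)) (j + int a)) = 0"
    and "i + j \<le> T"
  shows "g i j = 0"
  using assms(3)
proof (induction "nat (J - j)" arbitrary: i j rule: less_induct)
  case less
  show ?case
  proof (cases "j \<ge> J")
    case True then show ?thesis by (rule trunc)
  next
    case False
    have "0 = (\<Sum>a\<le>N. signed_binomial N a * g (i - int N + int (N - a)) (j + int a))"
      using zero[of "i - int N" j] less.prems by simp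
    also have "\<dots> = (\<Sum>a\<le>N. if a = 0 then g i j else 0)"
    proof (intro sum.cong refl)
      fix a assume "a \<in> {..N}"
      then show "signed_binomial N a * g (i - int N + int (N - a)) (j + int a) = (if a = 0 then g i j else 0)"
        using less.hyps[of "j + int a" "i - int a"] less.prems False
        by (auto simp: signed_binomial_def of_nat_diff algebra_simps)
    qed
    finally show ?thesis by simp
  qed
qed

text \<open>Truncation is assumed uniformly only for the last variable, and moments only for the
  first two. Quantifying over all labels in \<open>S\<close> lets locality carry both to every
  variable and every pair once the poles are cleared; then \<open>three_moments_vanish\<close>
  applies.\<close>

lemma three_fields_vanish:
  fixes f :: "'b \<Rightarrow> 'b \<Rightarrow> 'b \<Rightarrow> int \<Rightarrow> int \<Rightarrow> int \<Rightarrow> complex"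
  assumes loc12: "\<And>x y z i j k. x \<in> S \<Longrightarrow> y \<in> S \<Longrightarrow> z \<in> S \<Longrightarrow>
      mult12 N (f x y z) i j k = mult12 N (f y x z) j i k"
    and loc23: "\<And>x y z i j k. x \<in> S \<Longrightarrow> y \<in> S \<Longrightarrow> z \<in> S \<Longrightarrow>
      mult23 N (f x y z) i j k = mult23 N (f x z y) i k j"
    and trunc3: "\<And>x y z i j k. x \<in> S \<Longrightarrow> y \<in> S \<Longrightarrow> z \<in> S \<Longrightarrow> k \<ge> int M \<Longrightarrow> f x y z i j k = 0"
    and trunc2: "\<And>x y z k. x \<in> S \<Longrightarrow> y \<in> S \<Longrightarrow> z \<in> S \<Longrightarrow> \<exists>J. \<forall>i. \<forall>j\<ge>J. f x y z i j k = 0"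
    and mom: "\<And>x y z t k q. x \<in> S \<Longrightarrow> y \<in> S \<Longrightarrow> z \<in> S \<Longrightarrow> t \<le> -3 \<Longrightarrow> int (degree q) \<le> -3 - t \<Longrightarrow>
      null_sum (\<lambda>i. poly q (of_int i) * f x y z i (t - i) k)"
    and S: "x \<in> S" "y \<in> S" "z \<in> S"
    and total: "i + j + k \<le> - int (7 + 9 * N + 6 * M)"
  shows "f x y z i j k = 0"
proof -
  let ?H = "\<lambda>x y z. clear_poles N M (f x y z)"
  have swap23: "?H x y z i j k = ?H x z y i k j" if "x \<in> S" "y \<in> S" "z \<in> S" for x y z i j k
    by (rule clear_poles_swap23) (rule loc23[OF that])
  have swap12: "?H x y z i j k = ?H y x z j i k" if "x \<in> S" "y \<in> S" "z \<in> S" for x y z i j k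
    by (rule clear_poles_swap12) (rule loc12[OF that])
  have supp3: "?H x y z i j k = 0" if "x \<in> S" "y \<in> S" "z \<in> S" "k \<ge> 0" for x y z i j k
    by (rule clear_poles_eq_0[OF _ that(4)]) (rule trunc3[OF that(1-3)])
  have supp: "?H x y z i j k = 0"
    if "x \<in> S" "y \<in> S" "z \<in> S" "i \<ge> 0 \<or> j \<ge> 0 \<or> k \<ge> 0" for x y z i j k
    using that supp3[of x y z k i j] supp3[of x z y j i k] supp3[of y z x i j k]
      swap23[of x y z i j k] swap12[of x y z i j k] swap23[of y x z j i k]
    by auto
  define K where "K = 3 * N + 2 * M + 1"
  define h where "h a b c = ?H x y z (-1 - int a) (-1 - int b) (-1 - int c)" for a b c
  have m: "moments_vanish K (\<lambda>a b. ?H x y z (-1 - int a) (-1 - int b) k)"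
    if "x \<in> S" "y \<in> S" "z \<in> S" for x y z k
    unfolding K_def
    by (rule moments_vanish_clear_poles) (use that mom supp in auto)
  have h: "h a b c = 0" if "a + b + c > K + K + K" for a b c
    using that
  proof (rule three_moments_vanish[rotated 3])
    show "moments_vanish K (\<lambda>a b. h a b c)" for c
      unfolding h_def by (rule m[OF S])
    show "moments_vanish K (\<lambda>a c. h a b c)" for b
      unfolding h_def swap23[OF S] by (rule m) (use S in auto)
    show "moments_vanish K (\<lambda>b c. h a b c)" for a
      unfolding h_def swap12[OF S] swap23[OF S(2,1,3)] by (rule m) (use S in auto)
  qed
  \<comment> \<open>Here i + j + k = -3 - (a + b + c), so a + b + c > 3 K becomes the bound -(4 + 3
    K) = -(7 + 9 N + 6 M).\<close>
  have H: "?H x y z i j k = 0" if "i + j + k \<le> - int (4 + 3 * K)" for i j k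
  proof (cases "i \<ge> 0 \<or> j \<ge> 0 \<or> k \<ge> 0")
    case True then show ?thesis by (rule supp[OF S])
  next
    case False
    then have "h (nat (-1 - i)) (nat (-1 - j)) (nat (-1 - k)) = ?H x y z i j k"
      by (simp add: h_def)
    moreover have "h (nat (-1 - i)) (nat (-1 - j)) (nat (-1 - k)) = 0"
      by (rule h) (use that False in linarith)
    ultimately show ?thesis by simp
  qed
  define T where "T = - int (4 + 3 * K)"
  let ?f23 = "mult23 N (f x y z)" and ?f12 = "mult12 N (mult23 N (f x y z))"
  \<comment> \<open>The powers of differences are cancelled one by one, outermost first. Against z3
    the truncation bound M is uniform; for \<open>(z1 - z2)^N\<close> the bound in z2 depends on k,
    so a maximum over the N + 1 shifts of k is taken.\<close>
  have 1: "?f12 i j k = 0" if "i + j + k \<le> T" for i j k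
  proof -
    have "mult13 N ?f12 i j k = 0" if "i + j + k \<le> T" for i j k
      using H[of "i - int M" "j - int M" "k - int M"] that by (simp add: clear_poles_def T_def)
    then show ?thesis
      using that unfolding mult13_def
      by (intro mult_power_diff_inject[where g = "\<lambda>i k. ?f12 i j k" and i = i and j = k
            and J = "int M" and T = "T - j" and N = N])
        (auto simp: mult12_def mult23_def trunc3[OF S])
  qed
  have 2: "?f23 i j k = 0" if "i + j + k \<le> T" for i j k
  proof -
    from trunc2[OF S] obtain J where J: "\<forall>i. \<forall>j\<ge>J k. f x y z i j k = 0" for k by metis
    have "?f23 i j k = 0" if "j \<ge> Max ((\<lambda>c. J (k + int c)) ` {..N})" for i j
      unfolding mult23_def
    proof (intro sum.neutral ballI)
      fix c assume "c \<in> {..N}"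
      then have "J (k + int c) \<le> j + int (N - c)" using that by (simp add: trans_le_add1 add_increasing2)
      with J show "signed_binomial N c * f x y z i (j + int (N - c)) (k + int c) = 0" by simp
    qed
    then show ?thesis
      using that 1 unfolding mult12_def
      by (intro mult_power_diff_inject[where g = "\<lambda>i j. ?f23 i j k" and i = i and j = j and T = "T - k" and N = N
            and J = "Max ((\<lambda>c. J (k + int c)) ` {..N})"]) auto
  qed
  show ?thesis
    using 2 total unfolding mult23_def
    by (intro mult_power_diff_inject[where g = "\<lambda>j k. f x y z i j k" and i = j and j = k and T = "T - i" and N = N and J = "int M"])
      (auto simp: trunc3[OF S] T_def K_def)
qed


section \<open>Modes of a vertex operator algebra\<close>

text \<open>A vector outside a subspace is separated from it by a linear functional. This turns
  computations modulo the C2-space into statements about families of complex numbers.\<close>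

lemma subspace_memI:
  fixes v :: "'a::complex_vector"
  assumes S: "complex_vector.subspace S"
    and "\<And>\<phi> :: 'a \<Rightarrow> complex. clinear \<phi> \<Longrightarrow> (\<And>s. s \<in> S \<Longrightarrow> \<phi> s = 0) \<Longrightarrow> \<phi> v = 0"
  shows "v \<in> S"
proof (rule ccontr)
  assume v: "v \<notin> S"
  interpret vector_space_pair "scaleC :: complex \<Rightarrow> 'a \<Rightarrow> 'a" "scaleC :: complex \<Rightarrow> complex \<Rightarrow> complex"
    by unfold_locales
  obtain B where B: "B \<subseteq> S" "complex_vector.independent B" "S \<subseteq> complex_vector.span B"
    using complex_vector.maximal_independent_subset by blast
  have span: "complex_vector.span B = S"
    using B S by (metis complex_vector.span_subspace)
  have "complex_vector.independent (insert v B)"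
    using B v span by (simp add: complex_vector.independent_insert)
  from linear_independent_extend[OF this, of "\<lambda>x. if x = v then 1 else 0"]
  obtain \<phi> :: "'a \<Rightarrow> complex" where \<phi>: "clinear \<phi>"
    and vals: "\<forall>x\<in>insert v B. \<phi> x = (if x = v then 1 else 0)"
    by blast
  have B0: "\<phi> b = 0" if "b \<in> B" for b
    using vals that v B(1) by auto
  have "\<phi> s = 0" if "s \<in> S" for s
    using that unfolding span[symmetric]
    by (induction rule: complex_vector.span_induct_alt)
      (simp_all add: clinear_zero[OF \<phi>] clinear_add[OF \<phi>] clinear_scaleC[OF \<phi>] B0)
  with assms(2)[OF \<phi>] vals show False by simp
qed

lemma Sum_any_single: "(\<And>i. i \<noteq> k \<Longrightarrow> f i = 0) \<Longrightarrow> Sum_any f = f k"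
  by (subst Sum_any.expand_superset[of "{k}"]) auto

lemma Sum_any_mem_subspace:
  assumes "complex_vector.subspace S" "\<And>i. f i \<in> S"
  shows "Sum_any f \<in> S"
  unfolding Sum_any.expand_set by (intro complex_vector.subspace_sum assms)

context vertex_operator_algebra
begin

abbreviation "\<omega> \<equiv> conformal V"

lemma clinear_nprod: "clinear (nprod V n a)" "clinear (\<lambda>a. nprod V n a b)"
  using bilinear_nprod by (auto simp: cbilinear_def)

lemmas nprod_linear [simp] =
  clinear_add[OF clinear_nprod(1)] clinear_add[OF clinear_nprod(2)]
  clinear_diff[OF clinear_nprod(1)] clinear_diff[OF clinear_nprod(2)]
  clinear_neg[OF clinear_nprod(1)] clinear_neg[OF clinear_nprod(2)]
  clinear_scaleC[OF clinear_nprod(1)] clinear_scaleC[OF clinear_nprod(2)]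
  clinear_zero[OF clinear_nprod(1)] clinear_zero[OF clinear_nprod(2)]

text \<open>The case r = 0 of the Borcherds identity, where only i = 0 survives on the
  right.\<close>

lemma commutator:
  "nprod V m a (nprod V n b c) = nprod V n b (nprod V m a c) +
    Sum_any (\<lambda>i::nat. (of_int m gchoose i) *\<^sub>C nprod V (m + n - int i) (nprod V (int i) a b) c)"
proof -
  have "Sum_any (\<lambda>i::nat. ((-1) ^ i * (of_int 0 gchoose i)) *\<^sub>C
         (nprod V (m + 0 - int i) a (nprod V (n + int i) b c) -
          ((-1) powi 0) *\<^sub>C nprod V (n + 0 - int i) b (nprod V (m + int i) a c))) =
      nprod V m a (nprod V n b c) - nprod V n b (nprod V m a c)"
    by (subst Sum_any_single[of 0]) (auto simp: gr0_conv_Suc scaleC_one)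
  with borcherds[of m n 0 a b c] show ?thesis by (simp add: algebra_simps)
qed

text \<open>The case p = 0 of the Borcherds identity.\<close>

lemma iterate:
  "nprod V q (nprod V r a b) c =
    Sum_any (\<lambda>i::nat. ((-1) ^ i * (of_int r gchoose i)) *\<^sub>C
      (nprod V (r - int i) a (nprod V (q + int i) b c) -
       ((-1) powi r) *\<^sub>C nprod V (q + r - int i) b (nprod V (int i) a c)))"
proof -
  have "Sum_any (\<lambda>i::nat. (of_int 0 gchoose i) *\<^sub>C nprod V (0 + q - int i) (nprod V (r + int i) a b) c) =
      nprod V q (nprod V r a b) c"
    by (subst Sum_any_single[of 0]) (auto simp: gr0_conv_Suc scaleC_one)
  with borcherds[of 0 q r a b c] show ?thesis by simp
qed

text \<open>The case r = N of the Borcherds identity, with N so large that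
  \<open>nprod V n a b\<close> vanishes for n \<ge> N and the left-hand side is 0. The bound is
  independent of c, i and j.\<close>

lemma locality:
  "\<exists>N0. \<forall>N\<ge>N0. \<forall>c i j.
    (\<Sum>s\<le>N. signed_binomial N s *\<^sub>C nprod V (i + int (N - s)) a (nprod V (j + int s) b c)) =
    (\<Sum>s\<le>N. signed_binomial N s *\<^sub>C nprod V (j + int s) b (nprod V (i + int (N - s)) a c))"
proof -
  obtain M where M: "\<forall>n\<ge>M. nprod V n a b = 0" using truncation by blast
  show ?thesis
  proof (intro exI[of _ "nat M"] allI impI)
    fix N c i j assume N: "nat M \<le> N"
    let ?X = "\<lambda>s. nprod V (i + int (N - s)) a (nprod V (j + int s) b c)"
    let ?Y = "\<lambda>s. nprod V (j + int (N - s)) b (nprod V (i + int s) a c)"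
    have "0 = Sum_any (\<lambda>s::nat. (of_int i gchoose s) *\<^sub>C
         nprod V (i + j - int s) (nprod V (int N + int s) a b) c)"
      using M N by simp
    also have "\<dots> = Sum_any (\<lambda>s::nat. ((-1) ^ s * (of_int (int N) gchoose s)) *\<^sub>C
         (nprod V (i + int N - int s) a (nprod V (j + int s) b c) -
          ((-1) powi (int N)) *\<^sub>C nprod V (j + int N - int s) b (nprod V (i + int s) a c)))"
      by (rule borcherds)
    also have "\<dots> = (\<Sum>s\<le>N. ((-1) ^ s * (of_int (int N) gchoose s)) *\<^sub>C
         (nprod V (i + int N - int s) a (nprod V (j + int s) b c) -
          ((-1) powi (int N)) *\<^sub>C nprod V (j + int N - int s) b (nprod V (i + int s) a c)))"
      by (rule Sum_any.expand_superset) (auto simp: binomial_gbinomial[symmetric] not_less intro!: leI)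
    also have "\<dots> = (\<Sum>s\<le>N. signed_binomial N s *\<^sub>C ?X s - ((-1) ^ N * signed_binomial N s) *\<^sub>C ?Y s)"
      by (intro sum.cong refl)
        (simp add: signed_binomial_def binomial_gbinomial of_nat_diff complex_vector.scale_right_diff_distrib
          scaleC_scaleC mult_ac add_diff_eq)
    also have "\<dots> = (\<Sum>s\<le>N. signed_binomial N s *\<^sub>C ?X s) - (\<Sum>s\<le>N. ((-1) ^ N * signed_binomial N s) *\<^sub>C ?Y s)"
      by (rule sum_subtractf)
    also have "(\<Sum>s\<le>N. ((-1) ^ N * signed_binomial N s) *\<^sub>C ?Y s) =
        (\<Sum>s\<le>N. signed_binomial N s *\<^sub>C nprod V (j + int s) b (nprod V (i + int (N - s)) a c))"
    proof (rule sum.reindex_bij_witness[of _ "\<lambda>s. N - s" "\<lambda>s. N - s"])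
      fix s assume "s \<in> {..N}"
      then have "(-1) ^ N * signed_binomial N s = signed_binomial N (N - s)"
        by (simp add: signed_binomial_reflect)
      then show "signed_binomial N (N - s) *\<^sub>C
          nprod V (j + int (N - s)) b (nprod V (i + int (N - (N - s))) a c) =
          ((-1) ^ N * signed_binomial N s) *\<^sub>C ?Y s"
        using \<open>s \<in> {..N}\<close> by simp
    qed auto
    finally show "(\<Sum>s\<le>N. signed_binomial N s *\<^sub>C ?X s) =
        (\<Sum>s\<le>N. signed_binomial N s *\<^sub>C nprod V (j + int s) b (nprod V (i + int (N - s)) a c))"
      by simp
  qed
qed

section \<open>Virasoro modes and conformal weights\<close>

lemma translation': "nprod V n (nprod V 0 \<omega> a) b = - of_int n *\<^sub>C nprod V (n - 1) a b"
  using translation[of n a b] by (simp add: virasoro_mode_def)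

lemma L1_L_minus1: "nprod V 2 \<omega> (nprod V 0 \<omega> v) - nprod V 0 \<omega> (nprod V 2 \<omega> v) = 2 *\<^sub>C nprod V 1 \<omega> v"
proof -
  from virasoro obtain z :: complex where z: "\<And>m n v.
      virasoro_mode V m (virasoro_mode V n v) - virasoro_mode V n (virasoro_mode V m v) =
         of_int (m - n) *\<^sub>C virasoro_mode V (m + n) v +
         (if m + n = 0 then (of_int (m ^ 3 - m) / 12 * z) *\<^sub>C v else 0)" by blast
  from z[of 1 "-1" v] show ?thesis by (simp add: virasoro_mode_def)
qed

text \<open>In the commutator with the mode 1 of \<omega> only i = 0 and i = 1 contribute; the
  former is evaluated by the translation axiom.\<close>

lemma L0_commutator:
  "nprod V 1 \<omega> (nprod V n a b) = nprod V n a (nprod V 1 \<omega> b) +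
    nprod V n (nprod V 1 \<omega> a) b - of_int (n + 1) *\<^sub>C nprod V n a b"
proof -
  have g: "(1::complex) gchoose i = 0" if "i \<noteq> 0" "i \<noteq> 1" for i
  proof -
    have "(1::nat) choose i = 0" using that by (intro binomial_eq_0) linarith
    then show ?thesis by (metis binomial_gbinomial of_nat_0 of_nat_1)
  qed
  have "Sum_any (\<lambda>i::nat. (of_int 1 gchoose i) *\<^sub>C nprod V (1 + n - int i) (nprod V (int i) \<omega> a) b) =
      (\<Sum>i\<in>{0,1}. (of_int 1 gchoose i) *\<^sub>C nprod V (1 + n - int i) (nprod V (int i) \<omega> a) b)"
    by (rule Sum_any.expand_superset) (auto simp: g intro: ccontr)
  also have "\<dots> = nprod V n (nprod V 1 \<omega> a) b - of_int (n + 1) *\<^sub>C nprod V n a b"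
    by (simp add: translation' scaleC_one add.commute complex_vector.scale_left_diff_distrib scaleC_add_left)
  finally show ?thesis by (simp add: commutator[of 1 \<omega> n a b] add_diff_eq)
qed

lemma weight_space_iff: "v \<in> weight_space V d \<longleftrightarrow> nprod V 1 \<omega> v = of_int d *\<^sub>C v"
  by (simp add: weight_space_def virasoro_mode_def)

lemma subspace_weight_space: "complex_vector.subspace (weight_space V d)"
  by (auto simp: complex_vector.subspace_def weight_space_iff scaleC_add_right scaleC_scaleC mult.commute)

lemma weight_nprod:
  assumes "a \<in> weight_space V d" "b \<in> weight_space V e" "f = d + e - n - 1"
  shows "nprod V n a b \<in> weight_space V f"
proof -
  have "nprod V 1 \<omega> (nprod V n a b) =
      of_int e *\<^sub>C nprod V n a b + of_int d *\<^sub>C nprod V n a b - of_int (n + 1) *\<^sub>C nprod V n a b"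
    using assms(1,2) by (simp add: weight_space_iff L0_commutator)
  then show ?thesis
    by (simp add: weight_space_iff assms(3) scaleC_add_left complex_vector.scale_left_diff_distrib scaleC_one)
qed

end


section \<open>Odd modes on the tensor square\<close>

lemma Sum_any_reindex_inj:
  assumes "inj h" "\<And>a. a \<notin> range h \<Longrightarrow> g a = 0"
  shows "Sum_any g = Sum_any (\<lambda>i. g (h i))"
proof -
  have "{a. g a \<noteq> 0} = h ` {i. g (h i) \<noteq> 0}"
    using assms(2) by fastforce
  then show ?thesis
    using assms(1) by (simp add: Sum_any.expand_set sum.reindex[OF inj_on_subset[OF assms(1)]])
qed

lemma Sum_any_uminus: "Sum_any (\<lambda>i. - f i) = - Sum_any f" for f :: "'i \<Rightarrow> 'a::ab_group_add"
  by (simp add: Sum_any.expand_set sum_negf)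

lemma clinear_Sum_any_swap:
  assumes "clinear f" "finite {i. g i \<noteq> 0}"
  shows "f (Sum_any g) = Sum_any (\<lambda>i. f (g i))"
proof -
  have "Sum_any (\<lambda>i. f (g i)) = (\<Sum>i | g i \<noteq> 0. f (g i))"
    by (rule Sum_any.expand_superset) (use assms in \<open>auto simp: clinear_zero\<close>)
  then show ?thesis by (simp add: Sum_any.expand_set clinear_sum[OF assms(1)])
qed

lemma tensor_linear [simp]:
  "(a + a') \<otimes> b = a \<otimes> b + a' \<otimes> b" "a \<otimes> (b + b') = a \<otimes> b + a \<otimes> b'"
  "(a - a') \<otimes> b = a \<otimes> b - a' \<otimes> b" "a \<otimes> (b - b') = a \<otimes> b - a \<otimes> b'"
  "(- a) \<otimes> b = - (a \<otimes> b)" "a \<otimes> (- b) = - (a \<otimes> b)"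
  "(c *\<^sub>C a) \<otimes> b = c *\<^sub>C (a \<otimes> b)" "a \<otimes> (c *\<^sub>C b) = c *\<^sub>C (a \<otimes> b)"
  "0 \<otimes> b = 0" "a \<otimes> 0 = 0"
proof -
  have lin: "clinear ((\<otimes>) a)" "clinear (\<lambda>a. a \<otimes> b)" for a :: 'a and b :: 'b
    using cbilinear_tensor by (auto simp: cbilinear_def)
  note clinear_simps = clinear_add clinear_diff clinear_neg clinear_scaleC clinear_zero
  show "(a + a') \<otimes> b = a \<otimes> b + a' \<otimes> b" "(a - a') \<otimes> b = a \<otimes> b - a' \<otimes> b"
    "(- a) \<otimes> b = - (a \<otimes> b)" "(c *\<^sub>C a) \<otimes> b = c *\<^sub>C (a \<otimes> b)" "0 \<otimes> b = 0"
    using clinear_simps[OF lin(2)] by blast+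
  show "a \<otimes> (b + b') = a \<otimes> b + a \<otimes> b'" "a \<otimes> (b - b') = a \<otimes> b - a \<otimes> b'"
    "a \<otimes> (- b) = - (a \<otimes> b)" "a \<otimes> (c *\<^sub>C b) = c *\<^sub>C (a \<otimes> b)" "a \<otimes> 0 = 0"
    using clinear_simps[OF lin(1)] by blast+
qed

lemma tensor_induct [case_names pure add]:
  assumes "\<And>a b. P (a \<otimes> b)" "\<And>x y. P x \<Longrightarrow> P y \<Longrightarrow> P (x + y)"
  shows "P x"
proof (induction x rule: tensor.abs_induct)
  case (1 p)
  have "P (\<Sum>(a, b)\<in>S. Poly_Mapping.lookup p (a, b) *\<^sub>C (a \<otimes> b))" if "finite S" for S
    using that
  proof (induction S)
    case empty
    show ?case using assms(1)[of 0 0] by simp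
  next
    case (insert z S)
    then show ?case
      using assms(2) assms(1)[of "Poly_Mapping.lookup p z *\<^sub>C fst z" "snd z"]
      by (simp add: case_prod_beta)
  qed
  then show ?case by (simp add: abs_tensor_eq free_lift_def)
qed

lemmas tensor_swap_linear [simp] =
  clinear_add[OF clinear_tensor_swap] clinear_diff[OF clinear_tensor_swap] clinear_neg[OF clinear_tensor_swap]
  clinear_scaleC[OF clinear_tensor_swap] clinear_zero[OF clinear_tensor_swap] tensor_swap_tensor

definition sym_prod :: "'a::complex_vector \<Rightarrow> 'a \<Rightarrow> ('a, 'a) tensor"
  where "sym_prod a b = a \<otimes> b + b \<otimes> a"

lemma tensor_swap_sym_prod [simp]: "tensor_swap (sym_prod a b) = sym_prod a b"
  by (simp add: sym_prod_def add.commute)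

lemma sym_prod_linear [simp]:
  "sym_prod (a + a') b = sym_prod a b + sym_prod a' b" "sym_prod a (b + b') = sym_prod a b + sym_prod a b'"
  "sym_prod (a - a') b = sym_prod a b - sym_prod a' b" "sym_prod a (b - b') = sym_prod a b - sym_prod a b'"
  "sym_prod (c *\<^sub>C a) b = c *\<^sub>C sym_prod a b" "sym_prod a (c *\<^sub>C b) = c *\<^sub>C sym_prod a b"
  "sym_prod 0 b = 0" "sym_prod a 0 = 0"
  by (simp_all add: sym_prod_def scaleC_add_right)

context vertex_operator_algebra
begin

abbreviation "vac \<equiv> vacuum V"

lemma clinear_T2: "clinear (nprod (T2 V) n x)" "clinear (\<lambda>x. nprod (T2 V) n x y)"
  using cbilinear_tensor_voa_nprod[OF vertex_operator_algebra_axioms vertex_operator_algebra_axioms]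
  by (auto simp: cbilinear_def T2_def)

lemmas T2_linear [simp] =
  clinear_add[OF clinear_T2(1)] clinear_add[OF clinear_T2(2)]
  clinear_diff[OF clinear_T2(1)] clinear_diff[OF clinear_T2(2)]
  clinear_neg[OF clinear_T2(1)] clinear_neg[OF clinear_T2(2)]
  clinear_scaleC[OF clinear_T2(1)] clinear_scaleC[OF clinear_T2(2)]
  clinear_zero[OF clinear_T2(1)] clinear_zero[OF clinear_T2(2)]

lemma T2_tensor: "nprod (T2 V) n (a \<otimes> b) (c \<otimes> d) = Sum_any (\<lambda>i. nprod V i a c \<otimes> nprod V (n - 1 - i) b d)"
  unfolding T2_def by (rule tensor_voa_nprod[OF vertex_operator_algebra_axioms vertex_operator_algebra_axioms])

lemma T2_left: "nprod (T2 V) n (a \<otimes> vac) (c \<otimes> d) = nprod V n a c \<otimes> d"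
  unfolding T2_tensor by (subst Sum_any_single[of n]) (auto simp: vacuum_left)

lemma T2_right: "nprod (T2 V) n (vac \<otimes> a) (c \<otimes> d) = c \<otimes> nprod V n a d"
  unfolding T2_tensor by (subst Sum_any_single[of "-1"]) (auto simp: vacuum_left)

definition odd_mode :: "'a \<Rightarrow> int \<Rightarrow> ('a, 'a) tensor \<Rightarrow> ('a, 'a) tensor"
  where "odd_mode a n w = nprod (T2 V) n (a \<otimes> vac - vac \<otimes> a) w"

lemma odd_mode_tensor: "odd_mode a n (c \<otimes> d) = nprod V n a c \<otimes> d - c \<otimes> nprod V n a d"
  by (simp add: odd_mode_def T2_left T2_right)

lemma clinear_odd_mode: "clinear (odd_mode a n)"
  unfolding odd_mode_def[abs_def] by (rule clinear_T2)

lemmas odd_mode_linear [simp] =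
  clinear_add[OF clinear_odd_mode] clinear_diff[OF clinear_odd_mode] clinear_neg[OF clinear_odd_mode]
  clinear_scaleC[OF clinear_odd_mode] clinear_zero[OF clinear_odd_mode]

lemma tensor_swap_odd_mode: "tensor_swap (odd_mode a n w) = - odd_mode a n (tensor_swap w)"
  unfolding odd_mode_def tensor_swap_T2[OF vertex_operator_algebra_axioms]
  by (simp del: T2_linear add: clinear_neg[OF clinear_T2(2), symmetric])

lemma odd_mode_truncation: "\<exists>N. \<forall>n\<ge>N. odd_mode a n w = 0"
proof (induction w rule: tensor_induct)
  case (pure c d)
  obtain M N where "\<forall>n\<ge>M. nprod V n a c = 0" "\<forall>n\<ge>N. nprod V n a d = 0"
    using truncation by metis
  then have "\<forall>n\<ge>max M N. odd_mode a n (c \<otimes> d) = 0" by (simp add: odd_mode_tensor)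
  then show ?case by blast
next
  case (add x y)
  then obtain M N where "\<forall>n\<ge>M. odd_mode a n x = 0" "\<forall>n\<ge>N. odd_mode a n y = 0" by blast
  then have "\<forall>n\<ge>max M N. odd_mode a n (x + y) = 0" by simp
  then show ?case by blast
qed

text \<open>The iterate formula with the vacuum as second factor. The vacuum has only the mode -1,
  so each of the two sums collapses to one term, at i = -1 - n and at i = n + r + 1. They are kept
  apart because \<open>Sum_any_nprod_creation\<close> reindexes them differently.\<close>

lemma nprod_creation:
  "nprod V n (nprod V r a vac) c =
    (if n < 0 then (-1) ^ nat (-1 - n) * (of_int r gchoose nat (-1 - n)) else 0) *\<^sub>C nprod V (n + r + 1) a c -
    (if n + r + 1 \<ge> 0 then (-1) ^ nat (n + r + 1) * (of_int r gchoose nat (n + r + 1)) * (-1) powi r else 0)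
      *\<^sub>C nprod V (n + r + 1) a c"
proof -
  let ?k = "\<lambda>i::nat. (-1) ^ i * (of_int r gchoose i) :: complex"
  let ?f = "\<lambda>i. ?k i *\<^sub>C nprod V (r - int i) a (nprod V (n + int i) vac c)"
  let ?g = "\<lambda>i. (?k i * (-1) powi r) *\<^sub>C nprod V (n + r - int i) vac (nprod V (int i) a c)"
  have f: "?f i \<noteq> 0 \<Longrightarrow> i = nat (-1 - n) \<and> n < 0" and g: "?g i \<noteq> 0 \<Longrightarrow> i = nat (n + r + 1) \<and> n + r + 1 \<ge> 0" for i
    by (auto simp: vacuum_left split: if_splits)
  have fin: "finite {i. ?f i \<noteq> 0}" "finite {i. ?g i \<noteq> 0}"
    by (rule finite_subset[of _ "{nat (-1 - n)}"]; use f in blast)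
      (rule finite_subset[of _ "{nat (n + r + 1)}"]; use g in blast)
  have "nprod V n (nprod V r a vac) c = Sum_any (\<lambda>i. ?f i + - ?g i)"
    by (simp add: iterate[of n r a vac c] complex_vector.scale_right_diff_distrib scaleC_scaleC)
  also have "\<dots> = Sum_any ?f + Sum_any (\<lambda>i. - ?g i)"
    by (rule Sum_any.distrib) (use fin in simp_all)
  also have "Sum_any (\<lambda>i. - ?g i) = - Sum_any ?g"
    by (rule Sum_any_uminus)
  also have "Sum_any ?f = ?f (nat (-1 - n))"
    by (rule Sum_any_single) (use f in blast)
  also have "Sum_any ?g = ?g (nat (n + r + 1))"
    by (rule Sum_any_single) (use g in blast)
  finally show ?thesis
    by (auto simp: vacuum_left algebra_simps)
qed

text \<open>These are the cross terms of an iterate: modes of \<open>nprod V r a vac\<close> in one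
  tensor factor, summed against modes of b in the other, reproduce the iterate formula for two
  fields acting on different factors.\<close>

lemma Sum_any_nprod_creation:
  fixes G :: "int \<Rightarrow> int \<Rightarrow> 'b::complex_vector"
  assumes trunc: "\<And>k l. k \<ge> K \<Longrightarrow> G k l = 0" "\<And>k l. l \<ge> K \<Longrightarrow> G k l = 0"
  shows "Sum_any (\<lambda>n.
      (if n < 0 then (-1) ^ nat (-1 - n) * (of_int r gchoose nat (-1 - n)) else 0) *\<^sub>C G (n + r + 1) (q - 1 - n) -
      (if n + r + 1 \<ge> 0 then (-1) ^ nat (n + r + 1) * (of_int r gchoose nat (n + r + 1)) * (-1) powi r else 0)
        *\<^sub>C G (n + r + 1) (q - 1 - n)) =
    Sum_any (\<lambda>i::nat. ((-1) ^ i * (of_int r gchoose i)) *\<^sub>C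
      (G (r - int i) (q + int i) - ((-1) powi r) *\<^sub>C G (int i) (q + r - int i)))"
  (is "Sum_any (\<lambda>n. ?F n - ?F' n) = Sum_any ?R")
proof -
  let ?k = "\<lambda>i::nat. (-1) ^ i * (of_int r gchoose i) :: complex"
  let ?f = "\<lambda>i. ?k i *\<^sub>C G (r - int i) (q + int i)"
  let ?g = "\<lambda>i. (?k i * (-1) powi r) *\<^sub>C G (int i) (q + r - int i)"
  have bound: "n \<in> {q - 1 - K..K - r - 1}" if "G (n + r + 1) (q - 1 - n) \<noteq> 0" for n
    using that trunc(1)[of "n + r + 1"] trunc(2)[of "q - 1 - n"] by force
  have finF: "finite {n. ?F n \<noteq> 0}" "finite {n. ?F' n \<noteq> 0}"
    by (rule finite_subset[of _ "{q - 1 - K..K - r - 1}"]; use bound in fastforce)+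
  have finf: "finite {i. ?f i \<noteq> 0}" "finite {i. ?g i \<noteq> 0}"
  proof -
    have "i \<le> nat (K - q)" if "?f i \<noteq> 0" for i
      using that trunc(2)[of "q + int i" "r - int i"] by (force simp: not_le)
    then show "finite {i. ?f i \<noteq> 0}" by (auto intro: finite_subset[of _ "{..nat (K - q)}"])
    have "i \<le> nat K" if "?g i \<noteq> 0" for i
      using that trunc(1)[of "int i" "q + r - int i"] by (force simp: not_le)
    then show "finite {i. ?g i \<noteq> 0}" by (auto intro: finite_subset[of _ "{..nat K}"])
  qed
  have "Sum_any (\<lambda>n. ?F n - ?F' n) = Sum_any ?F + Sum_any (\<lambda>n. - ?F' n)"
    using Sum_any.distrib[of ?F "\<lambda>n. - ?F' n"] finF by simp
  also have "Sum_any (\<lambda>n. - ?F' n) = - Sum_any ?F'"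
    by (rule Sum_any_uminus)
  also have "Sum_any ?F = Sum_any (\<lambda>i::nat. ?F (-1 - int i))"
  proof (rule Sum_any_reindex_inj)
    fix n assume "n \<notin> range (\<lambda>i. -1 - int i)"
    then have "n \<noteq> -1 - int (nat (-1 - n))" by blast
    then have "\<not> n < 0" by auto
    then show "?F n = 0" by simp
  qed (simp add: inj_on_def)
  also have "\<dots> = Sum_any ?f" by (simp add: algebra_simps)
  also have "Sum_any ?F' = Sum_any (\<lambda>i::nat. ?F' (int i - r - 1))"
  proof (rule Sum_any_reindex_inj)
    fix n assume "n \<notin> range (\<lambda>i. int i - r - 1)"
    then have "n \<noteq> int (nat (n + r + 1)) - r - 1" by blast
    then have "\<not> 0 \<le> n + r + 1" by auto
    then show "?F' n = 0" by simp
  qed (simp add: inj_on_def)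
  also have "\<dots> = Sum_any ?g" by (simp add: algebra_simps)
  also have "Sum_any ?f + - Sum_any ?g = Sum_any ?f + Sum_any (\<lambda>i. - ?g i)"
    by (simp only: Sum_any_uminus)
  also have "\<dots> = Sum_any (\<lambda>i. ?f i + - ?g i)"
    by (rule Sum_any.distrib[symmetric]) (use finf in simp_all)
  also have "\<dots> = Sum_any ?R"
    by (simp add: complex_vector.scale_right_diff_distrib scaleC_scaleC)
  finally show ?thesis .
qed

text \<open>The element on the left is the \<open>r\<close>-th product of \<open>a \<otimes> vac - vac \<otimes> a\<close> and \<open>b \<otimes> vac - vac \<otimes> b\<close>.\<close>

lemma odd_mode_iterate:
  "nprod (T2 V) q (sym_prod (nprod V r a b) vac - sym_prod (nprod V r a vac) b) w =
    Sum_any (\<lambda>i::nat. ((-1) ^ i * (of_int r gchoose i)) *\<^sub>C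
      (odd_mode a (r - int i) (odd_mode b (q + int i) w) -
       ((-1) powi r) *\<^sub>C odd_mode b (q + r - int i) (odd_mode a (int i) w)))"
    (is "?L w = Sum_any (\<lambda>i. ?R i w)")
proof (rule clinear_tensor_eqI[where f = ?L and g = "\<lambda>w. Sum_any (\<lambda>i. ?R i w)"])
  show "clinear ?L" by (rule clinear_T2)
  show "clinear (\<lambda>w. Sum_any (\<lambda>i. ?R i w))"
  proof (rule clinear_Sum_any)
    show "clinear (?R i)" for i
      by (rule clinearI) (simp_all add: scaleC_add_right complex_vector.scale_right_diff_distrib scaleC_scaleC mult_ac)
    fix w
    obtain A B where AB: "\<forall>n\<ge>A. odd_mode a n w = 0" "\<forall>n\<ge>B. odd_mode b n w = 0"
      using odd_mode_truncation by metis
    have "i \<le> nat (max A (B - q))" if "?R i w \<noteq> 0" for i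
    proof (rule ccontr)
      assume "\<not> i \<le> nat (max A (B - q))"
      then have "int i \<ge> A" "q + int i \<ge> B" by auto
      with AB that show False by simp
    qed
    then show "finite {i. ?R i w \<noteq> 0}" by (auto intro: finite_subset[of _ "{..nat (max A (B - q))}"])
  qed
  fix c d
  let ?k = "\<lambda>i::nat. (-1) ^ i * (of_int r gchoose i) :: complex"
  \<comment> \<open>\<open>A\<close> collects the terms with both fields on the same factor, to
    which the iterate formula of V applies; \<open>B G1\<close> and \<open>B G2\<close> are the two
    kinds of cross terms.\<close>
  define A where "A c i = ?k i *\<^sub>C (nprod V (r - int i) a (nprod V (q + int i) b c) -
       ((-1) powi r) *\<^sub>C nprod V (q + r - int i) b (nprod V (int i) a c))" for c i
  define B where "B G i = ?k i *\<^sub>C (G (r - int i) (q + int i) - ((-1) powi r) *\<^sub>C G (int i) (q + r - int i))"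
    for G :: "int \<Rightarrow> int \<Rightarrow> ('a, 'a) tensor" and i
  define G1 where "G1 k l = nprod V k a c \<otimes> nprod V l b d" for k l
  define G2 where "G2 k l = nprod V l b c \<otimes> nprod V k a d" for k l
  obtain K1 K2 K3 K4 where "\<forall>n\<ge>K1. nprod V n a c = 0" "\<forall>n\<ge>K2. nprod V n a d = 0"
      "\<forall>n\<ge>K3. nprod V n b c = 0" "\<forall>n\<ge>K4. nprod V n b d = 0"
    using truncation by metis
  then obtain K where K: "\<And>n. n \<ge> K \<Longrightarrow> nprod V n a c = 0" "\<And>n. n \<ge> K \<Longrightarrow> nprod V n a d = 0"
      "\<And>n. n \<ge> K \<Longrightarrow> nprod V n b c = 0" "\<And>n. n \<ge> K \<Longrightarrow> nprod V n b d = 0"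
    using that[of "max (max K1 K2) (max K3 K4)"] by simp
  have fin: "finite {i. f i \<noteq> 0}" if "\<And>i. int i \<ge> K \<Longrightarrow> int i \<ge> K - q \<Longrightarrow> f i = 0"
    for f :: "nat \<Rightarrow> 'c::zero"
  proof (rule finite_subset[of _ "{..nat (max K (K - q))}"])
    show "{i. f i \<noteq> 0} \<subseteq> {..nat (max K (K - q))}"
    proof
      fix i assume "i \<in> {i. f i \<noteq> 0}"
      then have "\<not> (int i \<ge> K \<and> int i \<ge> K - q)" using that by blast
      then show "i \<in> {..nat (max K (K - q))}" by auto
    qed
  qed simp
  have finA: "finite {i. A c i \<noteq> 0}" "finite {i. A d i \<noteq> 0}"
    by (rule fin; simp add: A_def K)+
  have finB: "finite {i. B G1 i \<noteq> 0}" "finite {i. B G2 i \<noteq> 0}"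
    by (rule fin; simp add: B_def G1_def G2_def K)+
  have cross: "nprod (T2 V) q (nprod V r a vac \<otimes> b) (c \<otimes> d) = Sum_any (B G1)"
    "nprod (T2 V) q (b \<otimes> nprod V r a vac) (c \<otimes> d) = Sum_any (B G2)"
  proof -
    show "nprod (T2 V) q (nprod V r a vac \<otimes> b) (c \<otimes> d) = Sum_any (B G1)"
      unfolding B_def[abs_def] by (subst Sum_any_nprod_creation[of K, symmetric])
        (simp_all add: G1_def K T2_tensor nprod_creation)
    have "Sum_any (\<lambda>i. nprod V i b c \<otimes> nprod V (q - 1 - i) (nprod V r a vac) d) =
        Sum_any (\<lambda>i. nprod V (q - 1 - i) b c \<otimes> nprod V i (nprod V r a vac) d)"
      by (rule Sum_any.reindex_cong[where l = "\<lambda>i. q - 1 - i"])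
        (simp_all add: bij_diff_int comp_def)
    then show "nprod (T2 V) q (b \<otimes> nprod V r a vac) (c \<otimes> d) = Sum_any (B G2)"
      unfolding B_def[abs_def] by (subst Sum_any_nprod_creation[of K, symmetric])
        (simp_all add: G2_def K T2_tensor nprod_creation)
  qed
  have lin: "clinear (\<lambda>c. c \<otimes> d)" "clinear ((\<otimes>) c)"
    by (auto intro: clinearI)
  have R: "?R i (c \<otimes> d) = (A c i \<otimes> d + c \<otimes> A d i) + - (B G1 i + B G2 i)" for i
    by (simp add: A_def B_def G1_def G2_def odd_mode_tensor complex_vector.scale_right_diff_distrib
        scaleC_add_right scaleC_scaleC algebra_simps)
  have "Sum_any (\<lambda>i. ?R i (c \<otimes> d)) =
      Sum_any (\<lambda>i. (A c i \<otimes> d + c \<otimes> A d i) + - (B G1 i + B G2 i))"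
    by (simp only: R)
  also have "\<dots> = Sum_any (\<lambda>i. A c i \<otimes> d + c \<otimes> A d i) + Sum_any (\<lambda>i. - (B G1 i + B G2 i))"
    by (rule Sum_any.distrib; rule fin; simp add: A_def B_def G1_def G2_def K)
  also have "Sum_any (\<lambda>i. A c i \<otimes> d + c \<otimes> A d i) = Sum_any (\<lambda>i. A c i \<otimes> d) + Sum_any (\<lambda>i. c \<otimes> A d i)"
    by (rule Sum_any.distrib; rule fin; simp add: A_def K)
  also have "Sum_any (\<lambda>i. A c i \<otimes> d) = Sum_any (A c) \<otimes> d"
    by (rule clinear_Sum_any_swap[OF lin(1) finA(1), symmetric])
  also have "Sum_any (\<lambda>i. c \<otimes> A d i) = c \<otimes> Sum_any (A d)"
    by (rule clinear_Sum_any_swap[OF lin(2) finA(2), symmetric])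
  also have "Sum_any (\<lambda>i. - (B G1 i + B G2 i)) = - Sum_any (\<lambda>i. B G1 i + B G2 i)"
    by (rule Sum_any_uminus)
  also have "Sum_any (\<lambda>i. B G1 i + B G2 i) = Sum_any (B G1) + Sum_any (B G2)"
    by (rule Sum_any.distrib) (use finB in auto)
  finally have R_sum: "Sum_any (\<lambda>i. ?R i (c \<otimes> d)) =
      Sum_any (A c) \<otimes> d + c \<otimes> Sum_any (A d) + - (Sum_any (B G1) + Sum_any (B G2))" .
  have A_sum: "Sum_any (A c) = nprod V q (nprod V r a b) c" for c
    unfolding A_def[abs_def] by (rule iterate[symmetric])
  show "?L (c \<otimes> d) = Sum_any (\<lambda>i. ?R i (c \<otimes> d))"
    unfolding R_sum A_sum by (simp add: cross sym_prod_def T2_left T2_right)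
qed

section \<open>The C2-space of the orbifold inside the tensor square\<close>

text \<open>This is the image of the C2-space of the orbifold under \<open>Rep_sym_tensor\<close>;
  it allows the argument to stay in the tensor square until the final theorem.\<close>

definition C2_T2 :: "('a, 'a) tensor set"
  where "C2_T2 = complex_vector.span {nprod (T2 V) (-2) x y | x y. tensor_swap x = x \<and> tensor_swap y = y}"

lemma subspace_C2_T2: "complex_vector.subspace C2_T2"
  unfolding C2_T2_def by (rule complex_vector.subspace_span)

lemma T2_translation:
  "nprod (T2 V) n (nprod V 0 \<omega> a \<otimes> b + a \<otimes> nprod V 0 \<omega> b) w = - of_int n *\<^sub>C nprod (T2 V) (n - 1) (a \<otimes> b) w"
proof (induction w rule: tensor_induct)
  case (pure c d)
  let ?G = "\<lambda>i. nprod V i a c \<otimes> nprod V (n - 2 - i) b d"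
  have fin: "finite {i. ?G i \<noteq> 0}"
    using finite_tensor_nprod[OF vertex_operator_algebra_axioms vertex_operator_algebra_axioms, of a c "n - 1" b d] by simp
  have fin': "finite {i. f i *\<^sub>C ?G i \<noteq> 0}" for f :: "int \<Rightarrow> complex"
    by (rule finite_subset[OF _ fin]) auto
  have "Sum_any (\<lambda>i. nprod V i (nprod V 0 \<omega> a) c \<otimes> nprod V (n - 1 - i) b d) =
      Sum_any (\<lambda>i. - of_int (i + 1) *\<^sub>C ?G i)"
    by (rule Sum_any.reindex_cong[where l = "\<lambda>i. i + 1"])
      (auto simp: translation' comp_def fun_eq_iff algebra_simps intro!: o_bij[where g = "\<lambda>i. i - 1"])
  moreover have "Sum_any (\<lambda>i. nprod V i a c \<otimes> nprod V (n - 1 - i) (nprod V 0 \<omega> b) d) =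
      Sum_any (\<lambda>i. - of_int (n - 1 - i) *\<^sub>C ?G i)"
    by (simp add: translation' algebra_simps)
  moreover have "Sum_any (\<lambda>i. - of_int (i + 1) *\<^sub>C ?G i) + Sum_any (\<lambda>i. - of_int (n - 1 - i) *\<^sub>C ?G i) =
      Sum_any (\<lambda>i. - of_int n *\<^sub>C ?G i)"
    by (subst Sum_any.distrib[OF fin' fin', symmetric])
      (simp add: scaleC_add_left[symmetric])
  moreover have "Sum_any (\<lambda>i. - of_int n *\<^sub>C ?G i) = - of_int n *\<^sub>C Sum_any ?G"
    by (rule clinear_Sum_any_swap[OF _ fin, symmetric])
      (simp add: clinearI scaleC_add_right scaleC_scaleC mult.commute)
  ultimately show ?case by (simp add: T2_tensor)
qed (simp add: scaleC_add_right)

text \<open>Descending induction from the mode -2. Translation acts as a derivation on symmetric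
  products, and the mode n of a translated vector is -n times its mode n - 1, where n is
  nonzero.\<close>

lemma sym_prod_mode_mem_C2:
  assumes w: "tensor_swap w = w" and "n \<le> -2"
  shows "nprod (T2 V) n (sym_prod a b) w \<in> C2_T2"
  using assms(2)
proof (induction n arbitrary: a b rule: int_le_induct)
  case base
  show ?case unfolding C2_T2_def by (rule complex_vector.span_base) (use w tensor_swap_sym_prod in blast)
next
  case (step n)
  let ?D = "\<lambda>a. nprod V 0 \<omega> a"
  have "nprod (T2 V) n (sym_prod (?D a) b + sym_prod a (?D b)) w = - of_int n *\<^sub>C nprod (T2 V) (n - 1) (sym_prod a b) w"
  proof -
    have "sym_prod (?D a) b + sym_prod a (?D b) = (?D a \<otimes> b + a \<otimes> ?D b) + (?D b \<otimes> a + b \<otimes> ?D a)"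
      by (simp add: sym_prod_def)
    then have "nprod (T2 V) n (sym_prod (?D a) b + sym_prod a (?D b)) w =
        nprod (T2 V) n (?D a \<otimes> b + a \<otimes> ?D b) w + nprod (T2 V) n (?D b \<otimes> a + b \<otimes> ?D a) w"
      by (simp only: clinear_add[OF clinear_T2(2)])
    then show ?thesis
      unfolding T2_translation by (simp add: sym_prod_def scaleC_add_right)
  qed
  moreover have "nprod (T2 V) n (sym_prod (?D a) b + sym_prod a (?D b)) w \<in> C2_T2"
    using step.IH by (simp add: complex_vector.subspace_add[OF subspace_C2_T2])
  ultimately have "(- of_int n) *\<^sub>C nprod (T2 V) (n - 1) (sym_prod a b) w \<in> C2_T2" by simp
  from complex_vector.subspace_scale[OF subspace_C2_T2 this, of "inverse (- of_int n)"] step.hyps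
  show ?case by (simp add: scaleC_scaleC scaleC_one)
qed

end


section \<open>Vanishing of odd modes in high degree\<close>

lemma null_sum_add: "null_sum f \<Longrightarrow> null_sum g \<Longrightarrow> null_sum (\<lambda>i. f i + g i)"
  using null_sum_sum[of "{True, False}" "\<lambda>b. if b then f else g"] by simp

text \<open>The polynomials binomial(X + l, l) with l \<le> n span all polynomials of degree at most
  n; the induction subtracts a multiple of the top one, rescaled to the monic
  \<open>P\<close>.\<close>

lemma null_sum_binomial_basis:
  assumes "\<And>l. l \<le> n \<Longrightarrow> null_sum (\<lambda>i. ((of_int i + of_nat l) gchoose l) * u i)"
    and "degree q \<le> n"
  shows "null_sum (\<lambda>i. poly q (of_int i) * u i)"
  using assms
proof (induction n arbitrary: q)
  case 0
  then obtain c where "q = [:c:]" by (auto elim: degree_eq_zeroE)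
  with null_sum_scale[OF "0.prems"(1)[of 0], of c] show ?case by simp
next
  case (Suc n)
  define P where "P = (\<Prod>j = 0..<Suc n. [:of_nat j + 1, 1::complex:])"
  have degP: "degree P = Suc n"
    unfolding P_def by (subst degree_prod_sum_eq) auto
  have lcP: "coeff P (Suc n) = 1"
  proof -
    have "lead_coeff P = 1"
      unfolding P_def lead_coeff_prod by (simp del: prod.op_ivl_Suc)
    then show ?thesis by (simp only: degP)
  qed
  have valP: "poly P (of_int i) = fact (Suc n) * ((of_int i + of_nat (Suc n)) gchoose Suc n)" for i
  proof -
    have "poly P (of_int i) = pochhammer (of_int i + 1) (Suc n)"
      by (simp add: P_def poly_prod pochhammer_prod add_ac del: prod.op_ivl_Suc)
    then show ?thesis by (simp add: gbinomial_pochhammer' del: fact_Suc)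
  qed
  define r where "r = q - smult (coeff q (Suc n)) P"
  have "degree r \<le> n"
  proof (rule degree_le, intro allI impI)
    fix i assume "n < i"
    then consider "i = Suc n" | "i > Suc n" by linarith
    then show "coeff r i = 0"
      by cases (use Suc.prems(2) degP lcP in \<open>auto simp: r_def coeff_eq_0\<close>)
  qed
  then have "null_sum (\<lambda>i. poly r (of_int i) * u i)"
    using Suc.IH Suc.prems(1) by simp
  from null_sum_add[OF this null_sum_scale[OF Suc.prems(1)[of "Suc n"], of "coeff q (Suc n) * fact (Suc n)"]]
  show ?case by (simp add: r_def valP algebra_simps)
qed

lemma minus_one_powi: "(-1 :: complex) powi (-1 - int l) = - ((-1) ^ l)"
proof -
  have "(-1 :: complex) powi (-1 - int l) = inverse ((-1) powi (1 + int l))"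
    using power_int_minus[of "-1 :: complex" "1 + int l"] by simp
  also have "(-1 :: complex) powi (1 + int l) = (-1) ^ Suc l"
    by (metis of_nat_Suc power_int_of_nat)
  finally show ?thesis by (simp add: minus_one_power_iff)
qed

lemma gchoose_minus_Suc: "((-1) ^ i * ((of_int (-1 - int l) :: complex) gchoose i)) = of_nat ((l + i) choose l)"
proof -
  have "(of_int (-1 - int l) :: complex) gchoose i = (- of_nat (Suc l)) gchoose i" by simp
  also have "\<dots> = (-1) ^ i * ((of_nat (Suc l) + of_nat i - 1) gchoose i)" by (rule gbinomial_minus)
  also have "(of_nat (Suc l) + of_nat i - 1 :: complex) = of_nat (l + i)" by simp
  also have "of_nat (l + i) gchoose i = (of_nat ((l + i) choose i) :: complex)" by (simp add: binomial_gbinomial)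
  also have "(l + i) choose i = (l + i) choose l" using binomial_symmetric[of i "l + i"] by simp
  finally show ?thesis by (simp add: mult.assoc[symmetric] power_mult_distrib[symmetric])
qed

text \<open>\<open>u\<close> and \<open>v\<close> are the coefficients, in fixed total degree, of the expansions of one rational function of
  \<open>z\<^sub>1, z\<^sub>2\<close> in \<open>|z\<^sub>1| > |z\<^sub>2|\<close> and in \<open>|z\<^sub>1| < |z\<^sub>2|\<close>; \<open>residues\<close> says that it vanishes on the diagonal to order
  at least \<open>-t - 2\<close>.\<close>

lemma null_sum_of_residues:
  fixes u v :: "int \<Rightarrow> complex"
  assumes u: "\<And>k. k \<le> A \<Longrightarrow> u k = 0" and v: "\<And>k. k \<ge> B \<Longrightarrow> v k = 0"
    and residues: "\<And>r. r \<ge> t + 2 \<Longrightarrow>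
      Sum_any (\<lambda>i::nat. ((-1) ^ i * (of_int r gchoose i)) * (u (r - int i) - ((-1) powi r) * v (int i))) = 0"
    and t: "t \<le> -3" and q: "int (degree q) \<le> -3 - t"
  shows "null_sum (\<lambda>i. poly q (of_int i) * u i)"
proof -
  \<comment> \<open>For r = n \<ge> 0 the residue conditions form a triangular system for the
    differences u - v at 0, ..., n.\<close>
  have uv: "u (int n) = v (int n)" for n
  proof (induction n rule: less_induct)
    case (less n)
    have "0 = Sum_any (\<lambda>i::nat. ((-1) ^ i * (of_int (int n) gchoose i)) *
        (u (int n - int i) - ((-1) powi int n) * v (int i)))"
      using residues[of "int n"] t by simp
    also have "\<dots> = (\<Sum>i\<le>n. ((-1) ^ i * (of_int (int n) gchoose i)) *
        (u (int n - int i) - ((-1) powi int n) * v (int i)))"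
      by (rule Sum_any.expand_superset) (auto simp: binomial_gbinomial[symmetric] intro!: leI)
    also have "\<dots> = (\<Sum>i\<le>n. signed_binomial n i * u (int (n - i))) -
        (\<Sum>i\<le>n. (-1) ^ n * signed_binomial n i * v (int i))"
      unfolding sum_subtractf[symmetric]
      by (intro sum.cong refl) (simp add: signed_binomial_def binomial_gbinomial of_nat_diff algebra_simps)
    also have "(\<Sum>i\<le>n. (-1) ^ n * signed_binomial n i * v (int i)) =
        (\<Sum>i\<le>n. signed_binomial n i * v (int (n - i)))"
    proof (rule sum.reindex_bij_witness[of _ "\<lambda>s. n - s" "\<lambda>s. n - s"])
      fix s assume s: "s \<in> {..n}"
      then have "(-1) ^ n * signed_binomial n s = signed_binomial n (n - s)"
        by (simp add: signed_binomial_reflect)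
      with s show "signed_binomial n (n - s) * v (int (n - (n - s))) = (-1) ^ n * signed_binomial n s * v (int s)"
        by simp
    qed auto
    also have "(\<Sum>i\<le>n. signed_binomial n i * u (int (n - i))) - (\<Sum>i\<le>n. signed_binomial n i * v (int (n - i))) =
        (\<Sum>i\<le>n. if i = 0 then u (int n) - v (int n) else 0)"
      unfolding sum_subtractf[symmetric]
    proof (intro sum.cong refl)
      fix i assume "i \<in> {..n}"
      then show "signed_binomial n i * u (int (n - i)) - signed_binomial n i * v (int (n - i)) =
          (if i = 0 then u (int n) - v (int n) else 0)"
        using less.IH[of "n - i"] by (auto simp: signed_binomial_def)
    qed
    finally show ?case by simp
  qed
  have fin_u: "finite {i. u i \<noteq> 0}"
  proof (rule finite_subset[of _ "{A..max 0 B}"])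
    show "{i. u i \<noteq> 0} \<subseteq> {A..max 0 B}"
    proof
      fix i assume "i \<in> {i. u i \<noteq> 0}"
      then have "u i \<noteq> 0" by simp
      moreover from this have "\<not> (i \<ge> 0 \<and> i \<ge> B)" using uv[of "nat i"] v[of i] by auto
      ultimately show "i \<in> {A..max 0 B}" using u[of i] by fastforce
    qed
  qed simp
  \<comment> \<open>The residue with r = -1 - l is, up to sign, the moment with weight binomial(X +
    l, l): the weight vanishes at -l, ..., -1, and at nonnegative indices v may be replaced by u.
    The condition r \<ge> t + 2 reads l \<le> -3 - t.\<close>
  have basis: "null_sum (\<lambda>i. ((of_int i + of_nat l) gchoose l) * u i)" if l: "l \<le> nat (-3 - t)" for l
  proof -
    let ?p = "\<lambda>i::int. (of_int i + of_nat l :: complex) gchoose l"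
    have fin: "finite {i. ?p i * u i \<noteq> 0}"
      by (rule finite_subset[OF _ fin_u]) auto
    let ?g = "\<lambda>i. if i \<ge> 0 then ?p i * u i else 0" and ?h = "\<lambda>i. if i < 0 then ?p i * u i else 0"
    let ?c = "\<lambda>i. of_nat ((l + i) choose l) :: complex"
    have p1: "?p (int i) = ?c i" for i
      by (simp add: binomial_gbinomial add.commute)
    have p2: "?p (-1 - int l - int i) = (-1) ^ l * ?c i" for i
    proof -
      have "?p (-1 - int l - int i) = (- of_nat (Suc i)) gchoose l" by (simp add: algebra_simps)
      also have "\<dots> = (-1) ^ l * ((of_nat (Suc i) + of_nat l - 1) gchoose l)" by (rule gbinomial_minus)
      also have "(of_nat (Suc i) + of_nat l - 1 :: complex) = of_nat (l + i)" by simp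
      finally show ?thesis by (simp add: binomial_gbinomial)
    qed
    have p3: "?p i = 0" if "i < 0" "i \<ge> - int l" for i
    proof -
      have "(of_int i + of_nat l :: complex) = of_nat (nat (i + int l))"
        using that by (simp add: of_nat_nat)
      moreover have "nat (i + int l) choose l = 0"
        using that by (intro binomial_eq_0) linarith
      ultimately show ?thesis by (metis binomial_gbinomial of_nat_0)
    qed
    have finv: "finite {i. v (int i) \<noteq> 0}"
    proof (rule finite_subset[of _ "{..nat B}"])
      show "{i. v (int i) \<noteq> 0} \<subseteq> {..nat B}"
      proof
        fix i assume "i \<in> {i. v (int i) \<noteq> 0}"
        with v[of "int i"] have "int i < B" by force
        then show "i \<in> {..nat B}" by simp
      qed
    qed simp
    have finu': "finite {i. u (-1 - int l - int i) \<noteq> 0}"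
      using finite_vimageI[OF fin_u, of "\<lambda>i. -1 - int l - int i"] by (simp add: inj_on_def vimage_def)
    have "Sum_any (\<lambda>i. ?p i * u i) = Sum_any (\<lambda>i. ?g i + ?h i)"
      by (rule arg_cong[where f = Sum_any]) auto
    also have "\<dots> = Sum_any ?g + Sum_any ?h"
      by (rule Sum_any.distrib; rule finite_subset[OF _ fin]) auto
    also have "Sum_any ?g = Sum_any (\<lambda>i::nat. ?g (int i))"
    proof (rule Sum_any_reindex_inj)
      fix i assume "i \<notin> range int"
      then have "\<not> i \<ge> 0" by (metis nonneg_int_cases rangeI)
      then show "?g i = 0" by simp
    qed (simp add: inj_on_def)
    also have "\<dots> = Sum_any (\<lambda>i. ?c i * v (int i))"
      by (rule arg_cong[where f = Sum_any]) (simp only: fun_eq_iff p1 uv if_True of_nat_0_le_iff simp_thms)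
    also have "Sum_any ?h = Sum_any (\<lambda>i::nat. ?h (-1 - int l - int i))"
    proof (rule Sum_any_reindex_inj)
      fix i assume "i \<notin> range (\<lambda>i. -1 - int l - int i)"
      then have "i \<noteq> -1 - int l - int (nat (-1 - int l - i))" by blast
      then have "\<not> i < - int l" by auto
      then show "?h i = 0" by (simp add: p3)
    qed (simp add: inj_on_def)
    also have "\<dots> = Sum_any (\<lambda>i. (-1) ^ l * ?c i * u (-1 - int l - int i))"
    proof (rule arg_cong[where f = Sum_any], rule ext)
      fix i
      have "-1 - int l - int i < 0" by simp
      then show "?h (-1 - int l - int i) = (-1) ^ l * ?c i * u (-1 - int l - int i)"
        by (simp only: p2 if_True)
    qed
    also have "Sum_any (\<lambda>i. ?c i * v (int i)) + Sum_any (\<lambda>i. (-1) ^ l * ?c i * u (-1 - int l - int i)) =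
        Sum_any (\<lambda>i. ?c i * v (int i) + (-1) ^ l * ?c i * u (-1 - int l - int i))"
      by (rule Sum_any.distrib[symmetric];
          rule finite_subset[OF _ finv] finite_subset[OF _ finu']) auto
    also have "\<dots> = Sum_any (\<lambda>i. (-1) ^ l * (?c i * (u (-1 - int l - int i) + (-1) ^ l * v (int i))))"
      by (rule arg_cong[where f = Sum_any], cases "even l") (simp_all add: fun_eq_iff distrib_left right_diff_distrib)
    also have "\<dots> = (-1) ^ l * Sum_any (\<lambda>i. ?c i * (u (-1 - int l - int i) + (-1) ^ l * v (int i)))"
    proof (rule Sum_any_right_distrib[symmetric])
      show "finite {i. ?c i * (u (-1 - int l - int i) + (-1) ^ l * v (int i)) \<noteq> 0}"
        by (rule finite_subset[OF _ finite_UnI[OF finu' finv]]) auto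
    qed
    also have "Sum_any (\<lambda>i. ?c i * (u (-1 - int l - int i) + (-1) ^ l * v (int i))) =
        Sum_any (\<lambda>i::nat. ((-1) ^ i * (of_int (-1 - int l) gchoose i)) *
          (u ((-1 - int l) - int i) - ((-1) powi (-1 - int l)) * v (int i)))"
      by (simp only: gchoose_minus_Suc minus_one_powi) simp
    also have "\<dots> = 0" by (rule residues) (use l t in simp)
    finally show ?thesis using fin by (simp add: null_sum_def)
  qed
  show ?thesis
    by (rule null_sum_binomial_basis[of "nat (-3 - t)", OF basis]) (use q t in auto)
qed

context vertex_operator_algebra
begin

text \<open>The residue with index r is the mode t - r of an even vector. For r \<ge> t + 2 this
  mode is at most -2, so its value on the symmetric w lies in \<open>C2_T2\<close> and is killed by
  \<phi>.\<close>

lemma null_sum_odd_modes: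
  fixes \<phi> :: "('a, 'a) tensor \<Rightarrow> complex"
  assumes \<phi>: "clinear \<phi>" "\<And>x. x \<in> C2_T2 \<Longrightarrow> \<phi> x = 0" and w: "tensor_swap w = w"
    and "t \<le> -3" "int (degree q) \<le> -3 - t"
  shows "null_sum (\<lambda>i. poly q (of_int i) * \<phi> (odd_mode a i (odd_mode b (t - i) w)))"
proof -
  obtain A B where AB: "\<forall>n\<ge>A. odd_mode a n w = 0" "\<forall>n\<ge>B. odd_mode b n w = 0"
    using odd_mode_truncation by metis
  let ?u = "\<lambda>i. \<phi> (odd_mode a i (odd_mode b (t - i) w))"
  let ?v = "\<lambda>i. \<phi> (odd_mode b (t - i) (odd_mode a i w))"
  show ?thesis
  proof (rule null_sum_of_residues[where v = ?v and A = "t - B" and B = A, OF _ _ _ assms(4,5)])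
    show "?u k = 0" if "k \<le> t - B" for k using that AB(2) by (simp add: clinear_zero[OF \<phi>(1)])
    show "?v k = 0" if "k \<ge> A" for k using that AB(1) by (simp add: clinear_zero[OF \<phi>(1)])
    fix r assume r: "r \<ge> t + 2"
    let ?R = "\<lambda>i::nat. ((-1) ^ i * (of_int r gchoose i)) *\<^sub>C
      (odd_mode a (r - int i) (odd_mode b (t - r + int i) w) -
       ((-1) powi r) *\<^sub>C odd_mode b (t - r + r - int i) (odd_mode a (int i) w))"
    have "i \<le> nat (max A (B - t + r))" if "?R i \<noteq> 0" for i
    proof (rule ccontr)
      assume "\<not> i \<le> nat (max A (B - t + r))"
      then have "int i \<ge> A" "t - r + int i \<ge> B" by auto
      with AB that show False by simp
    qed
    then have fin: "finite {i. ?R i \<noteq> 0}" by (auto intro: finite_subset[of _ "{..nat (max A (B - t + r))}"])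
    have "0 = \<phi> (nprod (T2 V) (t - r) (sym_prod (nprod V r a b) vac - sym_prod (nprod V r a vac) b) w)"
      using sym_prod_mode_mem_C2[OF w, of "t - r"] r by (simp add: clinear_diff[OF \<phi>(1)] \<phi>(2))
    also have "\<dots> = \<phi> (Sum_any ?R)" by (simp only: odd_mode_iterate)
    also have "\<dots> = Sum_any (\<lambda>i. \<phi> (?R i))" by (rule clinear_Sum_any_swap[OF \<phi>(1) fin])
    also have "\<dots> = Sum_any (\<lambda>i::nat. ((-1) ^ i * (of_int r gchoose i)) * (?u (r - int i) - ((-1) powi r) * ?v (int i)))"
      by (simp add: clinear_scaleC[OF \<phi>(1)] clinear_diff[OF \<phi>(1)] scaleC_complex_def algebra_simps)
    finally show "Sum_any (\<lambda>i::nat. ((-1) ^ i * (of_int r gchoose i)) * (?u (r - int i) - ((-1) powi r) * ?v (int i))) = 0"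
      by simp
  qed
qed

section \<open>Locality and Virasoro relations of odd modes\<close>

definition mutually_local :: "nat \<Rightarrow> 'a \<Rightarrow> 'a \<Rightarrow> bool"
  where "mutually_local N a b \<longleftrightarrow> (\<forall>w i j.
    (\<Sum>s\<le>N. signed_binomial N s *\<^sub>C odd_mode a (i + int (N - s)) (odd_mode b (j + int s) w)) =
    (\<Sum>s\<le>N. signed_binomial N s *\<^sub>C odd_mode b (j + int s) (odd_mode a (i + int (N - s)) w)))"

text \<open>Modes on different tensor factors commute, so the cross terms agree on both sides and
  locality of V in each factor suffices.\<close>

lemma ex_mutually_local: "\<exists>N0. \<forall>N\<ge>N0. mutually_local N a b"
proof -
  obtain N0 where N0: "\<And>N c i j. N \<ge> N0 \<Longrightarrow>
    (\<Sum>s\<le>N. signed_binomial N s *\<^sub>C nprod V (i + int (N - s)) a (nprod V (j + int s) b c)) =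
    (\<Sum>s\<le>N. signed_binomial N s *\<^sub>C nprod V (j + int s) b (nprod V (i + int (N - s)) a c))"
    using locality[of a b] by blast
  show ?thesis
    unfolding mutually_local_def
  proof (intro exI[of _ N0] allI impI)
    fix N w i j assume N: "N0 \<le> N"
    let ?p = "\<lambda>s. i + int (N - s)" and ?q = "\<lambda>s. j + int s"
    show "(\<Sum>s\<le>N. signed_binomial N s *\<^sub>C odd_mode a (?p s) (odd_mode b (?q s) w)) =
      (\<Sum>s\<le>N. signed_binomial N s *\<^sub>C odd_mode b (?q s) (odd_mode a (?p s) w))"
    proof (induction w rule: tensor_induct)
      case (pure c d)
      have lin: "clinear (\<lambda>c. c \<otimes> d)" "clinear ((\<otimes>) c)"
        by (auto intro: clinearI)
      let ?cross = "\<Sum>s\<le>N. signed_binomial N s *\<^sub>C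
        (nprod V (?q s) b c \<otimes> nprod V (?p s) a d + nprod V (?p s) a c \<otimes> nprod V (?q s) b d)"
      have "(\<Sum>s\<le>N. signed_binomial N s *\<^sub>C odd_mode a (?p s) (odd_mode b (?q s) (c \<otimes> d))) =
          (\<Sum>s\<le>N. signed_binomial N s *\<^sub>C nprod V (?p s) a (nprod V (?q s) b c)) \<otimes> d +
          c \<otimes> (\<Sum>s\<le>N. signed_binomial N s *\<^sub>C nprod V (?p s) a (nprod V (?q s) b d)) - ?cross"
        unfolding clinear_sum[OF lin(1)] clinear_sum[OF lin(2)] sum.distrib[symmetric] sum_subtractf[symmetric]
        by (intro sum.cong refl)
          (simp add: odd_mode_tensor scaleC_add_right complex_vector.scale_right_diff_distrib)
      moreover have "(\<Sum>s\<le>N. signed_binomial N s *\<^sub>C odd_mode b (?q s) (odd_mode a (?p s) (c \<otimes> d))) =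
          (\<Sum>s\<le>N. signed_binomial N s *\<^sub>C nprod V (?q s) b (nprod V (?p s) a c)) \<otimes> d +
          c \<otimes> (\<Sum>s\<le>N. signed_binomial N s *\<^sub>C nprod V (?q s) b (nprod V (?p s) a d)) - ?cross"
        unfolding clinear_sum[OF lin(1)] clinear_sum[OF lin(2)] sum.distrib[symmetric] sum_subtractf[symmetric]
        by (intro sum.cong refl)
          (simp add: odd_mode_tensor scaleC_add_right complex_vector.scale_right_diff_distrib)
      ultimately show ?case by (simp only: N0[OF N])
    qed (simp add: scaleC_add_right sum.distrib)
  qed
qed

text \<open>The cross terms cancel, and each factor contributes
  \<open>[L_1, L_(-1)] = 2 L_0\<close>. The commutator of two odd modes is thus an even one.\<close>

lemma odd_Virasoro_commutator:
  "odd_mode \<omega> 2 (odd_mode \<omega> 0 w) - odd_mode \<omega> 0 (odd_mode \<omega> 2 w) = 2 *\<^sub>C nprod (T2 V) 1 (sym_prod \<omega> vac) w"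
proof (induction w rule: tensor_induct)
  case (pure c d)
  have *: "nprod V 2 \<omega> (nprod V 0 \<omega> v) = nprod V 0 \<omega> (nprod V 2 \<omega> v) + 2 *\<^sub>C nprod V 1 \<omega> v" for v
    using L1_L_minus1[of v] by (simp add: algebra_simps)
  show ?case by (simp add: odd_mode_tensor sym_prod_def T2_left T2_right * scaleC_add_right)
next
  case (add x y)
  have "odd_mode \<omega> 2 (odd_mode \<omega> 0 (x + y)) - odd_mode \<omega> 0 (odd_mode \<omega> 2 (x + y)) =
      (odd_mode \<omega> 2 (odd_mode \<omega> 0 x) - odd_mode \<omega> 0 (odd_mode \<omega> 2 x)) +
      (odd_mode \<omega> 2 (odd_mode \<omega> 0 y) - odd_mode \<omega> 0 (odd_mode \<omega> 2 y))"
    by simp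
  also have "\<dots> = 2 *\<^sub>C nprod (T2 V) 1 (sym_prod \<omega> vac) (x + y)"
    by (simp only: add clinear_add[OF clinear_T2(1)] scaleC_add_right)
  finally show ?case .
qed

lemma even_L0_odd_mode_commutator:
  assumes "a \<in> weight_space V d"
  shows "nprod (T2 V) 1 (sym_prod \<omega> vac) (odd_mode a n w) =
    odd_mode a n (nprod (T2 V) 1 (sym_prod \<omega> vac) w) + of_int (d - n - 1) *\<^sub>C odd_mode a n w"
proof -
  define k :: complex where "k = of_int (d - n - 1)"
  have *: "nprod V 1 \<omega> (nprod V n a v) = nprod V n a (nprod V 1 \<omega> v) + k *\<^sub>C nprod V n a v" for v
    using assms by (simp add: k_def L0_commutator weight_space_iff complex_vector.scale_left_diff_distrib
        scaleC_add_left scaleC_one)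
  show ?thesis
    unfolding k_def[symmetric]
  proof (induction w rule: tensor_induct)
    case (pure c e)
    show ?case
      by (simp add: odd_mode_tensor sym_prod_def T2_left T2_right * complex_vector.scale_right_diff_distrib)
  next
    case (add x y)
    then show ?case by (simp add: scaleC_add_right)
  qed
qed

text \<open>Four odd insertions (three modes and an antisymmetric vector) force vanishing in high degree;
  commuting two conformal modes with \<open>a\<close> turns this into a statement about one mode.\<close>

lemma odd_mode_mem_C2:
  assumes a: "a \<in> weight_space V d" and m: "tensor_swap m = - m"
  shows "\<exists>K. \<forall>n\<le>K. odd_mode a n m \<in> C2_T2"
proof -
  define S where "S = {\<omega>, a}"
  obtain f where f: "\<And>x y N. N \<ge> f x y \<Longrightarrow> mutually_local N x y"
    using ex_mutually_local by metis
  define N0 where "N0 = max (max (f \<omega> \<omega>) (f \<omega> a)) (max (f a \<omega>) (f a a))"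
  \<comment> \<open>An even exponent makes \<open>(z - w)^N\<close> symmetric, so exchanging two
    fields produces no sign.\<close>
  define N where "N = 2 * N0"
  obtain M1 M2 where M12: "\<forall>n\<ge>M1. odd_mode \<omega> n m = 0" "\<forall>n\<ge>M2. odd_mode a n m = 0"
    using odd_mode_truncation by metis
  define M where "M = nat (max M1 M2)"
  have M: "odd_mode x n m = 0" if "x \<in> S" "n \<ge> int M" for x n
  proof -
    have "n \<ge> M1" "n \<ge> M2" using that(2) unfolding M_def by linarith+
    with that(1) M12 show ?thesis by (auto simp: S_def)
  qed
  have loc: "(\<Sum>s\<le>N. signed_binomial N s *\<^sub>C odd_mode x (i + int (N - s)) (odd_mode y (j + int s) w)) =
    (\<Sum>s\<le>N. signed_binomial N s *\<^sub>C odd_mode y (j + int (N - s)) (odd_mode x (i + int s) w))"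
    if "x \<in> S" "y \<in> S" for x y i j w
  proof -
    have "(\<Sum>s\<le>N. signed_binomial N s *\<^sub>C odd_mode x (i + int (N - s)) (odd_mode y (j + int s) w)) =
      (\<Sum>s\<le>N. signed_binomial N s *\<^sub>C odd_mode y (j + int s) (odd_mode x (i + int (N - s)) w))"
    proof -
      have "f x y \<le> N" using that by (auto simp: S_def N_def N0_def)
      then show ?thesis using f[of x y N] unfolding mutually_local_def by blast
    qed
    also have "\<dots> = (\<Sum>s\<le>N. signed_binomial N s *\<^sub>C odd_mode y (j + int (N - s)) (odd_mode x (i + int s) w))"
      by (rule sum.reindex_bij_witness[of _ "\<lambda>s. N - s" "\<lambda>s. N - s"])
        (auto simp: signed_binomial_reflect N_def)
    finally show ?thesis .
  qed
  \<comment> \<open>Replacing 7 by 9 makes room for the modes 2 and 0 of \<omega>, which add 2 to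
    the total; n \<le> d - 2 keeps the eigenvalue d - n - 1 nonzero.\<close>
  define K where "K = min (- int (9 + 9 * N + 6 * M)) (d - 2)"
  have "odd_mode a n m \<in> C2_T2" if n: "n \<le> K" for n
  proof (rule subspace_memI[OF subspace_C2_T2])
    fix \<phi> :: "('a, 'a) tensor \<Rightarrow> complex"
    assume \<phi>: "clinear \<phi>" "\<And>x. x \<in> C2_T2 \<Longrightarrow> \<phi> x = 0"
    define f where "f x y z i j k = \<phi> (odd_mode x i (odd_mode y j (odd_mode z k m)))" for x y z i j k
    have f0: "f x y z i j k = 0"
      if "x \<in> S" "y \<in> S" "z \<in> S" "i + j + k \<le> - int (7 + 9 * N + 6 * M)" for x y z i j k
    proof (rule three_fields_vanish[where f = f and S = S and N = N and M = M, OF _ _ _ _ _ that])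
      fix x y z :: 'a assume S: "x \<in> S" "y \<in> S" "z \<in> S"
      show "mult12 N (f x y z) i j k = mult12 N (f y x z) j i k" for i j k
        using arg_cong[where f = \<phi>, OF loc[OF S(1,2), of i j "odd_mode z k m"]]
        by (simp only: mult12_def f_def clinear_sum[OF \<phi>(1)] clinear_scaleC[OF \<phi>(1)] scaleC_complex_def)
      show "mult23 N (f x y z) i j k = mult23 N (f x z y) i k j" for i j k
        using arg_cong[where f = "\<lambda>w. \<phi> (odd_mode x i w)", OF loc[OF S(2,3), of j k m]]
        by (simp only: mult23_def f_def clinear_sum[OF \<phi>(1)] clinear_sum[OF clinear_odd_mode]
            clinear_scaleC[OF \<phi>(1)] clinear_scaleC[OF clinear_odd_mode] scaleC_complex_def)
      show "f x y z i j k = 0" if "k \<ge> int M" for i j k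
        using M[OF S(3) that] by (simp add: f_def clinear_zero[OF \<phi>(1)])
      show "\<exists>J. \<forall>i. \<forall>j\<ge>J. f x y z i j k = 0" for k
      proof -
        obtain J where "\<forall>n\<ge>J. odd_mode y n (odd_mode z k m) = 0" using odd_mode_truncation by blast
        then have "\<forall>i. \<forall>j\<ge>J. f x y z i j k = 0" by (simp add: f_def clinear_zero[OF \<phi>(1)])
        then show ?thesis by blast
      qed
      \<comment> \<open>One odd mode turns the antisymmetric m into a symmetric vector, as the
        moment conditions on the other two modes require.\<close>
      show "null_sum (\<lambda>i. poly q (of_int i) * f x y z i (t - i) k)"
        if "t \<le> -3" "int (degree q) \<le> -3 - t" for t k q
        unfolding f_def by (rule null_sum_odd_modes[OF \<phi> _ that]) (simp_all add: tensor_swap_odd_mode m)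
    qed
    have S: "\<omega> \<in> S" "a \<in> S" by (auto simp: S_def)
    have n': "n + 2 \<le> - int (7 + 9 * N + 6 * M)" "d - n - 1 \<noteq> 0"
      using n by (auto simp: K_def)
    let ?E = "nprod (T2 V) 1 (sym_prod \<omega> vac)"
    \<comment> \<open>Vanishing for both orders of the two odd conformal modes kills their
      commutator, hence \<open>L_0\<close>, on either side of the mode of \<open>a\<close>.\<close>
    have zero: "f \<omega> \<omega> a 2 0 n = 0" "f \<omega> \<omega> a 0 2 n = 0" "f a \<omega> \<omega> n 2 0 = 0" "f a \<omega> \<omega> n 0 2 = 0"
      using n'(1) by (auto intro!: f0 S)
    have "\<phi> (2 *\<^sub>C ?E (odd_mode a n m)) = f \<omega> \<omega> a 2 0 n - f \<omega> \<omega> a 0 2 n"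
      by (simp only: odd_Virasoro_commutator[symmetric] clinear_diff[OF \<phi>(1)] f_def)
    then have E1: "\<phi> (?E (odd_mode a n m)) = 0"
      by (simp only: zero clinear_scaleC[OF \<phi>(1)] scaleC_complex_def) simp
    have "\<phi> (odd_mode a n (2 *\<^sub>C ?E m)) = f a \<omega> \<omega> n 2 0 - f a \<omega> \<omega> n 0 2"
      by (simp only: odd_Virasoro_commutator[symmetric] clinear_diff[OF clinear_odd_mode] clinear_diff[OF \<phi>(1)] f_def)
    then have E2: "\<phi> (odd_mode a n (?E m)) = 0"
      by (simp only: zero clinear_scaleC[OF \<phi>(1)] clinear_scaleC[OF clinear_odd_mode] scaleC_complex_def) simp
    have "\<phi> (?E (odd_mode a n m)) = \<phi> (odd_mode a n (?E m)) + of_int (d - n - 1) * \<phi> (odd_mode a n m)"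
      by (simp only: even_L0_odd_mode_commutator[OF a] clinear_add[OF \<phi>(1)] clinear_scaleC[OF \<phi>(1)] scaleC_complex_def)
    then have "of_int (d - n - 1) * \<phi> (odd_mode a n m) = 0"
      by (simp only: E1 E2) simp
    with n'(2) show "\<phi> (odd_mode a n m) = 0" by (simp del: of_int_diff)
  qed
  then show ?thesis by blast
qed

end


section \<open>Filtration by total weight of modes\<close>

context vertex_operator_algebra
begin

section \<open>Weight decomposition of the C2-space\<close>

lemma weight_spaces_independent:
  assumes "finite S" "\<And>e. e \<in> S \<Longrightarrow> x e \<in> weight_space V e" "(\<Sum>e\<in>S. x e) = 0" "d \<in> S"
  shows "x d = 0"
  using assms
proof (induction S arbitrary: x d rule: finite_induct)
  case (insert f S)
  let ?L = "\<lambda>v. nprod V 1 \<omega> v - of_int f *\<^sub>C v"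
  have lin: "clinear ?L"
    by (rule clinearI) (simp_all add: scaleC_add_right complex_vector.scale_right_diff_distrib scaleC_scaleC mult.commute)
  have L: "?L (x e) = of_int (e - f) *\<^sub>C x e" if "e \<in> insert f S" for e
    using insert.prems(1)[OF that] by (simp add: weight_space_iff complex_vector.scale_left_diff_distrib)
  have "0 = ?L (\<Sum>e\<in>insert f S. x e)" by (simp only: insert.prems(2) clinear_zero[OF lin])
  also have "\<dots> = (\<Sum>e\<in>insert f S. of_int (e - f) *\<^sub>C x e)"
    unfolding clinear_sum[OF lin] by (intro sum.cong refl L)
  also have "\<dots> = (\<Sum>e\<in>S. of_int (e - f) *\<^sub>C x e)" using insert.hyps by simp
  finally have sum0: "(\<Sum>e\<in>S. of_int (e - f) *\<^sub>C x e) = 0" by simp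
  have S0: "x e = 0" if "e \<in> S" for e
  proof -
    have "of_int (e - f) *\<^sub>C x e = 0"
      by (rule insert.IH[where x = "\<lambda>e. of_int (e - f) *\<^sub>C x e"])
        (use insert.prems(1) sum0 that complex_vector.subspace_scale[OF subspace_weight_space] in auto)
    then show ?thesis using that insert.hyps by auto
  qed
  then have "(\<Sum>e\<in>S. x e) = 0" by simp
  then have "x f = 0" using insert.prems(2) insert.hyps by simp
  with S0 insert.prems(3) show ?case by blast
qed simp

lemma span_weight_spaces_sum:
  assumes "y \<in> complex_vector.span (\<Union>e\<in>E. weight_space V e)"
  shows "\<exists>S x. finite S \<and> S \<subseteq> E \<and> (\<forall>e. x e \<in> weight_space V e) \<and> y = (\<Sum>e\<in>S. x e)"
  using assms
proof (induction rule: complex_vector.span_induct_alt)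
  case base
  show ?case
    by (rule exI[of _ "{}"], rule exI[of _ "\<lambda>_. 0"]) (simp add: complex_vector.subspace_0[OF subspace_weight_space])
next
  case (step c v y)
  from step obtain f where f: "f \<in> E" "v \<in> weight_space V f" by blast
  from step obtain S x where S: "finite S" "S \<subseteq> E" "\<forall>e. x e \<in> weight_space V e" "y = (\<Sum>e\<in>S. x e)" by blast
  define x' where "x' e = (if e \<in> S then x e else 0) + (if e = f then c *\<^sub>C v else 0)" for e
  have "(\<Sum>e\<in>insert f S. x' e) = (\<Sum>e\<in>insert f S. if e \<in> S then x e else 0) + c *\<^sub>C v"
    unfolding x'_def sum.distrib using S(1) by (simp add: sum.delta)
  also have "(\<Sum>e\<in>insert f S. if e \<in> S then x e else 0) = y"
    unfolding S(4) by (rule sum.mono_neutral_cong_right) (use S in auto)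
  finally have "c *\<^sub>C v + y = (\<Sum>e\<in>insert f S. x' e)" by (simp add: add.commute)
  moreover have "\<forall>e. x' e \<in> weight_space V e"
    using S(3) f(2) complex_vector.subspace_0[OF subspace_weight_space]
      complex_vector.subspace_scale[OF subspace_weight_space] complex_vector.subspace_add[OF subspace_weight_space]
    by (simp add: x'_def)
  ultimately show ?case using S f(1) by (intro exI[of _ "insert f S"] exI[of _ x']) auto
qed

lemma weight_space_inter_others:
  assumes "v \<in> weight_space V d" "v \<in> complex_vector.span (\<Union>e\<in>- {d}. weight_space V e)"
  shows "v = 0"
proof -
  obtain S x where S: "finite S" "S \<subseteq> - {d}" "\<forall>e. x e \<in> weight_space V e" "v = (\<Sum>e\<in>S. x e)"
    using span_weight_spaces_sum[OF assms(2)] by blast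
  have "(x(d := - v)) d = 0"
  proof (rule weight_spaces_independent[where S = "insert d S" and x = "x(d := - v)"])
    show "(\<Sum>e\<in>insert d S. (x(d := - v)) e) = 0"
    proof -
      have "(\<Sum>e\<in>S. (x(d := - v)) e) = v"
        unfolding S(4) by (rule sum.cong) (use S(2) in auto)
      moreover have "d \<notin> S" using S(2) by auto
      ultimately show ?thesis using S(1) by simp
    qed
  qed (use S assms(1) complex_vector.subspace_neg[OF subspace_weight_space] in auto)
  then show ?thesis by simp
qed

text \<open>The part of weight d of the C2-space: a product with index -2 has weight i + j +
  1.\<close>

definition C2_weight :: "int \<Rightarrow> 'a set"
  where "C2_weight d = complex_vector.span
    {nprod V (-2) x y | x y i j. x \<in> weight_space V i \<and> y \<in> weight_space V j \<and> i + j = d - 1}"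

lemma C2_weight_subset: "C2_weight d \<subseteq> weight_space V d"
  unfolding C2_weight_def
  by (rule complex_vector.span_minimal[OF _ subspace_weight_space]) (auto intro: weight_nprod)

lemma C2_space_subset: "C2_space V \<subseteq> complex_vector.span (\<Union>d. C2_weight d)" (is "_ \<subseteq> ?S")
  unfolding C2_space_def
proof (rule complex_vector.span_minimal)
  have "nprod V (-2) x y \<in> ?S" if "x \<in> weight_space V i" "y \<in> weight_space V j" for x y i j
  proof -
    have "nprod V (-2) x y \<in> C2_weight (i + j + 1)"
      unfolding C2_weight_def using that by (intro complex_vector.span_base) auto
    then show ?thesis by (intro complex_vector.span_base) auto
  qed
  moreover have sub: "complex_vector.subspace ?S" by (rule complex_vector.subspace_span)
  ultimately have "nprod V (-2) x y \<in> ?S" if "x \<in> weight_space V i" for x y i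
  proof -
    have "y \<in> complex_vector.span (\<Union>d. weight_space V d)" using grading by simp
    then show ?thesis
    proof (induction rule: complex_vector.span_induct_alt)
      case base then show ?case by (simp add: complex_vector.span_zero)
    next
      case (step c v w)
      then show ?case
        using \<open>\<And>x y i j. x \<in> weight_space V i \<Longrightarrow> y \<in> weight_space V j \<Longrightarrow> nprod V (-2) x y \<in> ?S\<close> that
        by (auto intro!: complex_vector.span_add complex_vector.span_scale)
    qed
  qed
  note half = this
  have "nprod V (-2) x y \<in> ?S" for x y
  proof -
    have "x \<in> complex_vector.span (\<Union>d. weight_space V d)" using grading by simp
    then show ?thesis
    proof (induction rule: complex_vector.span_induct_alt)
      case base then show ?case by (simp add: complex_vector.span_zero)
    next
      case (step c v w)
      then show ?case using half by (auto intro!: complex_vector.span_add complex_vector.span_scale)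
    qed
  qed
  then show "{nprod V (-2) a b | a b. True} \<subseteq> ?S" by blast
qed (rule complex_vector.subspace_span)

text \<open>Finitely many representatives involve only weights up to some M. For v of weight d > M
  and a representative u, let c be the component of v - u in \<open>C2_weight d\<close>; then v - c
  has weight d and also lies in the span of the other weight spaces, so v = c.\<close>

lemma C2_cofinite_weight:
  assumes "C2_cofinite V"
  shows "\<exists>N. \<forall>d>N. weight_space V d \<subseteq> C2_weight d"
proof -
  obtain B where B: "finite B" "\<And>v. \<exists>u\<in>complex_vector.span B. v - u \<in> C2_space V"
    using assms unfolding C2_cofinite_def finite_dim_quotient_def by blast
  have "\<exists>N. b \<in> complex_vector.span (\<Union>e\<in>{..N}. weight_space V e)" for b
  proof -
    obtain S x where S: "finite S" "\<forall>e. x e \<in> weight_space V e" "b = (\<Sum>e\<in>S. x e)"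
      using span_weight_spaces_sum[of b UNIV] grading by auto
    have "x e \<in> complex_vector.span (\<Union>e\<in>{..Max S}. weight_space V e)" if "e \<in> S" for e
      by (rule complex_vector.span_base) (use S that in auto)
    then have "b \<in> complex_vector.span (\<Union>e\<in>{..Max S}. weight_space V e)"
      unfolding S(3) by (rule complex_vector.span_sum)
    then show ?thesis by blast
  qed
  then obtain N where N: "\<And>b. b \<in> complex_vector.span (\<Union>e\<in>{..N b}. weight_space V e)" by metis
  define M where "M = Max (insert 0 (N ` B))"
  have BM: "complex_vector.span B \<subseteq> complex_vector.span (\<Union>e\<in>{..M}. weight_space V e)"
  proof (rule complex_vector.span_minimal)
    show "B \<subseteq> complex_vector.span (\<Union>e\<in>{..M}. weight_space V e)"
    proof
      fix b assume "b \<in> B"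
      then have "N b \<le> M" using B(1) by (simp add: M_def)
      then have "(\<Union>e\<in>{..N b}. weight_space V e) \<subseteq> (\<Union>e\<in>{..M}. weight_space V e)" by force
      from complex_vector.span_mono[OF this] N show "b \<in> complex_vector.span (\<Union>e\<in>{..M}. weight_space V e)"
        by blast
    qed
  qed (rule complex_vector.subspace_span)
  have "v \<in> C2_weight d" if d: "d > M" and v: "v \<in> weight_space V d" for d v
  proof -
    let ?O = "complex_vector.span (\<Union>e\<in>- {d}. weight_space V e)"
    obtain u where u: "u \<in> complex_vector.span B" "v - u \<in> C2_space V" using B(2) by blast
    have "v - u \<in> complex_vector.span (C2_weight d \<union> (\<Union>e\<in>- {d}. C2_weight e))"
    proof -
      have "(\<Union>e. C2_weight e) = C2_weight d \<union> (\<Union>e\<in>- {d}. C2_weight e)" by auto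
      with u(2) C2_space_subset show ?thesis by auto
    qed
    then obtain c c' where c: "v - u = c + c'" "c \<in> C2_weight d" "c' \<in> complex_vector.span (\<Union>e\<in>- {d}. C2_weight e)"
      unfolding complex_vector.span_Un C2_weight_def complex_vector.span_span by blast
    have "c' \<in> ?O"
      using c(3) C2_weight_subset complex_vector.span_mono[of "\<Union>e\<in>- {d}. C2_weight e" "\<Union>e\<in>- {d}. weight_space V e"]
      by blast
    moreover have "u \<in> ?O"
    proof -
      have "(\<Union>e\<in>{..M}. weight_space V e) \<subseteq> (\<Union>e\<in>- {d}. weight_space V e)"
        by (rule UN_mono) (use d in auto)
      from complex_vector.span_mono[OF this] BM u(1) show ?thesis by blast
    qed
    moreover have "v - c = u + c'" using c(1) by (simp add: algebra_simps)
    ultimately have "v - c \<in> ?O" by (simp add: complex_vector.span_add)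
    moreover have "v - c \<in> weight_space V d"
      using v c(2) C2_weight_subset complex_vector.subspace_diff[OF subspace_weight_space] by blast
    ultimately have "v - c = 0" by (intro weight_space_inter_others)
    with c(2) show ?thesis by simp
  qed
  then show ?thesis by blast
qed

text \<open>A mode \<open>c\<^bsub>(n)\<^esub>\<close> contributes the weight of \<open>c\<close> to \<open>p\<close>, without the shift by \<open>n\<close>.\<close>

primrec words :: "nat \<Rightarrow> int \<Rightarrow> 'a set"
  where "words 0 p = weight_space V p"
  | "words (Suc k) p = complex_vector.span
      {nprod V n c v | n c v d. n \<le> -2 \<and> c \<in> weight_space V d \<and> v \<in> words k (p - d)}"

definition filt :: "int \<Rightarrow> 'a set"
  where "filt p = complex_vector.span (\<Union>k. \<Union>q\<in>{..p}. words k q)"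

lemma subspace_filt: "complex_vector.subspace (filt p)"
  unfolding filt_def by (rule complex_vector.subspace_span)

lemma subspace_words: "complex_vector.subspace (words k p)"
  by (cases k) (simp_all add: subspace_weight_space complex_vector.subspace_span)

lemma filt_mono: "p \<le> q \<Longrightarrow> filt p \<subseteq> filt q"
  unfolding filt_def by (intro complex_vector.span_mono) force

lemma words_filt: "v \<in> words k q \<Longrightarrow> q \<le> p \<Longrightarrow> v \<in> filt p"
  unfolding filt_def by (rule complex_vector.span_base) auto

lemma weight_filt: "v \<in> weight_space V q \<Longrightarrow> q \<le> p \<Longrightarrow> v \<in> filt p"
  using words_filt[of v 0] by simp

lemma words_Suc: "n \<le> -2 \<Longrightarrow> c \<in> weight_space V d \<Longrightarrow> v \<in> words k p \<Longrightarrow> q = p + d \<Longrightarrow> nprod V n c v \<in> words (Suc k) q"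
  unfolding words.simps
  by (rule complex_vector.span_base) force

lemma words_Suc_induct [consumes 1, case_names zero add mode]:
  assumes "v \<in> words (Suc k) p" "P 0" "\<And>x y c. P x \<Longrightarrow> P y \<Longrightarrow> P (c *\<^sub>C x + y)"
    "\<And>n c d u. n \<le> -2 \<Longrightarrow> c \<in> weight_space V d \<Longrightarrow> u \<in> words k (p - d) \<Longrightarrow> P (nprod V n c u)"
  shows "P v"
  using assms(1) unfolding words.simps
  by (induction rule: complex_vector.span_induct_alt) (use assms(2-4) in auto)

lemma filt_induct [consumes 1, case_names zero add words]:
  assumes "v \<in> filt p" "P 0" "\<And>x y c. P x \<Longrightarrow> P y \<Longrightarrow> P (c *\<^sub>C x + y)"
    "\<And>k q u. q \<le> p \<Longrightarrow> u \<in> words k q \<Longrightarrow> P u"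
  shows "P v"
  using assms(1) unfolding filt_def
  by (induction rule: complex_vector.span_induct_alt) (use assms(2-4) in auto)

lemmas filt_closed =
  complex_vector.subspace_0[OF subspace_filt] complex_vector.subspace_add[OF subspace_filt]
  complex_vector.subspace_diff[OF subspace_filt] complex_vector.subspace_neg[OF subspace_filt]
  complex_vector.subspace_scale[OF subspace_filt]

section \<open>Modes on the filtration and its associated graded space\<close>

lemma filt_creation:
  assumes "n \<le> -2" "c \<in> weight_space V d" "v \<in> filt p" "p + d \<le> q"
  shows "nprod V n c v \<in> filt q"
  using assms(3)
proof (induction rule: filt_induct)
  case (words k r u)
  have "nprod V n c u \<in> words (Suc k) (r + d)" by (rule words_Suc[OF assms(1,2) words(2)]) simp
  then show ?case by (rule words_filt) (use words(1) assms(4) in simp)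
qed (simp_all add: filt_closed)

text \<open>The mode is commuted inwards to the homogeneous vector, where for n \<ge> -1 the result
  has weight q + d - n - 1. Commutator terms lose a step because the i-th product of c and e has
  weight d + d' - i - 1.\<close>

lemma words_mode:
  assumes "v \<in> words k q" "c \<in> weight_space V d"
  shows "nprod V n c v \<in> filt (q + d) \<and> (n \<ge> 0 \<longrightarrow> nprod V n c v \<in> filt (q + d - 1))"
  using assms
proof (induction k arbitrary: q v c d n)
  case 0
  then have w: "nprod V n c v \<in> weight_space V (q + d - n - 1)" by (auto intro: weight_nprod)
  show ?case
  proof (cases "n \<le> -2")
    case True
    then show ?thesis using 0 words_Suc[of n c d v 0 q "q + d"] words_filt[of _ "Suc 0" "q + d"] by auto
  next
    case False
    then show ?thesis using weight_filt[OF w] by auto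
  qed
next
  case (Suc k)
  show ?case
  proof (cases "n \<le> -2")
    case True
    have "nprod V n c v \<in> words (Suc (Suc k)) (q + d)"
      by (rule words_Suc[OF True Suc.prems(2,1)]) simp
    from words_filt[OF this order_refl] True show ?thesis by simp
  next
    case False
    show ?thesis using Suc.prems(1)
    proof (induction rule: words_Suc_induct)
      case (mode m e d' u)
      let ?S = "Sum_any (\<lambda>i::nat. (of_int n gchoose i) *\<^sub>C nprod V (n + m - int i) (nprod V (int i) c e) u)"
      have S: "?S \<in> filt (q + d - 1)"
      proof (rule Sum_any_mem_subspace[OF subspace_filt])
        fix i :: nat
        have ce: "nprod V (int i) c e \<in> weight_space V (d + d' - int i - 1)"
          by (rule weight_nprod[OF Suc.prems(2) mode(2)]) simp
        have "nprod V (n + m - int i) (nprod V (int i) c e) u \<in> filt (q - d' + (d + d' - int i - 1))"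
          using Suc.IH[OF mode(3) ce] by blast
        then show "(of_int n gchoose i) *\<^sub>C nprod V (n + m - int i) (nprod V (int i) c e) u \<in> filt (q + d - 1)"
          using filt_mono[of "q - d' + (d + d' - int i - 1)" "q + d - 1"] by (auto intro: filt_closed)
      qed
      have IH: "nprod V n c u \<in> filt (q - d' + d) \<and> (n \<ge> 0 \<longrightarrow> nprod V n c u \<in> filt (q - d' + d - 1))"
        by (rule Suc.IH[OF mode(3) Suc.prems(2)])
      have "nprod V m e (nprod V n c u) \<in> filt (q + d)"
        by (rule filt_creation[OF mode(1,2) conjunct1[OF IH]]) simp
      moreover have "nprod V m e (nprod V n c u) \<in> filt (q + d - 1)" if "n \<ge> 0"
      proof -
        from IH that have "nprod V n c u \<in> filt (q - d' + d - 1)" by blast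
        then show ?thesis by (rule filt_creation[OF mode(1,2)]) simp
      qed
      ultimately show ?case
        using S filt_mono[of "q + d - 1" "q + d"] unfolding commutator[of n c m e u]
        by (auto intro: filt_closed)
    qed (auto simp: filt_closed)
  qed
qed

lemma filt_mode:
  assumes "c \<in> weight_space V d" "v \<in> filt p" "p + d \<le> q"
  shows "nprod V n c v \<in> filt q"
  using assms(2)
proof (induction rule: filt_induct)
  case (words k r u)
  then show ?case
    using words_mode[OF words(2) assms(1), of n] filt_mono[of "r + d" q] assms(3) by auto
qed (simp_all add: filt_closed)

lemma filt_mode_nonneg:
  assumes "n \<ge> 0" "c \<in> weight_space V d" "v \<in> filt p" "p + d - 1 \<le> q"
  shows "nprod V n c v \<in> filt q"
  using assms(3)
proof (induction rule: filt_induct)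
  case (words k r u)
  then show ?case
    using words_mode[OF words(2) assms(2), of n] filt_mono[of "r + d - 1" q] assms(1,4) by auto
qed (simp_all add: filt_closed)

lemma filt_commutator:
  assumes "c \<in> weight_space V d" "e \<in> weight_space V d'" "v \<in> filt p" "p + d + d' - 1 \<le> q"
  shows "nprod V n c (nprod V m e v) - nprod V m e (nprod V n c v) \<in> filt q"
proof -
  have "nprod V (n + m - int i) (nprod V (int i) c e) v \<in> filt q" for i
    by (rule filt_mode[OF weight_nprod[OF assms(1,2) refl] assms(3)]) (use assms(4) in simp)
  then have "Sum_any (\<lambda>i::nat. (of_int n gchoose i) *\<^sub>C nprod V (n + m - int i) (nprod V (int i) c e) v) \<in> filt q"
    by (intro Sum_any_mem_subspace[OF subspace_filt]) (simp add: filt_closed)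
  then show ?thesis by (simp add: commutator[of n c m e v])
qed

text \<open>An element x_(-2) y has weight i + j + 1, but the iterate formula writes its modes
  through one mode of x and one of y, which cost only i + j.\<close>

lemma filt_C2_mode:
  assumes "c \<in> C2_weight d" "v \<in> filt p" "p + d - 1 \<le> q"
  shows "nprod V n c v \<in> filt q"
  using assms(1) unfolding C2_weight_def
proof (induction rule: complex_vector.span_induct_alt)
  case base
  show ?case by (simp add: filt_closed)
next
  case (step k x y)
  then obtain a b i j where x: "x = nprod V (-2) a b" "a \<in> weight_space V i" "b \<in> weight_space V j" "i + j = d - 1"
    by blast
  have "nprod V l a (nprod V m b v) \<in> filt q" "nprod V m b (nprod V l a v) \<in> filt q" for l m
    using x(4) assms(3) by (auto intro!: filt_mode[OF x(2) filt_mode[OF x(3) assms(2) order_refl]]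
        filt_mode[OF x(3) filt_mode[OF x(2) assms(2) order_refl]])
  then have "nprod V n x v \<in> filt q"
    unfolding x(1) iterate by (intro Sum_any_mem_subspace[OF subspace_filt]) (simp add: filt_closed)
  with step show ?case by (simp add: filt_closed)
qed

lemma C2_weight_filt: "c \<in> C2_weight d \<Longrightarrow> d - 1 \<le> q \<Longrightarrow> c \<in> filt q"
  unfolding C2_weight_def
proof (induction rule: complex_vector.span_induct_alt)
  case (step k x y)
  then obtain a b i j where x: "x = nprod V (-2) a b" "a \<in> weight_space V i" "b \<in> weight_space V j" "i + j = d - 1"
    by blast
  then have "x \<in> filt q"
    using step.prems by (auto intro!: filt_creation[OF _ x(2) weight_filt[OF x(3) order_refl]])
  with step show ?case by (simp add: filt_closed)
qed (simp add: filt_closed)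

text \<open>Up to lower filtration the mode -1 passes through the word to its innermost homogeneous
  vector, which it maps to a homogeneous vector. It therefore never lengthens a word, which is why
  \<open>words\<close> uses modes at most -2.\<close>

lemma words_minus_one:
  assumes "v \<in> words k q" "c \<in> weight_space V d"
  shows "\<exists>v'\<in>words k (q + d). nprod V (-1) c v - v' \<in> filt (q + d - 1)"
  using assms(1)
proof (induction k arbitrary: q v)
  case 0
  then have "nprod V (-1) c v \<in> words 0 (q + d)" using assms(2) by (auto intro: weight_nprod)
  then show ?case by (rule bexI[rotated]) (simp add: filt_closed)
next
  case (Suc k)
  from Suc.prems show ?case
  proof (induction rule: words_Suc_induct)
    case zero
    show ?case by (rule bexI[of _ 0]) (simp_all add: filt_closed complex_vector.subspace_0[OF subspace_words] del: words.simps)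
  next
    case (add x y a)
    then obtain x' y' where "x' \<in> words (Suc k) (q + d)" "nprod V (-1) c x - x' \<in> filt (q + d - 1)"
      "y' \<in> words (Suc k) (q + d)" "nprod V (-1) c y - y' \<in> filt (q + d - 1)" by blast
    then have "a *\<^sub>C x' + y' \<in> words (Suc k) (q + d)"
      "a *\<^sub>C (nprod V (-1) c x - x') + (nprod V (-1) c y - y') \<in> filt (q + d - 1)"
      by (auto intro!: filt_closed complex_vector.subspace_add[OF subspace_words]
          complex_vector.subspace_scale[OF subspace_words] simp del: words.simps)
    moreover have "nprod V (-1) c (a *\<^sub>C x + y) - (a *\<^sub>C x' + y') =
        a *\<^sub>C (nprod V (-1) c x - x') + (nprod V (-1) c y - y')"
      by (simp add: complex_vector.scale_right_diff_distrib)
    ultimately show ?case by metis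
  next
    case (mode m e d' u)
    from Suc.IH[OF mode(3)] obtain u' where u': "u' \<in> words k (q - d' + d)"
      "nprod V (-1) c u - u' \<in> filt (q - d' + d - 1)" by blast
    have "nprod V m e u' \<in> words (Suc k) (q + d)"
      by (rule words_Suc[OF mode(1,2) u'(1)]) simp
    moreover have "nprod V (-1) c (nprod V m e u) - nprod V m e (nprod V (-1) c u) \<in> filt (q + d - 1)"
      by (rule filt_commutator[OF assms(2) mode(2) words_filt[OF mode(3) order_refl]]) simp
    moreover have "nprod V m e (nprod V (-1) c u - u') \<in> filt (q + d - 1)"
      by (rule filt_creation[OF mode(1,2) u'(2)]) simp
    ultimately have "nprod V (-1) c (nprod V m e u) - nprod V m e u' \<in> filt (q + d - 1)"
      "nprod V m e u' \<in> words (Suc k) (q + d)"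
      using filt_closed(2)[of "nprod V (-1) c (nprod V m e u) - nprod V m e (nprod V (-1) c u)" "q + d - 1"
          "nprod V m e (nprod V (-1) c u - u')"] by (simp_all del: words.simps)
    then show ?case by blast
  qed
qed

end


section \<open>Finiteness of the quotient\<close>

lemma clinear_span_mem:
  assumes "clinear f" "complex_vector.subspace D" "\<And>a. a \<in> A \<Longrightarrow> f a \<in> D" "x \<in> complex_vector.span A"
  shows "f x \<in> D"
  using assms(4)
  by (induction rule: complex_vector.span_induct_alt)
    (simp_all add: clinear_zero[OF assms(1)] clinear_add[OF assms(1)] clinear_scaleC[OF assms(1)] assms(3)
      complex_vector.subspace_0[OF assms(2)] complex_vector.subspace_add[OF assms(2)]
      complex_vector.subspace_scale[OF assms(2)])

context vertex_operator_algebra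
begin

section \<open>Relations among symmetric products\<close>

text \<open>The even vector \<open>sym_prod c vac\<close> acts as a derivation on pairs. Modulo
  \<open>C2_T2\<close> a mode below -1 thus moves to the other entry with a change of sign.\<close>

lemma sym_prod_skew:
  assumes "n \<le> -2"
  shows "sym_prod (nprod V n c a) b + sym_prod a (nprod V n c b) \<in> C2_T2"
proof -
  have "sym_prod (nprod V n c a) b + sym_prod a (nprod V n c b) = nprod (T2 V) n (sym_prod c vac) (sym_prod a b)"
    by (simp add: sym_prod_def T2_left T2_right)
  then show ?thesis using sym_prod_mode_mem_C2[OF tensor_swap_sym_prod assms] by simp
qed

lemma odd_mode_sym_prod:
  "odd_mode x i (odd_mode y j (sym_prod a b)) =
    sym_prod (nprod V i x (nprod V j y a)) b + sym_prod a (nprod V i x (nprod V j y b)) -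
    sym_prod (nprod V i x a) (nprod V j y b) - sym_prod (nprod V j y a) (nprod V i x b)"
  by (simp add: sym_prod_def odd_mode_tensor)

text \<open>On the antisymmetric vector a \<otimes> b - b \<otimes> a the odd mode gives the
  difference of the two terms in \<open>sym_prod_skew\<close>; adding their sum leaves twice the
  claimed element.\<close>

lemma sym_prod_mode_mem_C2_T2:
  assumes "c \<in> weight_space V d"
  shows "\<exists>K. \<forall>n\<le>K. sym_prod (nprod V n c a) b \<in> C2_T2"
proof -
  obtain K where K: "\<forall>n\<le>K. odd_mode c n (a \<otimes> b - b \<otimes> a) \<in> C2_T2"
    using odd_mode_mem_C2[OF assms, of "a \<otimes> b - b \<otimes> a"] by auto
  have "sym_prod (nprod V n c a) b \<in> C2_T2" if n: "n \<le> min K (-2)" for n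
  proof -
    have "odd_mode c n (a \<otimes> b - b \<otimes> a) + (sym_prod (nprod V n c a) b + sym_prod a (nprod V n c b)) =
        sym_prod (nprod V n c a) b + sym_prod (nprod V n c a) b"
      by (simp add: odd_mode_tensor sym_prod_def)
    also have "\<dots> = 2 *\<^sub>C sym_prod (nprod V n c a) b"
      using scaleC_add_left[of 1 1 "sym_prod (nprod V n c a) b"] by (simp add: scaleC_one)
    finally have "2 *\<^sub>C sym_prod (nprod V n c a) b \<in> C2_T2"
      using complex_vector.subspace_add[OF subspace_C2_T2] K n sym_prod_skew[of n c a b] by force
    from complex_vector.subspace_scale[OF subspace_C2_T2 this, of "1/2"] show ?thesis
      by (simp add: scaleC_scaleC scaleC_one)
  qed
  then show ?thesis by blast
qed

section \<open>Induction along the filtration of pairs\<close>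

definition pair_filt :: "int \<Rightarrow> ('a, 'a) tensor set"
  where "pair_filt p = complex_vector.span
    {sym_prod a b | a b q r. a \<in> filt q \<and> b \<in> filt r \<and> q + r \<le> p}"

lemma sym_prod_pair_filt: "a \<in> filt q \<Longrightarrow> b \<in> filt r \<Longrightarrow> q + r \<le> p \<Longrightarrow> sym_prod a b \<in> pair_filt p"
  unfolding pair_filt_def by (rule complex_vector.span_base) blast

lemma filt_mode_of_bool:
  assumes "c \<in> weight_space V d" "v \<in> filt p"
  shows "nprod V n c v \<in> filt (p + d - of_bool (n \<ge> 0))"
  using filt_mode[OF assms order_refl, of n] filt_mode_nonneg[OF _ assms order_refl, of n] by auto

text \<open>Modulo \<open>pair_filt (p - 1)\<close> all modes commute and nonnegative modes vanish, so that the moment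
  conditions of \<open>null_sum_odd_modes\<close> leave a one-dimensional space for each total mode number, detected
  by the mode \<open>-1\<close>. This trades two modes below \<open>-1\<close> for one.\<close>

lemma pair_filt_words_step:
  assumes D: "complex_vector.subspace D" "C2_T2 \<subseteq> D" "pair_filt (p - 1) \<subseteq> D"
    and IH: "\<And>v q b r. v \<in> words (Suc k) q \<Longrightarrow> b \<in> weight_space V r \<Longrightarrow> q + r = p \<Longrightarrow> sym_prod v b \<in> D"
    and x: "m \<le> -2" "x \<in> weight_space V d" and y: "l \<le> -2" "y \<in> weight_space V d'"
    and z: "z \<in> words k q" and b: "b \<in> weight_space V r" and p: "q + d + d' + r = p"
  shows "sym_prod (nprod V m x (nprod V l y z)) b \<in> D"
proof (rule subspace_memI[OF D(1)])
  fix \<phi> :: "('a, 'a) tensor \<Rightarrow> complex"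
  assume \<phi>: "clinear \<phi>" "\<And>s. s \<in> D \<Longrightarrow> \<phi> s = 0"
  note \<phi>_linear = clinear_add[OF \<phi>(1)] clinear_diff[OF \<phi>(1)]
  have zf: "z \<in> filt q" by (rule words_filt[OF z order_refl])
  have bf: "b \<in> filt r" by (rule weight_filt[OF b order_refl])
  have low: "\<phi> (sym_prod a c) = 0" if "a \<in> filt e" "c \<in> filt f" "e + f \<le> p - 1" for a c e f
    using sym_prod_pair_filt[OF that] D(3) by (intro \<phi>(2)) blast
  have skew: "\<phi> (sym_prod a (nprod V n c e)) = - \<phi> (sym_prod (nprod V n c a) e)" if "n \<le> -2" for a e n c
  proof -
    have "\<phi> (sym_prod (nprod V n c a) e + sym_prod a (nprod V n c e)) = 0"
      using sym_prod_skew[OF that] D(2) by (intro \<phi>(2)) blast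
    then show ?thesis by (simp add: \<phi>_linear eq_neg_iff_add_eq_0 add.commute)
  qed
  define w where "w = sym_prod z b"
  define t where "t = m + l"
  define u where "u i = \<phi> (odd_mode x i (odd_mode y (t - i) w))" for i
  have u: "u i = \<phi> (sym_prod (nprod V i x (nprod V (t - i) y z)) b) + \<phi> (sym_prod z (nprod V i x (nprod V (t - i) y b)))
      - \<phi> (sym_prod (nprod V i x z) (nprod V (t - i) y b)) - \<phi> (sym_prod (nprod V (t - i) y z) (nprod V i x b))" for i
    by (simp only: u_def w_def odd_mode_sym_prod \<phi>_linear)
  \<comment> \<open>A nonnegative mode costs one filtration step, so all four terms of
    \<open>u i\<close> fall into \<open>pair_filt (p - 1)\<close>.\<close>
  have u_nonneg: "u i = 0" if "i \<ge> 0 \<or> t - i \<ge> 0" for i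
  proof -
    note mx = filt_mode_of_bool[OF x(2), of _ _ i] and my = filt_mode_of_bool[OF y(2), of _ _ "t - i"]
    have "of_bool (i \<ge> 0) + of_bool (t - i \<ge> 0) \<ge> (1::int)" using that by auto
    with p show ?thesis
      unfolding u
      by (simp add: low[OF mx[OF my[OF zf]] bf] low[OF zf mx[OF my[OF bf]]] low[OF mx[OF zf] my[OF bf]]
          low[OF my[OF zf] mx[OF bf]])
  qed
  have comm: "\<phi> (sym_prod (nprod V i x (nprod V j y z)) b) = \<phi> (sym_prod (nprod V j y (nprod V i x z)) b)"
    "\<phi> (sym_prod z (nprod V i x (nprod V j y b))) = \<phi> (sym_prod z (nprod V j y (nprod V i x b)))" for i j
  proof -
    show "\<phi> (sym_prod (nprod V i x (nprod V j y z)) b) = \<phi> (sym_prod (nprod V j y (nprod V i x z)) b)"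
      using low[OF filt_commutator[OF x(2) y(2) zf order_refl, of i j] bf] p
      by (simp add: \<phi>_linear)
    show "\<phi> (sym_prod z (nprod V i x (nprod V j y b))) = \<phi> (sym_prod z (nprod V j y (nprod V i x b)))"
      using low[OF zf filt_commutator[OF x(2) y(2) bf order_refl, of i j]] p
      by (simp add: \<phi>_linear)
  qed
  \<comment> \<open>Commuting and skew-symmetry reduce all four terms to the forms \<open>A\<close>
    and \<open>B\<close>. There the mode -1 is absorbed into a word or into b, leaving words of
    length k + 1, which \<open>IH\<close> covers.\<close>
  have u_minus_one: "u (-1) = 0"
  proof -
    define j where "j = t - (-1)"
    have j: "j \<le> -2" using x(1) y(1) by (simp add: j_def t_def)
    obtain z' where z': "z' \<in> words k (q + d)" "nprod V (-1) x z - z' \<in> filt (q + d - 1)"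
      using words_minus_one[OF z x(2)] by blast
    have "\<phi> (sym_prod (nprod V j y z') b) = 0"
      by (intro \<phi>(2) IH[OF words_Suc[OF j y(2) z'(1) refl] b]) (use p in simp)
    moreover have "\<phi> (sym_prod (nprod V j y (nprod V (-1) x z - z')) b) = 0"
      by (rule low[OF filt_creation[OF j y(2) z'(2) order_refl] bf]) (use p in simp)
    ultimately have A: "\<phi> (sym_prod (nprod V j y (nprod V (-1) x z)) b) = 0"
      by (simp add: \<phi>_linear)
    have xb: "nprod V (-1) x b \<in> weight_space V (r + d)" by (rule weight_nprod[OF x(2) b]) simp
    have B: "\<phi> (sym_prod (nprod V j y z) (nprod V (-1) x b)) = 0"
      by (intro \<phi>(2) IH[OF words_Suc[OF j y(2) z refl] xb]) (use p in simp)
    show ?thesis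
      unfolding u j_def[symmetric] comm skew[OF j] A B by simp
  qed
  \<comment> \<open>Only the indices t + 1, ..., -1 can contribute. Leaving out -1 and m gives -3 -
    t roots for \<open>Q\<close>, exactly the largest admissible degree.\<close>
  define I where "I = {t + 1..-1} - {-1, m}"
  define Q :: "complex poly" where "Q = (\<Prod>i\<in>I. [:- of_int i, 1:])"
  have m: "m \<in> {t + 1..-1}" "m \<noteq> -1" using x(1) y(1) by (auto simp: t_def)
  have cardI: "int (card I) = -3 - t"
  proof -
    have "card I = card {t + 1..-1} - card {-1, m}"
      unfolding I_def by (rule card_Diff_subset) (use m in auto)
    moreover have "card {-1, m} = 2" using m(2) by simp
    ultimately show ?thesis using x(1) y(1) by (simp add: t_def)
  qed
  have "degree Q \<le> card I"
    unfolding Q_def by (rule order.trans[OF degree_prod_sum_le]) (simp_all add: I_def comp_def)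
  then have null: "null_sum (\<lambda>i. poly Q (of_int i) * u i)"
    unfolding u_def w_def
    by (intro null_sum_odd_modes[OF \<phi>(1)] \<phi>(2)) (use D(2) cardI in auto)
  have Q: "poly Q (of_int i) = 0 \<longleftrightarrow> i \<in> I" for i
    by (auto simp: Q_def poly_prod prod_zero_iff I_def)
  have "poly Q (of_int i) * u i = 0" if "i \<noteq> m" for i
    using that u_nonneg[of i] u_minus_one Q[of i] by (cases "i \<in> I"; cases "i = -1") (auto simp: I_def)
  then have "Sum_any (\<lambda>i. poly Q (of_int i) * u i) = poly Q (of_int m) * u m"
    by (rule Sum_any_single)
  moreover have "m \<notin> I" by (simp add: I_def)
  ultimately have "u m = 0" using null Q[of m] by (simp add: null_sum_def)
  moreover have "t - m = l" by (simp add: t_def)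
  \<comment> \<open>By skew-symmetry and commutation the four summands of \<open>u m\<close>
    coincide.\<close>
  ultimately have "4 * \<phi> (sym_prod (nprod V m x (nprod V l y z)) b) = 0"
    using comm[of m l] unfolding u by (simp add: skew[OF x(1)] skew[OF y(1)])
  then show "\<phi> (sym_prod (nprod V m x (nprod V l y z)) b) = 0" by simp
qed

text \<open>Words in the second entry are moved to the first by skew-symmetry, and
  \<open>pair_filt_words_step\<close> then shortens every word until at most one mode is
  left.\<close>

lemma pair_filt_step:
  assumes D: "complex_vector.subspace D" "C2_T2 \<subseteq> D" "pair_filt (p - 1) \<subseteq> D"
    and one: "\<And>c a b d q r n. n \<le> -2 \<Longrightarrow> c \<in> weight_space V d \<Longrightarrow> a \<in> weight_space V q \<Longrightarrow>
      b \<in> weight_space V r \<Longrightarrow> d + q + r = p \<Longrightarrow> sym_prod (nprod V n c a) b \<in> D"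
    and zero: "\<And>a b q r. a \<in> weight_space V q \<Longrightarrow> b \<in> weight_space V r \<Longrightarrow> q + r = p \<Longrightarrow> sym_prod a b \<in> D"
  shows "pair_filt p \<subseteq> D"
proof -
  note D_closed = complex_vector.subspace_0[OF D(1)] complex_vector.subspace_add[OF D(1)]
    complex_vector.subspace_diff[OF D(1)] complex_vector.subspace_scale[OF D(1)]
  have left: "sym_prod v b \<in> D" if "v \<in> words k q" "b \<in> weight_space V r" "q + r = p" for k v b q r
    using that
  proof (induction k arbitrary: v b q r rule: less_induct)
    case (less k)
    consider "k = 0" | "k = Suc 0" | k' where "k = Suc (Suc k')"
      by (metis not0_implies_Suc)
    then show ?case
    proof cases
      case 1
      with less.prems zero show ?thesis by simp
    next
      case 2
      from less.prems(1)[unfolded 2] show ?thesis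
      proof (induction rule: words_Suc_induct)
        case (mode n c d u)
        then show ?case using one[of n c d u "q - d" b r] less.prems(2,3) by simp
      qed (simp_all add: D_closed)
    next
      case 3
      from less.prems(1)[unfolded 3] show ?thesis
      proof (induction rule: words_Suc_induct)
        case (mode m x d u)
        from mode(3) show ?case
        proof (induction rule: words_Suc_induct)
          case (mode l y d' z)
          show ?case
            by (rule pair_filt_words_step[OF D _ \<open>m \<le> -2\<close> \<open>x \<in> weight_space V d\<close> mode less.prems(2)])
              (use less.IH[of "Suc k'"] less.prems(3) 3 in auto)
        qed (simp_all add: D_closed)
      qed (simp_all add: D_closed)
    qed
  qed
  have both: "sym_prod a b \<in> D" if "a \<in> words k q" "b \<in> words l r" "q + r = p" for k l a b q r
    using that
  proof (induction l arbitrary: k a b q r)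
    case 0
    then show ?case using left by simp
  next
    case (Suc l)
    from Suc.prems(2) show ?case
    proof (induction rule: words_Suc_induct)
      case (mode n c d u)
      have "sym_prod (nprod V n c a) u \<in> D"
        by (rule Suc.IH[OF words_Suc[OF mode(1,2) Suc.prems(1) refl] mode(3)]) (use Suc.prems(3) in simp)
      moreover have "sym_prod (nprod V n c a) u + sym_prod a (nprod V n c u) \<in> D"
        using sym_prod_skew[OF mode(1)] D(2) by blast
      ultimately show ?case using D_closed(3) by fastforce
    qed (simp_all add: D_closed)
  qed
  have "sym_prod a b \<in> D" if ab: "a \<in> filt q" "b \<in> filt r" "q + r \<le> p" for a b q r
    using ab(1)
  proof (induction rule: filt_induct)
    case (words k q' a)
    note a = words
    from ab(2) show ?case
    proof (induction rule: filt_induct)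
      case (words l r' b)
      show ?case
      proof (cases "q' + r' = p")
        case True
        then show ?thesis using both a(2) words(2) by blast
      next
        case False
        then have "sym_prod a b \<in> pair_filt (p - 1)"
          using a words ab(3) by (intro sym_prod_pair_filt[OF words_filt words_filt, OF _ order_refl _ order_refl]) auto
        then show ?thesis using D(3) by blast
      qed
    qed (simp_all add: D_closed)
  qed (simp_all add: D_closed)
  then show ?thesis
    unfolding pair_filt_def by (intro complex_vector.span_minimal[OF _ D(1)]) blast
qed

text \<open>Without negative weights every negative filtration level is 0, and a negative total puts
  one entry into such a level.\<close>

lemma pair_filt_negative:
  assumes "CFT_type V" "p < 0"
  shows "pair_filt p \<subseteq> {0}"
proof -
  have W: "weight_space V d = {0}" if "d < 0" for d
    using assms(1) that by (simp add: CFT_type_def)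
  have words0: "v = 0" if "v \<in> words k q" "q < 0" for k v q
    using that
  proof (induction k arbitrary: v q)
    case 0
    then show ?case using W by simp
  next
    case (Suc k)
    from Suc.prems(1) show ?case
    proof (induction rule: words_Suc_induct)
      case (mode n c d u)
      show ?case
      proof (cases "d < 0")
        case True
        then show ?thesis using W mode(2) by simp
      next
        case False
        then have "u = 0" using Suc.IH[OF mode(3)] Suc.prems(2) by simp
        then show ?thesis by simp
      qed
    qed simp_all
  qed
  have filt0: "v = 0" if "v \<in> filt q" "q < 0" for v q
    using that(1) by (induction rule: filt_induct) (use words0 that(2) in force)+
  show ?thesis
    unfolding pair_filt_def
  proof (rule complex_vector.span_minimal)
    show "{sym_prod a b | a b q r. a \<in> filt q \<and> b \<in> filt r \<and> q + r \<le> p} \<subseteq> {0}"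
    proof
      fix s assume "s \<in> {sym_prod a b | a b q r. a \<in> filt q \<and> b \<in> filt r \<and> q + r \<le> p}"
      then obtain a b q r where s: "s = sym_prod a b" "a \<in> filt q" "b \<in> filt r" "q + r \<le> p" by blast
      then have "q < 0 \<or> r < 0" using assms(2) by linarith
      then have "a = 0 \<or> b = 0" using s(2,3) filt0 by blast
      then show "s \<in> {0}" by (auto simp: s(1))
    qed
  qed (simp add: complex_vector.subspace_def)
qed

section \<open>The finite spanning set\<close>

lemma pair_filt_finite:
  assumes "CFT_type V" "C2_cofinite V"
  shows "\<exists>B. finite B \<and> (\<forall>x\<in>B. tensor_swap x = x) \<and> (\<forall>p. pair_filt p \<subseteq> complex_vector.span (C2_T2 \<union> B))"
proof -
  obtain M where M: "\<And>d. d > M \<Longrightarrow> weight_space V d \<subseteq> C2_weight d"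
    using C2_cofinite_weight[OF assms(2)] by blast
  obtain W where W: "\<And>d. finite (W d)" "\<And>d. weight_space V d = complex_vector.span (W d)"
    using finite_dim_weight_space by metis
  define U where "U = (\<Union>d\<in>{0..M}. W d)"
  have finU: "finite U" using W(1) by (simp add: U_def)
  have spanU: "weight_space V d \<subseteq> complex_vector.span U" if "d \<le> M" for d
  proof (cases "d < 0")
    case True
    then show ?thesis using assms(1) by (auto simp: CFT_type_def complex_vector.span_zero)
  next
    case False
    then have "W d \<subseteq> U" unfolding U_def by (intro UN_upper) (use that in simp)
    then show ?thesis unfolding W(2) by (rule complex_vector.span_mono)
  qed
  have "\<exists>K. \<forall>n\<le>K. sym_prod (nprod V n c a) b \<in> C2_T2" if "c \<in> U" for c a b
  proof -
    from that obtain d where "c \<in> weight_space V d" unfolding W(2) U_def by (auto intro: complex_vector.span_base)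
    then show ?thesis by (rule sym_prod_mode_mem_C2_T2)
  qed
  then obtain K where K: "\<And>c a b n. c \<in> U \<Longrightarrow> n \<le> K c a b \<Longrightarrow> sym_prod (nprod V n c a) b \<in> C2_T2" by metis
  \<comment> \<open>The bounds of \<open>K\<close> have a common minimum over the finitely many
    triples from \<open>U\<close>; 0 only keeps the set nonempty. Modes up to \<open>K0\<close> give
    elements of \<open>C2_T2\<close>, so finitely many mode numbers remain for
    \<open>B\<close>.\<close>
  define K0 where "K0 = Min (insert 0 ((\<lambda>(c, a, b). K c a b) ` (U \<times> U \<times> U)))"
  have K0: "K0 \<le> K c a b" if "c \<in> U" "a \<in> U" "b \<in> U" for c a b
  proof -
    have "K c a b \<in> (\<lambda>(c, a, b). K c a b) ` (U \<times> U \<times> U)"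
      using that by (force simp: image_iff)
    then show ?thesis unfolding K0_def using finU by (intro Min_le) auto
  qed
  define B where "B = (\<lambda>(n, c, a, b). sym_prod (nprod V n c a) b) ` ({K0..-2} \<times> U \<times> U \<times> U) \<union>
    (\<lambda>(a, b). sym_prod a b) ` (U \<times> U)"
  define D where "D = complex_vector.span (C2_T2 \<union> B)"
  have D: "complex_vector.subspace D" unfolding D_def by (rule complex_vector.subspace_span)
  have C2_D: "C2_T2 \<subseteq> D" and B_D: "B \<subseteq> D" unfolding D_def by (auto intro: complex_vector.span_base)
  have lin: "clinear (\<lambda>c. sym_prod (nprod V n c a) b)" "clinear (\<lambda>a. sym_prod (nprod V n c a) b)"
    "clinear (\<lambda>b. sym_prod (nprod V n c a) b)" "clinear (\<lambda>a. sym_prod a b)" "clinear (\<lambda>b. sym_prod a b)"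
    for n a b c by (auto intro!: clinearI)
  have one: "sym_prod (nprod V n c a) b \<in> D"
    if "n \<le> -2" "c \<in> complex_vector.span U" "a \<in> complex_vector.span U" "b \<in> complex_vector.span U" for n c a b
  proof (rule clinear_span_mem[OF lin(1) D _ that(2)])
    fix c assume c: "c \<in> U"
    show "sym_prod (nprod V n c a) b \<in> D"
    proof (rule clinear_span_mem[OF lin(2) D _ that(3)])
      fix a assume a: "a \<in> U"
      show "sym_prod (nprod V n c a) b \<in> D"
      proof (rule clinear_span_mem[OF lin(3) D _ that(4)])
        fix b assume b: "b \<in> U"
        show "sym_prod (nprod V n c a) b \<in> D"
        proof (cases "n \<le> K0")
          case True
          then show ?thesis using K[OF c, of n a b] K0[OF c a b] C2_D by auto
        next
          case False
          then have "(n, c, a, b) \<in> {K0..-2} \<times> U \<times> U \<times> U" using that(1) c a b by simp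
          then have "sym_prod (nprod V n c a) b \<in> B" unfolding B_def by force
          then show ?thesis using B_D by blast
        qed
      qed
    qed
  qed
  have zero: "sym_prod a b \<in> D" if "a \<in> complex_vector.span U" "b \<in> complex_vector.span U" for a b
  proof (rule clinear_span_mem[OF lin(4) D _ that(1)])
    fix a assume a: "a \<in> U"
    show "sym_prod a b \<in> D"
      by (rule clinear_span_mem[OF lin(5) D _ that(2)]) (use a B_D in \<open>force simp: B_def\<close>)
  qed
  have pair: "pair_filt p \<subseteq> D" if "p \<ge> -1" for p
    using that
  proof (induction p rule: int_ge_induct)
    case base
    show ?case using pair_filt_negative[OF assms(1), of "-1"] complex_vector.subspace_0[OF D] by auto
  next
    case (step p)
    show ?case
    proof (rule pair_filt_step[OF D C2_D])
      show "pair_filt (p + 1 - 1) \<subseteq> D" using step.IH by simp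
      have low: "sym_prod a b \<in> D" if "a \<in> filt q" "b \<in> filt r" "q + r \<le> p" for a b q r
        using sym_prod_pair_filt[OF that] step.IH by blast
      fix a b q r assume a: "a \<in> weight_space V q" and b: "b \<in> weight_space V r"
      \<comment> \<open>A vector of weight above M lies in \<open>C2_weight\<close> and hence one
        filtration step lower, where the induction hypothesis applies.\<close>
      have high: "a \<in> filt (q - 1)" if "q > M" using M[OF that] a C2_weight_filt by blast
      have high': "b \<in> filt (r - 1)" if "r > M" using M[OF that] b C2_weight_filt by blast
      show "sym_prod a b \<in> D" if "q + r = p + 1"
      proof -
        consider "q > M" | "r > M" | "q \<le> M" "r \<le> M" by linarith
        then show ?thesis
        proof cases
          case 1
          then show ?thesis using low[OF high weight_filt[OF b order_refl]] that by simp
        next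
          case 2
          then show ?thesis using low[OF weight_filt[OF a order_refl] high'] that by simp
        next
          case 3
          then show ?thesis using zero a b spanU by blast
        qed
      qed
      show "sym_prod (nprod V n c a) b \<in> D"
        if n: "n \<le> -2" and c: "c \<in> weight_space V d" and sum: "d + q + r = p + 1" for c d n
      proof -
        consider "d > M" | "q > M" | "r > M" | "d \<le> M" "q \<le> M" "r \<le> M" by linarith
        then show ?thesis
        proof cases
          case 1
          then have "nprod V n c a \<in> filt (q + d - 1)"
            using M c by (intro filt_C2_mode[OF _ weight_filt[OF a order_refl] order_refl]) blast
          then show ?thesis using low[OF _ weight_filt[OF b order_refl]] sum by simp
        next
          case 2
          then have "nprod V n c a \<in> filt (q - 1 + d)" by (intro filt_creation[OF n c high]) simp_all
          then show ?thesis using low[OF _ weight_filt[OF b order_refl]] sum by simp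
        next
          case 3
          have "nprod V n c a \<in> filt (q + d)"
            by (rule filt_creation[OF n c weight_filt[OF a order_refl] order_refl])
          then show ?thesis using low[OF _ high'[OF 3]] sum by simp
        next
          case 4
          then show ?thesis using one[OF n] a b c spanU by blast
        qed
      qed
    qed
  qed
  have "pair_filt p \<subseteq> D" for p
    using pair[of p] pair_filt_negative[OF assms(1), of p] complex_vector.subspace_0[OF D] by force
  moreover have "finite B" unfolding B_def using finU by simp
  moreover have "\<forall>x\<in>B. tensor_swap x = x" unfolding B_def by auto
  ultimately show ?thesis unfolding D_def by blast
qed

lemma sym_prod_in_pair_filt:
  assumes "complex_vector.subspace D" "\<And>p. pair_filt p \<subseteq> D"
  shows "sym_prod a b \<in> D"
proof -
  have lin: "clinear (\<lambda>a. sym_prod a b)" "clinear (\<lambda>b. sym_prod a b)" for a b :: 'a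
    by (auto intro!: clinearI)
  have V: "a \<in> complex_vector.span (\<Union>d. weight_space V d)" for a using grading by simp
  show ?thesis
  proof (rule clinear_span_mem[OF lin(1) assms(1) _ V])
    fix a assume "a \<in> (\<Union>d. weight_space V d)"
    then obtain q where a: "a \<in> weight_space V q" by blast
    show "sym_prod a b \<in> D"
    proof (rule clinear_span_mem[OF lin(2) assms(1) _ V])
      fix b assume "b \<in> (\<Union>d. weight_space V d)"
      then obtain r where b: "b \<in> weight_space V r" by blast
      show "sym_prod a b \<in> D"
        using sym_prod_pair_filt[OF weight_filt[OF a order_refl] weight_filt[OF b order_refl] order_refl] assms(2) by blast
    qed
  qed
qed

text \<open>A symmetric x is half of x + \<open>tensor_swap x\<close>, and symmetrising pure tensors
  gives symmetric products.\<close>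

lemma sym_tensor_mem:
  assumes "complex_vector.subspace D" "\<And>a b. sym_prod a b \<in> D" "tensor_swap x = x"
  shows "x \<in> D"
proof -
  have "y + tensor_swap y \<in> D" for y
  proof (induction y rule: tensor_induct)
    case (pure a b)
    then show ?case using assms(2)[of a b] by (simp add: sym_prod_def)
  next
    case (add y z)
    from complex_vector.subspace_add[OF assms(1) this] show ?case by (simp add: algebra_simps)
  qed
  from this[of x] have "x + x \<in> D" using assms(3) by simp
  moreover have "x = (1/2) *\<^sub>C (x + x)"
    using scaleC_add_left[of "1/2" "1/2" x] by (simp add: scaleC_add_right scaleC_one)
  ultimately show ?thesis using complex_vector.subspace_scale[OF assms(1)] by metis
qed

end

section \<open>Descent to the orbifold\<close>

lemma span_Rep_sym_tensor:
  assumes "A \<subseteq> Rep_sym_tensor ` A'" "x \<in> complex_vector.span A"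
  shows "\<exists>y\<in>complex_vector.span A'. x = Rep_sym_tensor y"
  using assms(2)
proof (induction rule: complex_vector.span_induct_alt)
  case base
  show ?case by (rule bexI[of _ 0]) (simp_all add: zero_sym_tensor.rep_eq complex_vector.span_zero)
next
  case (step c v w)
  then obtain y where y: "y \<in> complex_vector.span A'" "w = Rep_sym_tensor y" by blast
  from step assms(1) obtain v' where v': "v' \<in> A'" "v = Rep_sym_tensor v'" by blast
  show ?case
    by (rule bexI[of _ "c *\<^sub>C v' + y"])
      (simp_all add: y v' plus_sym_tensor.rep_eq scaleC_sym_tensor.rep_eq
        complex_vector.span_add complex_vector.span_scale complex_vector.span_base)
qed

theorem theorem4p1:
  fixes V :: "'a::complex_vector voa"
  assumes "vertex_operator_algebra V"
    and "simple_voa V"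
    and "CFT_type V"
    and "C2_cofinite V"
  shows "C2_cofinite (T2_S2 V)"
proof -
  interpret vertex_operator_algebra V by (rule assms(1))
  obtain B where B: "finite B" "\<forall>x\<in>B. tensor_swap x = x"
    "\<And>p. pair_filt p \<subseteq> complex_vector.span (C2_T2 \<union> B)"
    using pair_filt_finite[OF assms(3,4)] by blast
  let ?B = "Abs_sym_tensor ` B" and ?G = "{nprod (T2_S2 V) (-2) a b | a b. True}"
  have subB: "B \<subseteq> Rep_sym_tensor ` ?B"
  proof
    fix x assume "x \<in> B"
    with B(2) show "x \<in> Rep_sym_tensor ` ?B"
      by (intro image_eqI[of _ _ "Abs_sym_tensor x"]) (simp_all add: Abs_sym_tensor_inverse)
  qed
  have subC: "{nprod (T2 V) (-2) x y | x y. tensor_swap x = x \<and> tensor_swap y = y} \<subseteq> Rep_sym_tensor ` ?G"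
  proof
    fix s assume "s \<in> {nprod (T2 V) (-2) x y | x y. tensor_swap x = x \<and> tensor_swap y = y}"
    then obtain x y where s: "s = nprod (T2 V) (-2) x y" "tensor_swap x = x" "tensor_swap y = y" by blast
    then have "s = Rep_sym_tensor (nprod (T2_S2 V) (-2) (Abs_sym_tensor x) (Abs_sym_tensor y))"
      by (simp add: Rep_T2_S2_nprod[OF assms(1)] Abs_sym_tensor_inverse)
    then show "s \<in> Rep_sym_tensor ` ?G" by blast
  qed
  have "\<exists>u\<in>complex_vector.span ?B. v - u \<in> C2_space (T2_S2 V)" for v
  proof -
    \<comment> \<open>The decomposition is found in the tensor square and pulled back along the
      injective linear map \<open>Rep_sym_tensor\<close>.\<close>
    have "Rep_sym_tensor v \<in> complex_vector.span (C2_T2 \<union> B)"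
      by (rule sym_tensor_mem[OF complex_vector.subspace_span sym_prod_in_pair_filt[OF complex_vector.subspace_span B(3)]])
        (use Rep_sym_tensor[of v] in simp)
    then obtain c w where cw: "Rep_sym_tensor v = c + w" "c \<in> C2_T2" "w \<in> complex_vector.span B"
      unfolding complex_vector.span_Un C2_T2_def complex_vector.span_span by blast
    obtain c' where c': "c' \<in> complex_vector.span ?G" "c = Rep_sym_tensor c'"
      using span_Rep_sym_tensor[OF subC] cw(2) unfolding C2_T2_def by blast
    obtain u where u: "u \<in> complex_vector.span ?B" "w = Rep_sym_tensor u"
      using span_Rep_sym_tensor[OF subB cw(3)] by blast
    have "v = c' + u"
      using cw(1) unfolding c'(2) u(2) by (simp add: plus_sym_tensor.rep_eq[symmetric] Rep_sym_tensor_inject)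
    with c'(1) u(1) show ?thesis unfolding C2_space_def by (intro bexI[of _ u]) simp_all
  qed
  then show ?thesis
    unfolding C2_cofinite_def finite_dim_quotient_def using B(1) by blast
qed

end
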